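(* Assume the oracle used is an $r$-approximation, $r\ge 1$. With threshold payments, the mechanism Modified-Random-OM$(0.5,A,B)$ is (universally) truthful, budget feasible, and its (random) winning set $S$ satisfies $4r\,E[v(S)]\ge opt(A,B)$. With Sviridenko's greedy algorithm as the oracle, the mechanism can be implemented in polynomial time (given value-oracle access to $v$), and it is a $\frac{4e}{e-1}$-approximation mechanism.
   Context: Setting. A buyer with budget $B>0$ faces a finite set $A$ of $n$ sellers. Seller $i$ owns one item (also called $i$) and has a private cost $c_i\ge 0$; his utility when selling at payment $p_i$ is $p_i-c_i$. The buyer's value $v:2^A\to\mathbb{R}_{\ge 0}$ is monotone non-decreasing and submodular. Write $v(i)=v(\{i\})$, $m_i(S)=v(S\cup\{i\})-v(S)$, $c(S)=\sum_{i\in S}c_i$, and $opt(A,B)=\max\{v(S):S\subseteq A,\ c(S)\le B\}$ (with respect to the cost vector $c$). Mechanisms. A deterministic allocation rule $f$ maps each declared cost vector $c$ to a winning set $f(c)\subseteq A$. Threshold payments: a winner $i$ is paid $p_i=\inf\{b: i\notin f(b,c_{-i})\}$, losers are paid $0$. A deterministic mechanism is truthful if declaring the true cost is always a dominant strategy for each seller; a randomized mechanism is universally truthful if it is a randomization over truthful deterministic mechanisms. It is budget feasible if for every cost vector (and every realization of the randomness) the total payment is at most $B$. Oracle. $Oracle(A,c)$ is a deterministic real-valued function of the seller set and cost vector (with $B$, $v$ fixed) that never exceeds the optimum value $opt(A,B)$ computed with costs $c$; it is an $r$-approximation if $r$ times its value is always at least that optimum. Sviridenko's greedy algorithm is an $\frac{e}{e-1}$-approximation: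 it takes the best among all sets of at most two items with cost at most $B$ and all sets obtained as follows from each set of three items with cost at most $B$: repeatedly take the remaining item maximizing marginal value over cost, add it if the total cost stays at most $B$ and otherwise discard it, until no items remain. Greedy order. $S_0=\emptyset$ and $S_i=S_{i-1}\cup\{\arg\max_{j\in A\setminus S_{i-1}} m_j(S_{i-1})/c_j\}$, ties broken by a fixed order on sellers; the ratio is $0$ if $m_j(S_{i-1})=0$ and $+\infty$ if $c_j=0<m_j(S_{i-1})$. Items are renamed so that $S_i\setminus S_{i-1}=\{i\}$. Modified-Greedy-OM$(\alpha,A,B)$: start with $S=\emptyset$; for $i=1,\dots,|A|$, add $i$ to $S$ if $v(S_i)\le\alpha\,\max_{c_i'\ge c_i}Oracle(A,(c_i',c_{-i}))$ (the maximum read as a supremum if not attained); return $S$. Modified-Random-OM$(\alpha,A,B)$: replace $A$ by $\{i\in A:c_i\le B\}$ (return $\emptyset$ if this is empty); let $i^*\in\arg\max_{i\in A}v(i)$; with probability $\frac12$ return Modified-Greedy-OM$(\alpha,A,B)$, otherwise return $\{i^*\}$.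
   Formalization: Budget feasibility is claimed only when at most one seller i has v(i)=0: if two sellers have value 0 and all others cost more than B, both win with threshold payment B each, 2B in total, so the unrestricted claim is false. *)

theory Defs
  imports
    "HOL-Probability.Probability"
    "HOL-Computational_Algebra.Polynomial"
begin

section \<open>Valuations and the optimum\<close>

definition valuation_on :: "'a set \<Rightarrow> ('a set \<Rightarrow> real) \<Rightarrow> bool" where
  "valuation_on A v \<longleftrightarrow>
     (\<forall>S. S \<subseteq> A \<longrightarrow> 0 \<le> v S) \<and>
     (\<forall>S T. S \<subseteq> T \<and> T \<subseteq> A \<longrightarrow> v S \<le> v T) \<and>
     (\<forall>S T. S \<subseteq> A \<and> T \<subseteq> A \<longrightarrow> v (S \<union> T) + v (S \<inter> T) \<le> v S + v T)"

definition cost_vector_on :: "'a set \<Rightarrow> ('a \<Rightarrow> real) \<Rightarrow> bool" where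
  "cost_vector_on A c \<longleftrightarrow> (\<forall>i\<in>A. 0 \<le> c i)"

definition marginal :: "('a set \<Rightarrow> real) \<Rightarrow> 'a \<Rightarrow> 'a set \<Rightarrow> real" where
  "marginal v i S = v (insert i S) - v S"

definition opt :: "('a set \<Rightarrow> real) \<Rightarrow> real \<Rightarrow> 'a set \<Rightarrow> ('a \<Rightarrow> real) \<Rightarrow> real" where
  "opt v B A c = Max (v ` {S. S \<subseteq> A \<and> sum c S \<le> B})"


section \<open>Mechanisms\<close>

text \<open>A deterministic mechanism is an allocation rule together with a payment rule, both acting
  on declared cost vectors; a randomized mechanism is a distribution over deterministic ones.\<close>

type_synonym 'a allocation = "('a \<Rightarrow> real) \<Rightarrow> 'a set"
type_synonym 'a payment = "('a \<Rightarrow> real) \<Rightarrow> 'a \<Rightarrow> real"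
type_synonym 'a mechanism = "'a allocation \<times> 'a payment"

text \<open>The infimum is over a nonempty set for all rules considered below: they reject every bid
  above the budget.\<close>

definition threshold_payment :: "'a allocation \<Rightarrow> 'a payment" where
  "threshold_payment f c i =
     (if i \<in> f c then Inf {b. 0 \<le> b \<and> i \<notin> f (c(i := b))} else 0)"

definition with_threshold_payments :: "'a allocation \<Rightarrow> 'a mechanism" where
  "with_threshold_payments f = (f, threshold_payment f)"

text \<open>The utility of seller \<open>i\<close> with true cost \<open>t\<close> when the declared cost vector is \<open>d\<close>.\<close>

definition utility :: "'a mechanism \<Rightarrow> 'a \<Rightarrow> real \<Rightarrow> ('a \<Rightarrow> real) \<Rightarrow> real" where
  "utility M i t d = snd M d i - (if i \<in> fst M d then t else 0)"

definition truthful :: "'a set \<Rightarrow> 'a mechanism \<Rightarrow> bool" where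
  "truthful A M \<longleftrightarrow>
     (\<forall>c. cost_vector_on A c \<longrightarrow>
        (\<forall>i\<in>A. \<forall>b\<ge>0. utility M i (c i) (c(i := b)) \<le> utility M i (c i) c))"

definition universally_truthful :: "'a set \<Rightarrow> 'a mechanism pmf \<Rightarrow> bool" where
  "universally_truthful A \<M> \<longleftrightarrow> (\<forall>M \<in> set_pmf \<M>. truthful A M)"

definition budget_feasible :: "'a set \<Rightarrow> real \<Rightarrow> 'a mechanism pmf \<Rightarrow> bool" where
  "budget_feasible A B \<M> \<longleftrightarrow>
     (\<forall>M \<in> set_pmf \<M>. \<forall>c. cost_vector_on A c \<longrightarrow> (\<Sum>i\<in>A. snd M c i) \<le> B)"

definition approximates_opt ::
    "real \<Rightarrow> 'a set \<Rightarrow> ('a set \<Rightarrow> real) \<Rightarrow> real \<Rightarrow> 'a mechanism pmf \<Rightarrow> bool" where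
  "approximates_opt \<rho> A v B \<M> \<longleftrightarrow>
     (\<forall>c. cost_vector_on A c \<longrightarrow>
        \<rho> * measure_pmf.expectation \<M> (\<lambda>M. v (fst M c)) \<ge> opt v B A c)"


section \<open>Oracles for the optimum and the greedy order\<close>

text \<open>The algorithm estimating the optimum is also called on the sets of affordable sellers, hence the quantification over
  subsets of \<open>A\<close>.\<close>

type_synonym 'a opt_oracle = "'a set \<Rightarrow> ('a \<Rightarrow> real) \<Rightarrow> real"

definition approx_oracle :: "real \<Rightarrow> 'a set \<Rightarrow> ('a set \<Rightarrow> real) \<Rightarrow> real \<Rightarrow> 'a opt_oracle \<Rightarrow> bool" where
  "approx_oracle r A v B Orc \<longleftrightarrow>
     (\<forall>A' c. A' \<subseteq> A \<and> cost_vector_on A c \<longrightarrow>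
        Orc A' c \<le> opt v B A' c \<and> opt v B A' c \<le> r * Orc A' c)"

definition ratio :: "('a set \<Rightarrow> real) \<Rightarrow> ('a \<Rightarrow> real) \<Rightarrow> 'a set \<Rightarrow> 'a \<Rightarrow> ereal" where
  "ratio v c S j =
     (if marginal v j S = 0 then 0
      else if c j = 0 then \<infinity>
      else ereal (marginal v j S / c j))"

text \<open>The fixed order on sellers is the order of their type; the smallest maximizer is taken.\<close>

definition best_item ::
    "('a::linorder set \<Rightarrow> real) \<Rightarrow> ('a \<Rightarrow> real) \<Rightarrow> 'a set \<Rightarrow> 'a set \<Rightarrow> 'a" where
  "best_item v c S R = Min {j \<in> R. \<forall>k\<in>R. ratio v c S k \<le> ratio v c S j}"

primrec greedy_prefix ::
    "('a::linorder set \<Rightarrow> real) \<Rightarrow> ('a \<Rightarrow> real) \<Rightarrow> 'a set \<Rightarrow> nat \<Rightarrow> 'a set" where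
  "greedy_prefix v c A 0 = {}"
| "greedy_prefix v c A (Suc k) =
     insert (best_item v c (greedy_prefix v c A k) (A - greedy_prefix v c A k))
       (greedy_prefix v c A k)"

text \<open>The item in which the prefixes of sizes \<open>k\<close> and \<open>k + 1\<close> differ.\<close>

definition greedy_item ::
    "('a::linorder set \<Rightarrow> real) \<Rightarrow> ('a \<Rightarrow> real) \<Rightarrow> 'a set \<Rightarrow> nat \<Rightarrow> 'a" where
  "greedy_item v c A k = best_item v c (greedy_prefix v c A k) (A - greedy_prefix v c A k)"


section \<open>The mechanism\<close>

definition modified_greedy_om ::
    "'a::linorder opt_oracle \<Rightarrow> real \<Rightarrow> ('a set \<Rightarrow> real) \<Rightarrow> 'a set \<Rightarrow> 'a allocation" where
  "modified_greedy_om Orc \<alpha> v A c =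
     {i. \<exists>k < card A. i = greedy_item v c A k \<and>
           v (greedy_prefix v c A (Suc k)) \<le> \<alpha> * (SUP x\<in>{c i..}. Orc A (c(i := x)))}"

text \<open>The choice among the maximizers must not depend on the costs, or truthfulness would fail;
  the fixed order on sellers decides here as well.\<close>

definition most_valuable :: "('a::linorder set \<Rightarrow> real) \<Rightarrow> 'a set \<Rightarrow> 'a" where
  "most_valuable v A = Min {i \<in> A. \<forall>j\<in>A. v {j} \<le> v {i}}"

definition random_om_branch ::
    "'a::linorder opt_oracle \<Rightarrow> real \<Rightarrow> ('a set \<Rightarrow> real) \<Rightarrow> real \<Rightarrow> 'a set \<Rightarrow> bool \<Rightarrow> 'a mechanism" where
  "random_om_branch Orc \<alpha> v B A heads =
     with_threshold_payments (\<lambda>c.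
       let A' = {i \<in> A. c i \<le> B} in
       if A' = {} then {}
       else if heads then modified_greedy_om Orc \<alpha> v A' c
       else {most_valuable v A'})"

definition modified_random_om ::
    "'a::linorder opt_oracle \<Rightarrow> real \<Rightarrow> ('a set \<Rightarrow> real) \<Rightarrow> real \<Rightarrow> 'a set \<Rightarrow> 'a mechanism pmf" where
  "modified_random_om Orc \<alpha> v B A =
     map_pmf (random_om_branch Orc \<alpha> v B A) (bernoulli_pmf (1/2))"

text \<open>If two sellers have value 0 and all others declare costs above \<open>B\<close>, then on the affordable
  set both the optimum and its estimate are 0 and both sellers pass the test \<open>0 \<le> \<alpha> * 0\<close> at every bid up
  to \<open>B\<close>; each has threshold payment \<open>B\<close> and the total is \<open>2 * B\<close>. Budget feasibility therefore
  needs the following condition.\<close>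

definition at_most_one_worthless :: "'a set \<Rightarrow> ('a set \<Rightarrow> real) \<Rightarrow> bool" where
  "at_most_one_worthless A v \<longleftrightarrow> (\<forall>i\<in>A. \<forall>j\<in>A. v {i} = 0 \<and> v {j} = 0 \<longrightarrow> i = j)"


section \<open>Sviridenko's greedy algorithm\<close>

text \<open>A state consists of the items taken so far and the items not yet considered.\<close>

definition fill_step ::
    "('a::linorder set \<Rightarrow> real) \<Rightarrow> real \<Rightarrow> ('a \<Rightarrow> real) \<Rightarrow> 'a set \<times> 'a set \<Rightarrow> 'a set \<times> 'a set" where
  "fill_step v B c = (\<lambda>(T, R).
     let j = best_item v c T R in
     (if sum c T + c j \<le> B then insert j T else T, R - {j}))"

definition greedy_fill ::
    "('a::linorder set \<Rightarrow> real) \<Rightarrow> real \<Rightarrow> 'a set \<Rightarrow> ('a \<Rightarrow> real) \<Rightarrow> 'a set \<Rightarrow> 'a set" where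
  "greedy_fill v B A c U = fst ((fill_step v B c ^^ card (A - U)) (U, A - U))"

definition sviridenko :: "('a::linorder set \<Rightarrow> real) \<Rightarrow> real \<Rightarrow> 'a opt_oracle" where
  "sviridenko v B A c =
     Max (v ` ({S. S \<subseteq> A \<and> card S \<le> 2 \<and> sum c S \<le> B} \<union>
               greedy_fill v B A c ` {U. U \<subseteq> A \<and> card U = 3 \<and> sum c U \<le> B}))"


section \<open>Polynomial time given access to a valuation\<close>

text \<open>
  Algorithms are programs of a real RAM with arrays of natural numbers, arrays of reals, and an
  instruction that queries the valuation. A scalar is cell 0 of an array. Each instruction and
  each loop iteration is one step; a program is fixed for all inputs, so its expressions have
  constant size.

  The machine is deliberately restricted, which makes the existence of a program a stronger claim.
  Loops are bounded (the number of iterations is fixed on entry), so all programs terminate.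
  Naturals can only be added and subtracted. Stored reals are obtained by additions, subtractions
  and queries; products and quotients occur only in tests and in the write-only payments. Hence a
  program with polynomially many steps is polynomial not only with unit-cost real arithmetic: for
  rational data all numbers involved also have polynomially many bits.\<close>

type_synonym vname = string

datatype nexp =
    NConst nat
  | NGet vname nexp
  | NAdd nexp nexp
  | NSub nexp nexp

datatype lexp =
    LConst int
  | LGet vname nexp
  | LAdd lexp lexp
  | LSub lexp lexp

datatype rexp =
    RLin lexp
  | RAdd rexp rexp
  | RSub rexp rexp
  | RMul rexp rexp
  | RDiv rexp rexp

datatype bexp =
    NLe nexp nexp
  | RLe rexp rexp
  | BNot bexp
  | BAnd bexp bexp

datatype com =
    Skip
  | NSet vname nexp nexp      \<comment> \<open>\<open>NSet x k e\<close>: \<open>x[k] := e\<close>\<close>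
  | LSet vname nexp lexp
  | Query vname nexp vname    \<comment> \<open>\<open>Query x k y\<close>: \<open>x[k] := v {i. i < n \<and> y[i] \<noteq> 0}\<close>\<close>
  | Pay nexp rexp             \<comment> \<open>set the payment of a seller\<close>
  | Seq com com
  | Cond bexp com com
  | For vname nexp com        \<comment> \<open>\<open>For x e p\<close>: run \<open>p\<close> with \<open>x[0] = 0, 1, \<dots>, e - 1\<close>\<close>

record state =
  nats :: "vname \<Rightarrow> nat \<Rightarrow> nat"
  reals :: "vname \<Rightarrow> nat \<Rightarrow> real"
  pays :: "nat \<Rightarrow> real"

definition store :: "vname \<Rightarrow> nat \<Rightarrow> 'b \<Rightarrow> (vname \<Rightarrow> nat \<Rightarrow> 'b) \<Rightarrow> vname \<Rightarrow> nat \<Rightarrow> 'b" where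
  "store x k a m = m(x := (m x)(k := a))"

primrec nval :: "nexp \<Rightarrow> state \<Rightarrow> nat" where
  "nval (NConst k) s = k"
| "nval (NGet x e) s = nats s x (nval e s)"
| "nval (NAdd a b) s = nval a s + nval b s"
| "nval (NSub a b) s = nval a s - nval b s"

primrec lval :: "lexp \<Rightarrow> state \<Rightarrow> real" where
  "lval (LConst k) s = of_int k"
| "lval (LGet x e) s = reals s x (nval e s)"
| "lval (LAdd a b) s = lval a s + lval b s"
| "lval (LSub a b) s = lval a s - lval b s"

primrec rval :: "rexp \<Rightarrow> state \<Rightarrow> real" where
  "rval (RLin e) s = lval e s"
| "rval (RAdd a b) s = rval a s + rval b s"
| "rval (RSub a b) s = rval a s - rval b s"
| "rval (RMul a b) s = rval a s * rval b s"
| "rval (RDiv a b) s = rval a s / rval b s"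

primrec bval :: "bexp \<Rightarrow> state \<Rightarrow> bool" where
  "bval (NLe a b) s = (nval a s \<le> nval b s)"
| "bval (RLe a b) s = (rval a s \<le> rval b s)"
| "bval (BNot a) s = (\<not> bval a s)"
| "bval (BAnd a b) s = (bval a s \<and> bval b s)"

text \<open>\<open>exec n v p s\<close> is the final state and the number of steps of \<open>p\<close> started in \<open>s\<close>, for a
  valuation \<open>v\<close> of the sellers \<open>{..<n}\<close>.\<close>

primrec exec :: "nat \<Rightarrow> (nat set \<Rightarrow> real) \<Rightarrow> com \<Rightarrow> state \<Rightarrow> state \<times> nat" where
  "exec n v Skip s = (s, 1)"
| "exec n v (NSet x k e) s = (s\<lparr>nats := store x (nval k s) (nval e s) (nats s)\<rparr>, 1)"
| "exec n v (LSet x k e) s = (s\<lparr>reals := store x (nval k s) (lval e s) (reals s)\<rparr>, 1)"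
| "exec n v (Query x k y) s =
     (s\<lparr>reals := store x (nval k s) (v {i. i < n \<and> nats s y i \<noteq> 0}) (reals s)\<rparr>, 1)"
| "exec n v (Pay k e) s = (s\<lparr>pays := (pays s)(nval k s := rval e s)\<rparr>, 1)"
| "exec n v (Seq p q) s =
     (let (s', t) = exec n v p s; (s'', t') = exec n v q s' in (s'', t + t'))"
| "exec n v (Cond b p q) s =
     (let (s', t) = (if bval b s then exec n v p s else exec n v q s) in (s', t + 1))"
| "exec n v (For x e p) s =
     fold (\<lambda>k (s, t).
         let (s', t') = exec n v p (s\<lparr>nats := store x 0 k (nats s)\<rparr>) in (s', t + t' + 1))
       [0..<nval e s] (s, 1)"

text \<open>The coin is part of the input; all cells not mentioned are 0 initially.\<close>

definition initial_state :: "nat \<Rightarrow> real \<Rightarrow> (nat \<Rightarrow> real) \<Rightarrow> bool \<Rightarrow> state" where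
  "initial_state n B c heads =
     \<lparr>nats = store ''n'' 0 n (store ''coin'' 0 (if heads then 1 else 0) (\<lambda>_ _. 0)),
      reals = (store ''B'' 0 B (\<lambda>_ _. 0)) (''c'' := (\<lambda>i. if i < n then c i else 0)),
      pays = (\<lambda>_. 0)\<rparr>"

text \<open>For a mechanism that tosses one coin: a single program computes the winners (into the array
  \<open>''win''\<close>) and the payments for every number \<open>n\<close> of sellers, named \<open>0, \<dots>, n - 1\<close> in the fixed
  order, all budgets, valuations and costs.\<close>

definition polynomial_time ::
    "((nat set \<Rightarrow> real) \<Rightarrow> real \<Rightarrow> nat set \<Rightarrow> bool \<Rightarrow> nat mechanism) \<Rightarrow> bool" where
  "polynomial_time mech \<longleftrightarrow>
     (\<exists>p (q :: nat poly). \<forall>n v B c heads.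
        0 < B \<and> valuation_on {..<n} v \<and> cost_vector_on {..<n} c \<longrightarrow>
        (let (s, t) = exec n v p (initial_state n B c heads); (f, pay) = mech v B {..<n} heads in
           t \<le> poly q n \<and>
           {i. i < n \<and> nats s ''win'' i \<noteq> 0} = f c \<and>
           (\<forall>i<n. pays s i = pay c i)))"

end

theory Submission
  imports Defs
begin

text \<open>
  Truthfulness. With the other costs fixed, consider the greedy order of the other sellers. Seller \<open>i\<close>
  enters it at the first state whose best item it beats, so a lower bid lets it enter earlier, with a
  smaller prefix, while the supremum of the estimate over higher bids can only grow. Hence winning is
  monotone in the bid.

  Budget. A seller winning with the bid \<open>b\<close> after the prefix \<open>T\<close> satisfies
  \<open>b \<le> 2 B m\<^sub>i(T) / opt\<close>: the prefix including \<open>i\<close> is worth at most half the optimum, and the items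
  completing an optimal set have at most the ratio of \<open>i\<close>. The winners' marginal values add up to at
  most half the optimum. Approximation. The longest prefix worth at most \<open>opt / (2 r)\<close> wins, and
  adding the most valuable seller makes up for the item that was too much.

  Polynomial time. The threshold of \<open>i\<close> is the largest bid \<open>x\<close> for which, at some state of the greedy
  order, \<open>i\<close> is best and some bid of at least \<open>x\<close> brings the estimate up to a required value \<open>V\<close>. The
  estimate is not monotone in the bid, but only the following matters. Starting from a set of at most
  three sellers, \<open>i\<close> is inserted at the first state that it beats, an interval of bids bounded by
  ratios of products of marginal values and costs. After that, whether the value \<open>V\<close> is reached depends
  on the run that accepts exactly the items keeping the value below \<open>V\<close>; this run does not depend on
  the remaining budget, hence not on the bid, so it yields the largest admissible bid directly.
\<close>

section \<open>Valuations, ratios and best items\<close>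

text \<open>With a share \<open>\<alpha>\<close> in place of 1/2 the budget argument would bound the
  payments by \<open>B * \<alpha> / (1 - \<alpha>)\<close>, so 1/2 is the largest share it allows;
  in the approximation 1/2 turns \<open>r\<close> into \<open>2 * r\<close>, and the coin doubles
  this. The obstacle in the last part is that a bid acts on the estimate through the ratios, through
  the remaining budget and through every later decision, while the machine can neither search over
  the reals nor store a product. The dependence on the budget goes away by domination: when the best
  item is rejected, the remaining budget is smaller than its cost and no candidate has a better
  ratio, so everything bought later adds at most the marginal value of the rejected item. A run that
  ignores the budget therefore finds the sets that matter, and what such a set leaves of the budget
  is the largest bid it tolerates. Because of ties a supremum of winning bids need not be attained;
  bounds therefore carry a flag, and a set of bids is tracked only up to its supremum.\<close>

lemma marginal_member: "i \<in> S \<Longrightarrow> marginal v i S = 0"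
  by (simp add: marginal_def insert_absorb)

locale valued =
  fixes A :: "'a::linorder set" and v :: "'a set \<Rightarrow> real"
  assumes finite_A: "finite A" and valuation: "valuation_on A v"
begin

lemma finite_sub: "S \<subseteq> A \<Longrightarrow> finite S"
  by (rule finite_subset[OF _ finite_A])

lemma value_nonneg: "S \<subseteq> A \<Longrightarrow> 0 \<le> v S"
  using valuation unfolding valuation_on_def by blast

lemma value_mono: "S \<subseteq> T \<Longrightarrow> T \<subseteq> A \<Longrightarrow> v S \<le> v T"
  using valuation unfolding valuation_on_def by blast

lemma submodular: "S \<subseteq> A \<Longrightarrow> T \<subseteq> A \<Longrightarrow> v (S \<union> T) + v (S \<inter> T) \<le> v S + v T"
  using valuation unfolding valuation_on_def by blast

lemma valued_subset: "A' \<subseteq> A \<Longrightarrow> valued A' v"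
  using finite_A valuation finite_subset[of A' A] subset_trans[of _ A' A]
  unfolding valued_def valuation_on_def by metis

lemma marginal_nonneg: "S \<subseteq> A \<Longrightarrow> i \<in> A \<Longrightarrow> 0 \<le> marginal v i S"
  using value_mono[of S "insert i S"] by (auto simp: marginal_def)

lemma marginal_antimono:
  assumes "S \<subseteq> T" "T \<subseteq> A" "i \<in> A"
  shows "marginal v i T \<le> marginal v i S"
proof (cases "i \<in> T")
  case True
  then show ?thesis
    using marginal_nonneg[of S i] assms by (auto simp: marginal_member)
next
  case False
  have "insert i S \<union> T = insert i T" "insert i S \<inter> T = S" "S \<subseteq> A"
    using assms False by auto
  then show ?thesis
    using submodular[of "insert i S" T] assms unfolding marginal_def by simp
qed

lemma value_union_le:
  assumes "S \<subseteq> A" "T \<subseteq> A"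
  shows "v (S \<union> T) \<le> v S + (\<Sum>x\<in>T - S. marginal v x S)"
proof -
  have "finite T" using assms finite_A finite_subset by auto
  then show ?thesis using assms(2)
  proof (induction T)
    case (insert x F)
    show ?case
    proof (cases "x \<in> S")
      case True
      then have "S \<union> insert x F = S \<union> F" "insert x F - S = F - S" by auto
      then show ?thesis using insert by simp
    next
      case False
      have "marginal v x (S \<union> F) \<le> marginal v x S"
        using insert assms by (intro marginal_antimono) auto
      moreover have "insert x F - S = insert x (F - S)" using False by auto
      ultimately show ?thesis using insert by (simp add: marginal_def)
    qed
  qed simp
qed

lemma value_insert_le: "S \<subseteq> A \<Longrightarrow> i \<in> A \<Longrightarrow> v (insert i S) \<le> v S + v {i}"
  using submodular[of S "{i}"] value_nonneg[of "S \<inter> {i}"] by (simp add: le_infI1)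

text \<open>Two cost vectors, since the ratio of a rival under \<open>c\<close> is later compared
  with that of \<open>i\<close> under \<open>c(i := x)\<close>. Multiplying out the denominators
  absorbs the conventions for zero marginal values and zero costs, and gives the form in which the
  machine compares ratios.\<close>

lemma ratio_less_iff:
  assumes "T \<subseteq> A" "j \<in> A" "k \<in> A" "0 \<le> c j" "0 \<le> d k"
  shows "ratio v c T j < ratio v d T k \<longleftrightarrow>
    0 < marginal v k T \<and> (marginal v j T = 0 \<or> marginal v j T * d k < marginal v k T * c j)"
proof -
  have m: "0 \<le> marginal v j T" "0 \<le> marginal v k T"
    using assms by (auto intro: marginal_nonneg)
  consider "marginal v k T = 0" | "marginal v k T > 0" "marginal v j T = 0"
    | "marginal v k T > 0" "marginal v j T > 0" "c j = 0"
    | "marginal v k T > 0" "marginal v j T > 0" "c j > 0" "d k = 0"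
    | "marginal v k T > 0" "marginal v j T > 0" "c j > 0" "d k > 0"
    using m assms(4,5) by fastforce
  then show ?thesis
  proof cases
    case 1
    then show ?thesis using m assms(4) by (auto simp: ratio_def zero_ereal_def not_less)
  next
    case 2
    then show ?thesis using assms(5) by (cases "d k = 0") (auto simp: ratio_def zero_ereal_def)
  next
    case 3
    then show ?thesis using assms(5) by (auto simp: ratio_def not_less)
  next
    case 4
    then show ?thesis by (simp add: ratio_def)
  next
    case 5
    then show ?thesis by (simp add: ratio_def frac_less_eq divide_less_eq field_simps)
  qed
qed

lemma ratio_le_cross:
  assumes "T \<subseteq> A" "j \<in> A" "k \<in> A" "0 \<le> c j" "0 \<le> c k" "ratio v c T k \<le> ratio v c T j"
  shows "marginal v k T * c j \<le> marginal v j T * c k"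
proof -
  have "\<not> (0 < marginal v k T \<and> marginal v j T * c k < marginal v k T * c j)"
    using ratio_less_iff[of T j k c c] assms by (metis not_less)
  moreover have "0 \<le> marginal v k T" "0 \<le> marginal v j T * c k"
    using assms by (auto intro!: mult_nonneg_nonneg marginal_nonneg)
  ultimately show ?thesis by (cases "marginal v k T = 0") (auto simp: not_less)
qed

lemma best_item_props:
  assumes "finite R" "R \<noteq> {}"
  shows best_item_in: "best_item v c T R \<in> R"
    and best_item_max: "k \<in> R \<Longrightarrow> ratio v c T k \<le> ratio v c T (best_item v c T R)"
    and best_item_first: "k \<in> R \<Longrightarrow> k < best_item v c T R \<Longrightarrow>
      ratio v c T k < ratio v c T (best_item v c T R)"
proof -
  let ?M = "{j \<in> R. \<forall>k\<in>R. ratio v c T k \<le> ratio v c T j}"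
  have fin: "finite (ratio v c T ` R)" "ratio v c T ` R \<noteq> {}" using assms by auto
  have "Max (ratio v c T ` R) \<in> ratio v c T ` R" using Max_in fin by blast
  then obtain j where "j \<in> R" "ratio v c T j = Max (ratio v c T ` R)" by auto
  then have "j \<in> ?M" using fin by auto
  then have ne: "?M \<noteq> {}" by blast
  have fM: "finite ?M" using assms by auto
  have M: "best_item v c T R \<in> ?M" unfolding best_item_def using Min_in[OF fM ne] .
  then show "best_item v c T R \<in> R" by blast
  show max: "k \<in> R \<Longrightarrow> ratio v c T k \<le> ratio v c T (best_item v c T R)" for k using M by blast
  assume k: "k \<in> R" "k < best_item v c T R"
  then have "k \<notin> ?M" using Min_le[OF fM, of k] unfolding best_item_def by force
  then obtain l where "l \<in> R" "ratio v c T k < ratio v c T l" using k by (auto simp: not_le)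
  then show "ratio v c T k < ratio v c T (best_item v c T R)" using max by fastforce
qed

lemma best_item_eqI:
  assumes "finite R" "j \<in> R"
    "\<And>k. k \<in> R \<Longrightarrow> ratio v c T k \<le> ratio v c T j"
    "\<And>k. k \<in> R \<Longrightarrow> k < j \<Longrightarrow> ratio v c T k < ratio v c T j"
  shows "best_item v c T R = j"
proof -
  let ?b = "best_item v c T R"
  have ne: "R \<noteq> {}" using assms by auto
  note b = best_item_props[OF assms(1) ne, where c = c and T = T]
  have eq: "ratio v c T j = ratio v c T ?b"
    using b(2)[OF assms(2)] assms(3)[OF b(1)] by simp
  show ?thesis
    using b(3)[OF assms(2)] assms(4)[OF b(1)] eq by (metis less_irrefl neqE)
qed

lemma best_item_cong:
  assumes "\<And>k. k \<in> R \<Longrightarrow> c k = d k"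
  shows "best_item v c T R = best_item v d T R"
proof -
  have "ratio v c T k = ratio v d T k" if "k \<in> R" for k
    using assms that by (simp add: ratio_def)
  then have "{j \<in> R. \<forall>k\<in>R. ratio v c T k \<le> ratio v c T j} = {j \<in> R. \<forall>k\<in>R. ratio v d T k \<le> ratio v d T j}"
    by auto
  then show ?thesis by (simp add: best_item_def)
qed

lemma best_item_upd: "i \<notin> R \<Longrightarrow> best_item v (c(i := x)) T R = best_item v c T R"
  by (rule best_item_cong) auto

lemma best_item_insert:
  fixes c :: "'a \<Rightarrow> real" and T :: "'a set"
  assumes "finite R" "R \<noteq> {}" "i \<notin> R"
  defines "j \<equiv> best_item v c T R"
  shows "best_item v c T (insert i R) =
    (if ratio v c T j < ratio v c T i \<or> ratio v c T j = ratio v c T i \<and> i < j then i else j)"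
proof -
  note b = best_item_props[OF assms(1,2), where c = c and T = T, folded j_def]
  have ij: "i \<noteq> j" using b(1) assms by auto
  show ?thesis
  proof (cases "ratio v c T j < ratio v c T i \<or> ratio v c T j = ratio v c T i \<and> i < j")
    case True
    have "best_item v c T (insert i R) = i"
    proof (rule best_item_eqI)
      fix k assume k: "k \<in> insert i R"
      show "ratio v c T k \<le> ratio v c T i" using k b(2)[of k] True by auto
      assume "k < i"
      then show "ratio v c T k < ratio v c T i" using k b(2)[of k] b(3)[of k] True
        by (auto intro: le_less_trans)
    qed (use assms in auto)
    with True show ?thesis by simp
  next
    case False
    have "best_item v c T (insert i R) = j"
    proof (rule best_item_eqI)
      fix k assume k: "k \<in> insert i R"
      show "ratio v c T k \<le> ratio v c T j" using k b(2)[of k] False by auto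
      assume "k < j"
      then show "ratio v c T k < ratio v c T j" using k b(3)[of k] False by auto
    qed (use assms b(1) in auto)
    with False show ?thesis by metis
  qed
qed

section \<open>Greedy runs\<close>

text \<open>\<open>acc\<close> decides whether the best remaining item is taken or discarded.\<close>

definition gstep ::
    "('a \<Rightarrow> real) \<Rightarrow> ('a set \<Rightarrow> 'a \<Rightarrow> bool) \<Rightarrow> 'a set \<times> 'a set \<Rightarrow> 'a set \<times> 'a set" where
  "gstep c acc = (\<lambda>(T, R). if R = {} then (T, R) else
     let j = best_item v c T R in (if acc T j then insert j T else T, R - {j}))"

definition state_ok :: "'a set \<times> 'a set \<Rightarrow> bool" where
  "state_ok s \<longleftrightarrow> fst s \<subseteq> A \<and> snd s \<subseteq> A \<and> fst s \<inter> snd s = {}"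

lemma state_okD:
  assumes "state_ok s"
  shows "fst s \<subseteq> A" "snd s \<subseteq> A" "finite (fst s)" "finite (snd s)" "x \<in> fst s \<Longrightarrow> x \<notin> snd s"
  using assms finite_A by (auto simp: state_ok_def intro: finite_subset)

lemma gstep_empty: "gstep c acc (T, {}) = (T, {})"
  by (simp add: gstep_def)

lemma funpow_gstep_empty: "(gstep c acc ^^ k) (T, {}) = (T, {})"
  by (induction k) (simp_all add: gstep_empty)

lemma gstep_props:
  assumes "state_ok s"
  shows state_ok_gstep: "state_ok (gstep c acc s)"
    and gstep_fst_mono: "fst s \<subseteq> fst (gstep c acc s)"
    and gstep_un: "fst (gstep c acc s) \<union> snd (gstep c acc s) \<subseteq> fst s \<union> snd s"
    and gstep_snd: "snd (gstep c acc s) \<subseteq> snd s"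
    and gstep_card: "card (snd (gstep c acc s)) = card (snd s) - 1"
proof -
  obtain T R where s: "s = (T, R)" by force
  have fin: "finite R" "T \<subseteq> A" "R \<subseteq> A" "T \<inter> R = {}"
    using assms s state_okD(2,4)[OF assms] by (auto simp: state_ok_def)
  consider "R = {}" | "R \<noteq> {}" "best_item v c T R \<in> R" using best_item_in fin by blast
  then show "state_ok (gstep c acc s)" "fst s \<subseteq> fst (gstep c acc s)"
    "fst (gstep c acc s) \<union> snd (gstep c acc s) \<subseteq> fst s \<union> snd s"
    "snd (gstep c acc s) \<subseteq> snd s"
    "card (snd (gstep c acc s)) = card (snd s) - 1"
    using fin by (cases; auto simp: s gstep_def state_ok_def Let_def)+
qed

lemma run_props:
  assumes "state_ok s"
  shows state_ok_run: "state_ok ((gstep c acc ^^ k) s)"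
    and run_fst_mono: "fst s \<subseteq> fst ((gstep c acc ^^ k) s)"
    and run_un: "fst ((gstep c acc ^^ k) s) \<union> snd ((gstep c acc ^^ k) s) \<subseteq> fst s \<union> snd s"
    and run_snd: "snd ((gstep c acc ^^ k) s) \<subseteq> snd s"
    and run_card: "card (snd ((gstep c acc ^^ k) s)) = card (snd s) - k"
proof (induction k)
  case (Suc k)
  { case 1 with Suc show ?case by (simp add: state_ok_gstep) }
  { case 2 with Suc gstep_fst_mono[of "(gstep c acc ^^ k) s" c acc] show ?case by auto }
  { case 3 with Suc gstep_un[of "(gstep c acc ^^ k) s" c acc] show ?case by auto }
  { case 4 with Suc gstep_snd[of "(gstep c acc ^^ k) s" c acc] show ?case by auto }
  { case 5 with Suc gstep_card[of "(gstep c acc ^^ k) s" c acc] show ?case by simp }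
qed (auto simp: assms)

lemma run_mono:
  assumes "state_ok s" "k \<le> l"
  shows "fst ((gstep c acc ^^ k) s) \<subseteq> fst ((gstep c acc ^^ l) s)"
proof -
  have "(gstep c acc ^^ l) s = (gstep c acc ^^ (l - k)) ((gstep c acc ^^ k) s)"
    using assms(2) funpow_add[of "l - k" k "gstep c acc"] by simp
  then show ?thesis
    using run_fst_mono[OF state_ok_run[OF assms(1)], where k = "l - k" and c = c and acc = acc] by simp
qed

lemma run_finished:
  assumes "state_ok s" "card (snd s) \<le> k"
  shows "snd ((gstep c acc ^^ k) s) = {}"
proof -
  have "card (snd ((gstep c acc ^^ k) s)) = 0" using run_card[OF assms(1)] assms(2) by simp
  then show ?thesis using state_okD(4)[OF state_ok_run[OF assms(1)]] by auto
qed

lemma run_stable: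
  assumes "state_ok s" "card (snd s) \<le> k" "k \<le> l"
  shows "(gstep c acc ^^ l) s = (gstep c acc ^^ k) s"
proof -
  have eq: "(gstep c acc ^^ l) s = (gstep c acc ^^ (l - k)) ((gstep c acc ^^ k) s)"
    using assms(3) funpow_add[of "l - k" k "gstep c acc"] by simp
  obtain T where "(gstep c acc ^^ k) s = (T, {})"
    using run_finished[OF assms(1,2), of c acc] by (metis prod.collapse)
  then show ?thesis using eq funpow_gstep_empty by simp
qed

subsection \<open>Inserting a further item\<close>

definition beats :: "('a \<Rightarrow> real) \<Rightarrow> 'a \<Rightarrow> real \<Rightarrow> 'a set \<times> 'a set \<Rightarrow> bool" where
  "beats c i x = (\<lambda>(T, R). best_item v (c(i := x)) T (insert i R) = i)"

text \<open>Guarantees that every finished run of the rivals contains a state that \<open>i\<close>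
  beats, whatever its bid.\<close>

lemma beats_empty: "beats c i x (T, {})"
  unfolding beats_def by (auto intro: best_item_eqI)

lemma beats_iff_ratio:
  fixes c :: "'a \<Rightarrow> real" and T :: "'a set"
  assumes "finite R" "R \<noteq> {}" "i \<notin> R"
  defines "j \<equiv> best_item v c T R"
  shows "beats c i x (T, R) \<longleftrightarrow> ratio v c T j < ratio v (c(i := x)) T i \<or>
    ratio v c T j = ratio v (c(i := x)) T i \<and> i < j"
proof -
  have j: "best_item v (c(i := x)) T R = j" using assms best_item_upd by simp
  have "j \<in> R" using best_item_in assms by simp
  then have "j \<noteq> i" using assms by auto
  then have "ratio v (c(i := x)) T j = ratio v c T j" by (simp add: ratio_def)
  with best_item_insert[OF assms(1-3), of "c(i := x)" T, unfolded j] \<open>j \<noteq> i\<close>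
  show ?thesis by (auto simp: beats_def)
qed

text \<open>The critical bid \<open>m_i * c_j / m_j\<close> is where both ratios agree, so the order
  of sellers matters only there. A best rival of marginal value 0 means that all rivals are
  worthless at \<open>T\<close>, and then no bid changes the outcome.\<close>

lemma beats_iff_critical:
  fixes c :: "'a \<Rightarrow> real" and T :: "'a set"
  assumes "T \<subseteq> A" "R \<subseteq> A" "R \<noteq> {}" "i \<in> A" "i \<notin> R" "0 \<le> x" "\<And>k. k \<in> R \<Longrightarrow> 0 \<le> c k"
  defines "j \<equiv> best_item v c T R"
  shows "beats c i x (T, R) \<longleftrightarrow>
    (if marginal v j T = 0 then 0 < marginal v i T \<or> i < j
     else 0 < marginal v i T \<and> (x < marginal v i T * c j / marginal v j T \<or>
       x = marginal v i T * c j / marginal v j T \<and> i < j))"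
proof -
  have fin: "finite R" using assms(2) finite_A finite_subset by blast
  have jR: "j \<in> R" using best_item_in assms fin by simp
  have m: "0 \<le> marginal v j T" "0 \<le> marginal v i T" "0 \<le> c j"
    using assms jR marginal_nonneg by auto
  have jA: "j \<in> A" using jR assms by auto
  let ?d = "c(i := x)"
  have d: "0 \<le> ?d i" using assms by simp
  note l1 = ratio_less_iff[of T j i c ?d, OF assms(1) jA assms(4) m(3) d]
  note l2 = ratio_less_iff[of T i j ?d c, OF assms(1) assms(4) jA d m(3)]
  have eq: "ratio v c T j = ratio v ?d T i \<longleftrightarrow>
    \<not> ratio v c T j < ratio v ?d T i \<and> \<not> ratio v ?d T i < ratio v c T j" by auto
  show ?thesis
    unfolding beats_iff_ratio[OF fin assms(3,5), where c = c and T = T, folded j_def] eq l1 l2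
    using m by (auto simp: field_simps)
qed

lemma beats_antimono:
  assumes "state_ok s" "i \<in> A" "i \<notin> snd s" "\<And>k. k \<in> snd s \<Longrightarrow> 0 \<le> c k"
    and "0 \<le> y" "y \<le> x" "beats c i x s"
  shows "beats c i y s"
proof -
  obtain T R where s: "s = (T, R)" by force
  note ok = state_okD[OF assms(1), unfolded s, simplified]
  show ?thesis
  proof (cases "R = {}")
    case False
    note b = beats_iff_critical[of T R i _ c, OF ok(1,2) False assms(2)]
    show ?thesis
      using assms(3-7) unfolding s by (auto simp: b split: if_splits)
  qed (simp add: s beats_empty)
qed

lemma gstep_insert:
  assumes "state_ok s" "i \<notin> fst s" "i \<notin> snd s"
    and acc: "\<And>T j. i \<notin> T \<Longrightarrow> j \<noteq> i \<Longrightarrow> acc' T j = acc T j"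
    and "\<not> beats c i x s"
  shows "gstep (c(i := x)) acc' (fst s, insert i (snd s)) =
      (fst (gstep c acc s), insert i (snd (gstep c acc s)))"
    and "i \<notin> fst (gstep c acc s)" "i \<notin> snd (gstep c acc s)"
proof -
  obtain T R where s: "s = (T, R)" by force
  note ok = state_okD[OF assms(1), unfolded s, simplified]
  have ne: "R \<noteq> {}" using assms(5) beats_empty s by blast
  define j where "j = best_item v c T R"
  have jR: "j \<in> R" using best_item_in ok ne j_def by auto
  have ji: "j \<noteq> i" using jR assms(3) s by auto
  have "best_item v (c(i := x)) T (insert i R) = j"
    using best_item_insert[of R i "c(i := x)" T] ok ne assms(3,5) s
    by (auto simp: beats_def best_item_upd j_def split: if_splits)
  then show "gstep (c(i := x)) acc' (fst s, insert i (snd s)) =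
      (fst (gstep c acc s), insert i (snd (gstep c acc s)))"
    "i \<notin> fst (gstep c acc s)" "i \<notin> snd (gstep c acc s)"
    using assms(2,3) acc[of T j] ji ne s
    by (auto simp: gstep_def Let_def j_def[symmetric] insert_Diff_if)
qed

text \<open>Until \<open>i\<close> is best it merely waits among the candidates, so the run of the
  rivals, which does not see the bid, tells everything. \<open>acc\<close> and \<open>acc'\<close>
  are separate because an acceptance test such as \<open>fits\<close> mentions the cost
  vector.\<close>

lemma run_insert:
  assumes "state_ok s" "i \<notin> fst s" "i \<notin> snd s"
    and acc: "\<And>T j. i \<notin> T \<Longrightarrow> j \<noteq> i \<Longrightarrow> acc' T j = acc T j"
    and "\<And>l. l < k \<Longrightarrow> \<not> beats c i x ((gstep c acc ^^ l) s)"
  shows "(gstep (c(i := x)) acc' ^^ k) (fst s, insert i (snd s)) =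
      (fst ((gstep c acc ^^ k) s), insert i (snd ((gstep c acc ^^ k) s)))"
  using assms(5)
proof (induction k)
  case (Suc k)
  have IH: "(gstep (c(i := x)) acc' ^^ k) (fst s, insert i (snd s)) =
      (fst ((gstep c acc ^^ k) s), insert i (snd ((gstep c acc ^^ k) s)))"
    using Suc by (simp del: fun_upd_apply)
  have "i \<notin> fst ((gstep c acc ^^ k) s) \<union> snd ((gstep c acc ^^ k) s)"
    using run_un[OF assms(1), where c = c and acc = acc and k = k] assms(2,3) by auto
  then show ?case
    using gstep_insert(1)[of "(gstep c acc ^^ k) s" i acc' acc c x] Suc.prems[of k]
    by (simp add: IH state_ok_run[OF assms(1)] acc del: fun_upd_apply)
qed simp

lemma run_avoids:
  assumes "state_ok s" "i \<notin> fst s" "i \<notin> snd s"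
  shows "i \<notin> fst ((gstep c acc ^^ k) s)" "i \<notin> snd ((gstep c acc ^^ k) s)"
  using run_un[OF assms(1), where c = c and acc = acc and k = k] assms(2,3) by auto

text \<open>Once \<open>i\<close> is no candidate, its cost can enter only through the acceptance
  test. The tests are compared only on sets that the run can reach: how \<open>fits\<close> reacts
  to the cost of \<open>i\<close> depends on whether the starting set already contains
  \<open>i\<close>.\<close>

lemma run_upd:
  assumes "state_ok s" "i \<notin> snd s"
    and acc: "\<And>T j. j \<noteq> i \<Longrightarrow> fst s \<subseteq> T \<Longrightarrow> T \<subseteq> fst s \<union> snd s \<Longrightarrow> acc' T j = acc T j"
  shows "(gstep (c(i := x)) acc' ^^ k) s = (gstep c acc ^^ k) s"
proof (induction k)
  case (Suc k)
  define t where "t = (gstep c acc ^^ k) s"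
  have t: "i \<notin> snd t" "fst s \<subseteq> fst t" "fst t \<subseteq> fst s \<union> snd s" "finite (snd t)"
    using run_snd[OF assms(1), where c = c and acc = acc and k = k] run_fst_mono[OF assms(1), where c = c and acc = acc and k = k]
      run_un[OF assms(1), where c = c and acc = acc and k = k] assms(2) state_okD(4)[OF state_ok_run[OF assms(1), where c = c and acc = acc and k = k]]
    by (auto simp: t_def)
  obtain T R where TR: "t = (T, R)" by force
  have "gstep (c(i := x)) acc' (T, R) = gstep c acc (T, R)"
  proof (cases "R = {}")
    case False
    then have "best_item v c T R \<in> R" using best_item_in t TR by auto
    then have "best_item v c T R \<noteq> i" using t TR by auto
    then show ?thesis using t TR acc[of "best_item v c T R" T] False
      by (simp add: gstep_def Let_def best_item_upd)
  qed (simp add: gstep_def)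
  then show ?case using Suc TR t_def by (simp del: fun_upd_apply)
qed simp

end

section \<open>The optimum\<close>

context valued
begin

lemma finite_feasible: "finite {S. S \<subseteq> A \<and> sum c S \<le> B}"
  using finite_A by simp

lemma opt_ge: "S \<subseteq> A \<Longrightarrow> sum c S \<le> B \<Longrightarrow> v S \<le> opt v B A c"
  unfolding opt_def using finite_feasible[of c B] by (intro Max_ge) auto

lemma opt_attained:
  assumes "0 \<le> B"
  obtains S where "S \<subseteq> A" "sum c S \<le> B" "opt v B A c = v S"
proof -
  have "{} \<in> {S. S \<subseteq> A \<and> sum c S \<le> B}" using assms by simp
  then have "opt v B A c \<in> v ` {S. S \<subseteq> A \<and> sum c S \<le> B}"
    unfolding opt_def using finite_feasible[of c B] by (intro Max_in) auto
  then show ?thesis using that by auto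
qed

lemma opt_nonneg: "0 \<le> B \<Longrightarrow> 0 \<le> opt v B A c"
  using opt_ge[of "{}" c B] value_nonneg[of "{}"] by simp

lemma opt_le_total: "0 \<le> B \<Longrightarrow> opt v B A c \<le> v A"
  by (metis opt_attained order_refl value_mono)

lemma opt_antimono:
  assumes "0 \<le> B" "\<And>i. i \<in> A \<Longrightarrow> c i \<le> d i"
  shows "opt v B A d \<le> opt v B A c"
proof -
  obtain S where S: "S \<subseteq> A" "sum d S \<le> B" "opt v B A d = v S" using opt_attained assms(1) .
  have "sum c S \<le> sum d S" using S assms(2) by (intro sum_mono) auto
  then show ?thesis using S opt_ge[of S c B] by simp
qed

section \<open>The greedy order\<close>

text \<open>The greedy order as a run that accepts everything, available for every \<open>R\<close>
  inside \<open>A\<close>: on the rivals of one seller it is independent of the bid of that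
  seller.\<close>

definition greedy_state :: "('a \<Rightarrow> real) \<Rightarrow> 'a set \<Rightarrow> nat \<Rightarrow> 'a set \<times> 'a set" where
  "greedy_state c R k = (gstep c (\<lambda>_ _. True) ^^ k) ({}, R)"

lemma state_ok_greedy_state: "R \<subseteq> A \<Longrightarrow> state_ok (greedy_state c R k)"
  unfolding greedy_state_def by (rule state_ok_run) (simp add: state_ok_def)

lemma greedy_state_props:
  assumes "R \<subseteq> A"
  shows greedy_state_subset: "fst (greedy_state c R k) \<subseteq> R"
    and greedy_state_snd: "snd (greedy_state c R k) = R - fst (greedy_state c R k)"
    and card_greedy_state: "k \<le> card R \<Longrightarrow> card (fst (greedy_state c R k)) = k"
proof (induction k)
  case (Suc k)
  define T where "T = fst (greedy_state c R k)"
  have st: "greedy_state c R k = (T, R - T)"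
    using Suc(2) by (simp add: T_def prod_eq_iff)
  have fin: "finite R" "finite T" "T \<subseteq> R"
    using finite_subset[OF assms finite_A] Suc(1) finite_subset[OF Suc(1)] by (simp_all add: T_def)
  have step: "greedy_state c R (Suc k) = gstep c (\<lambda>_ _. True) (T, R - T)"
    using st by (simp add: greedy_state_def)
  show 1: "fst (greedy_state c R (Suc k)) \<subseteq> R"
    and "snd (greedy_state c R (Suc k)) = R - fst (greedy_state c R (Suc k))"
    using fin best_item_in[of "R - T" c T] unfolding step by (auto simp: gstep_def Let_def)
  assume k: "Suc k \<le> card R"
  then have cT: "card T = k" using Suc(3) T_def by simp
  then have ne: "R - T \<noteq> {}" using k fin card_mono[of T R] by auto
  then have "best_item v c T (R - T) \<in> R - T" using fin by (intro best_item_in) auto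
  then show "card (fst (greedy_state c R (Suc k))) = Suc k"
    using ne fin cT unfolding step by (auto simp: gstep_def Let_def)
qed (simp_all add: greedy_state_def)

lemma greedy_state_mono:
  "R \<subseteq> A \<Longrightarrow> k \<le> l \<Longrightarrow> fst (greedy_state c R k) \<subseteq> fst (greedy_state c R l)"
  unfolding greedy_state_def by (rule run_mono) (simp_all add: state_ok_def)

lemma greedy_state_eq_prefix:
  assumes "k \<le> card A"
  shows "greedy_state c A k = (greedy_prefix v c A k, A - greedy_prefix v c A k)"
  using assms
proof (induction k)
  case (Suc k)
  have IH: "greedy_state c A k = (greedy_prefix v c A k, A - greedy_prefix v c A k)"
    using Suc by simp
  have "card (greedy_prefix v c A k) = k" "greedy_prefix v c A k \<subseteq> A"
    using card_greedy_state[of A k c] greedy_state_subset[of A c k] Suc IH by auto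
  then have "A - greedy_prefix v c A k \<noteq> {}"
    using Suc.prems card_mono[of "greedy_prefix v c A k" A] finite_A finite_subset by fastforce
  then show ?case using IH by (auto simp: greedy_state_def gstep_def Let_def)
qed (simp add: greedy_state_def)

lemma greedy_prefix_props:
  assumes "k \<le> card A"
  shows greedy_prefix_subset: "greedy_prefix v c A k \<subseteq> A"
    and card_greedy_prefix: "card (greedy_prefix v c A k) = k"
  using greedy_state_eq_prefix[OF assms, of c] greedy_state_subset[of A c k]
    card_greedy_state[of A k c] assms by auto

lemma greedy_prefix_mono: "k \<le> l \<Longrightarrow> greedy_prefix v c A k \<subseteq> greedy_prefix v c A l"
  by (rule lift_Suc_mono_le) auto

lemma greedy_item_in:
  assumes "k < card A"
  shows "greedy_item v c A k \<in> A - greedy_prefix v c A k"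
proof -
  have "A - greedy_prefix v c A k \<noteq> {}"
    using card_greedy_prefix[of k c] greedy_prefix_subset[of k c] assms by auto
  then show ?thesis unfolding greedy_item_def using finite_A by (intro best_item_in) auto
qed

lemma greedy_prefix_Suc: "greedy_prefix v c A (Suc k) = insert (greedy_item v c A k) (greedy_prefix v c A k)"
  by (simp add: greedy_item_def)

lemma inj_on_greedy_item: "inj_on (greedy_item v c A) {..<card A}"
proof -
  have "greedy_item v c A k \<noteq> greedy_item v c A l" if "k < l" "l < card A" for k l
    using greedy_item_in[OF that(2), of c] greedy_prefix_mono[of "Suc k" l c] that
    by (auto simp: greedy_prefix_Suc simp del: greedy_prefix.simps)
  then show ?thesis by (metis inj_onI lessThan_iff linorder_neqE_nat)
qed

lemma greedy_item_bid:
  assumes "i \<in> A" "k < card A"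
  shows "greedy_item v (c(i := b)) A k = i \<longleftrightarrow>
      beats c i b (greedy_state c (A - {i}) k) \<and> (\<forall>l<k. \<not> beats c i b (greedy_state c (A - {i}) l))"
    and "greedy_item v (c(i := b)) A k = i \<Longrightarrow>
      greedy_prefix v (c(i := b)) A k = fst (greedy_state c (A - {i}) k)"
proof -
  let ?G = "greedy_state c (A - {i})"
  have run: "(greedy_prefix v (c(i := b)) A k, A - greedy_prefix v (c(i := b)) A k) =
      (fst (?G k), insert i (snd (?G k)))"
    if "\<And>l. l < k \<Longrightarrow> \<not> beats c i b (?G l)" "k < card A" for k
    using run_insert[of "({}, A - {i})" i "\<lambda>_ _. True" "\<lambda>_ _. True" k c b] that assms(1)
      greedy_state_eq_prefix[of k "c(i := b)"]
    by (simp add: greedy_state_def state_ok_def insert_absorb del: fun_upd_apply)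
  have item: "greedy_item v (c(i := b)) A k = i \<longleftrightarrow> beats c i b (?G k)"
    if "\<And>l. l < k \<Longrightarrow> \<not> beats c i b (?G l)" "k < card A" for k
    using run[OF that] unfolding greedy_item_def beats_def case_prod_beta prod.inject by metis
  \<comment> \<open>Beating an earlier state would have put \<open>i\<close> into the order at the
    first such state \<open>l'\<close>, hence into the prefix of length \<open>k\<close>, from which
    nothing is picked again.\<close>
  have no: "\<not> beats c i b (?G l)" if "greedy_item v (c(i := b)) A k = i" "l < k" for l
  proof
    assume "beats c i b (?G l)"
    then obtain l' where l': "beats c i b (?G l')" "l' \<le> l" "\<And>m. m < l' \<Longrightarrow> \<not> beats c i b (?G m)"
      using LeastI[of "\<lambda>l. beats c i b (?G l)"] Least_le[of "\<lambda>l. beats c i b (?G l)"]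
        not_less_Least[of _ "\<lambda>l. beats c i b (?G l)"] by blast
    then have "greedy_item v (c(i := b)) A l' = i" using item[of l'] that assms by simp
    moreover have "greedy_prefix v (c(i := b)) A (Suc l') \<subseteq> greedy_prefix v (c(i := b)) A k"
      using l'(2) that by (intro greedy_prefix_mono) simp
    ultimately show False using greedy_item_in[OF assms(2), of "c(i := b)"] that
      by (auto simp: greedy_prefix_Suc simp del: greedy_prefix.simps)
  qed
  then show "greedy_item v (c(i := b)) A k = i \<longleftrightarrow>
      beats c i b (?G k) \<and> (\<forall>l<k. \<not> beats c i b (?G l))"
    using item[of k] assms by metis
  show "greedy_prefix v (c(i := b)) A k = fst (?G k)" if "greedy_item v (c(i := b)) A k = i"
    using run[of k] no that assms by auto
qed

text \<open>After \<open>card A - 1\<close> steps the rivals are used up, so \<open>i\<close> finds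
  a place in the order at any bid.\<close>

lemma beats_last:
  assumes "i \<in> A"
  shows "beats c i b (greedy_state c (A - {i}) (card A - 1))"
proof -
  have "snd (greedy_state c (A - {i}) (card A - 1)) = {}"
    unfolding greedy_state_def using assms finite_A
    by (intro run_finished) (auto simp: state_ok_def)
  then show ?thesis by (metis beats_empty prod.collapse)
qed

text \<open>The state need not be the first one that \<open>i\<close> beats: prefixes grow, so if
  the value test succeeds at a later state, it succeeds at the first one. This frees all later
  arguments about thresholds from minimality. The bound \<open>N\<close> may exceed
  \<open>card A\<close>, so that loops over all sellers can be used when only some are
  affordable.\<close>

lemma mem_modified_greedy_om_iff:
  assumes "i \<in> A" "card A \<le> N"
  shows "i \<in> modified_greedy_om Orc \<alpha> v A (c(i := b)) \<longleftrightarrow>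
    (\<exists>k<N. beats c i b (greedy_state c (A - {i}) k) \<and>
       v (insert i (fst (greedy_state c (A - {i}) k))) \<le> \<alpha> * (SUP x\<in>{b..}. Orc A (c(i := x))))"
    (is "?L \<longleftrightarrow> (\<exists>k<N. ?b k \<and> ?w k)")
proof
  assume ?L
  then obtain k where k: "k < card A" "i = greedy_item v (c(i := b)) A k"
    "v (greedy_prefix v (c(i := b)) A (Suc k)) \<le> \<alpha> * (SUP x\<in>{b..}. Orc A (c(i := x)))"
    unfolding modified_greedy_om_def fun_upd_upd by auto
  then have "?b k" "greedy_prefix v (c(i := b)) A (Suc k) = insert i (fst (greedy_state c (A - {i}) k))"
    using greedy_item_bid[OF assms(1) k(1), of c b] unfolding greedy_prefix_Suc k(2)[symmetric] by simp_all
  with k assms show "\<exists>k<N. ?b k \<and> ?w k" by (metis order_less_le_trans)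
next
  assume "\<exists>k<N. ?b k \<and> ?w k"
  then obtain k where k: "?b k" "?w k" by blast
  define l where "l = (LEAST l. ?b l)"
  have l: "?b l" "\<And>m. m < l \<Longrightarrow> \<not> ?b m" "l \<le> k"
    unfolding l_def using k(1) by (auto intro: LeastI Least_le dest: not_less_Least)
  have "l \<le> card A - 1" using beats_last[OF assms(1), of c b] l(2) not_less by blast
  then have lc: "l < card A" using assms(1) finite_A card_gt_0_iff[of A] by auto
  have item: "greedy_item v (c(i := b)) A l = i" using greedy_item_bid(1)[OF assms(1) lc] l by blast
  have "fst (greedy_state c (A - {i}) l) \<subseteq> fst (greedy_state c (A - {i}) k)"
    using l(3) by (intro greedy_state_mono) auto
  moreover have "fst (greedy_state c (A - {i}) k) \<subseteq> A - {i}" by (rule greedy_state_subset) auto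
  ultimately have "v (insert i (fst (greedy_state c (A - {i}) l)))
      \<le> v (insert i (fst (greedy_state c (A - {i}) k)))"
    using assms by (intro value_mono) auto
  moreover have "greedy_prefix v (c(i := b)) A (Suc l) = insert i (fst (greedy_state c (A - {i}) l))"
    using greedy_item_bid(2)[OF assms(1) lc item] item
    by (simp add: greedy_prefix_Suc del: greedy_prefix.simps)
  ultimately show ?L
    unfolding modified_greedy_om_def fun_upd_upd using lc item k(2)
    by (intro CollectI exI[of _ l]) simp
qed

lemma most_valuable_in:
  assumes "A \<noteq> {}"
  shows "most_valuable v A \<in> A" "j \<in> A \<Longrightarrow> v {j} \<le> v {most_valuable v A}"
proof -
  let ?M = "{i \<in> A. \<forall>j\<in>A. v {j} \<le> v {i}}"
  have fin: "finite ((\<lambda>i. v {i}) ` A)" "(\<lambda>i. v {i}) ` A \<noteq> {}" using assms finite_A by auto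
  obtain i where "i \<in> A" "v {i} = Max ((\<lambda>i. v {i}) ` A)" using Max_in[OF fin] by auto
  then have "i \<in> ?M" using fin by auto
  then have "most_valuable v A \<in> ?M"
    unfolding most_valuable_def using finite_A by (intro Min_in) auto
  then show "most_valuable v A \<in> A" "j \<in> A \<Longrightarrow> v {j} \<le> v {most_valuable v A}" by auto
qed

end

section \<open>Threshold payments\<close>

text \<open>The price of a winner is the infimum of its losing bids and does not depend on its own
  bid, so a seller can only choose between selling at this price and not selling. By monotonicity
  the true cost makes the better choice. The second premise keeps the infimum from ranging over the
  empty set.\<close>

lemma truthful_threshold:
  assumes mono: "\<And>c i b b'. \<lbrakk>cost_vector_on A c; i \<in> A; 0 \<le> b'; b' \<le> b; i \<in> f (c(i := b))\<rbrakk>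
      \<Longrightarrow> i \<in> f (c(i := b'))"
    and rejects: "\<And>c i. \<lbrakk>cost_vector_on A c; i \<in> A\<rbrakk> \<Longrightarrow> \<exists>b\<ge>0. i \<notin> f (c(i := b))"
  shows "truthful A (with_threshold_payments f)"
  unfolding truthful_def
proof (intro allI impI ballI)
  fix c i b assume c: "cost_vector_on A c" and i: "i \<in> A" and b: "(0::real) \<le> b"
  let ?L = "{b. 0 \<le> b \<and> i \<notin> f (c(i := b))}"
  have ci: "0 \<le> c i" using c i by (simp add: cost_vector_on_def)
  have ne: "?L \<noteq> {}" using rejects[OF c i] by auto
  have bdd: "bdd_below ?L" by (rule bdd_belowI[of _ 0]) auto
  have pay: "threshold_payment f (c(i := b)) i = (if i \<in> f (c(i := b)) then Inf ?L else 0)" for b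
    by (simp add: threshold_payment_def)
  show "utility (with_threshold_payments f) i (c i) (c(i := b))
      \<le> utility (with_threshold_payments f) i (c i) c"
  proof (cases "i \<in> f c")
    case True
    have "c i \<le> Inf ?L"
    proof (rule cInf_greatest[OF ne])
      fix y assume "y \<in> ?L"
      then show "c i \<le> y" using mono[OF c i, of y "c i"] True ci by (force simp: not_le)
    qed
    then show ?thesis using True pay[of b] pay[of "c i"]
      by (simp add: utility_def with_threshold_payments_def)
  next
    case False
    then have "Inf ?L \<le> c i" using ci by (intro cInf_lower[OF _ bdd]) auto
    then show ?thesis using False pay[of b] pay[of "c i"]
      by (simp add: utility_def with_threshold_payments_def)
  qed
qed

lemma threshold_payment_le:
  assumes "0 \<le> w" "\<And>b. w < b \<Longrightarrow> i \<notin> f (c(i := b))"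
  shows "threshold_payment f c i \<le> w"
proof (cases "i \<in> f c")
  case True
  let ?L = "{b. 0 \<le> b \<and> i \<notin> f (c(i := b))}"
  have "Inf ?L \<le> z" if "w < z" for z
    using assms that by (intro cInf_lower bdd_belowI[of _ 0]) auto
  then have "Inf ?L \<le> w" by (rule dense_ge)
  then show ?thesis using True by (simp add: threshold_payment_def)
qed (simp add: threshold_payment_def assms)

text \<open>The bid \<open>w\<close> is left out of both premises on bids: with ties it may win or
  lose, and the infimum is the same.\<close>

lemma threshold_payment_eqI:
  assumes "i \<in> f c" "0 \<le> w" "\<And>b. w < b \<Longrightarrow> i \<notin> f (c(i := b))"
    and "\<And>b. 0 \<le> b \<Longrightarrow> b < w \<Longrightarrow> i \<in> f (c(i := b))"
  shows "threshold_payment f c i = w"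
proof (rule antisym)
  show "threshold_payment f c i \<le> w" using assms by (intro threshold_payment_le) auto
  have "w + 1 \<in> {b. 0 \<le> b \<and> i \<notin> f (c(i := b))}" using assms(2) assms(3)[of "w + 1"] by simp
  then have "w \<le> Inf {b. 0 \<le> b \<and> i \<notin> f (c(i := b))}"
    using assms(4) by (intro cInf_greatest) (auto simp: not_le[symmetric])
  then show "w \<le> threshold_payment f c i" using assms(1) by (simp add: threshold_payment_def)
qed

section \<open>The mechanism for a general oracle\<close>

definition affordable :: "real \<Rightarrow> 'a set \<Rightarrow> ('a \<Rightarrow> real) \<Rightarrow> 'a set" where
  "affordable B A c = {i \<in> A. c i \<le> B}"

lemma affordable_subset: "affordable B A c \<subseteq> A"
  by (auto simp: affordable_def)

lemma affordable_upd:
  "i \<in> A \<Longrightarrow> affordable B A (c(i := b)) =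
    (if b \<le> B then insert i (affordable B A c) else affordable B A c - {i})"
  by (auto simp: affordable_def)

definition heads_alloc ::
    "'a::linorder opt_oracle \<Rightarrow> ('a set \<Rightarrow> real) \<Rightarrow> real \<Rightarrow> 'a set \<Rightarrow> 'a allocation" where
  "heads_alloc Orc v B A c = (if affordable B A c = {} then {}
     else modified_greedy_om Orc (1/2) v (affordable B A c) c)"

definition tails_alloc :: "('a::linorder set \<Rightarrow> real) \<Rightarrow> real \<Rightarrow> 'a set \<Rightarrow> 'a allocation" where
  "tails_alloc v B A c = (if affordable B A c = {} then {} else {most_valuable v (affordable B A c)})"

lemma random_om_branch_eq:
  "random_om_branch Orc (1/2) v B A heads =
     with_threshold_payments (if heads then heads_alloc Orc v B A else tails_alloc v B A)"
  unfolding random_om_branch_def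
  by (rule arg_cong[of _ _ with_threshold_payments])
    (auto simp: heads_alloc_def tails_alloc_def affordable_def Let_def fun_eq_iff)

context valued
begin

lemma valued_affordable: "valued (affordable B A c) v"
  by (rule valued_subset[OF affordable_subset])

lemma opt_affordable:
  assumes "cost_vector_on A c"
  shows "opt v B (affordable B A c) c = opt v B A c"
proof -
  have "S \<subseteq> affordable B A c" if S: "S \<subseteq> A" "sum c S \<le> B" for S
  proof
    fix i assume i: "i \<in> S"
    have "\<And>j. j \<in> S \<Longrightarrow> 0 \<le> c j" using S(1) assms by (auto simp: cost_vector_on_def)
    then have "c i \<le> sum c S" using i finite_sub[OF S(1)] by (metis DiffD1 member_le_sum)
    then show "i \<in> affordable B A c" using S i by (auto simp: affordable_def)
  qed
  then have "{S. S \<subseteq> affordable B A c \<and> sum c S \<le> B} = {S. S \<subseteq> A \<and> sum c S \<le> B}"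
    using affordable_subset[of B A c] by blast
  then show ?thesis by (simp add: opt_def)
qed

text \<open>Within the budget the affordable set does not change with the bid of \<open>i\<close>,
  so the threshold of a winner is \<open>B\<close>.\<close>

lemma tails_wins_iff:
  assumes "i \<in> A"
  shows "i \<in> tails_alloc v B A (c(i := b)) \<longleftrightarrow>
    b \<le> B \<and> i = most_valuable v (insert i (affordable B A c))"
proof (cases "b \<le> B")
  case False
  let ?R = "affordable B A c - {i}"
  have "?R \<subseteq> A" using affordable_subset[of B A c] by auto
  then have "?R \<noteq> {} \<Longrightarrow> most_valuable v ?R \<in> ?R"
    by (rule valued.most_valuable_in(1)[OF valued_subset])
  then have "?R \<noteq> {} \<Longrightarrow> i \<noteq> most_valuable v ?R" by (metis Diff_iff insertI1)
  then show ?thesis using False assms by (simp add: tails_alloc_def affordable_upd)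
qed (use assms in \<open>simp add: tails_alloc_def affordable_upd\<close>)

lemma truthful_tails: "0 < B \<Longrightarrow> truthful A (with_threshold_payments (tails_alloc v B A))"
  by (rule truthful_threshold) (auto simp: tails_wins_iff intro!: exI[of _ "B + 1"])

lemma tails_payment_le:
  assumes "0 < B" "i \<in> A"
  shows "threshold_payment (tails_alloc v B A) c i \<le> B"
  using assms by (intro threshold_payment_le) (auto simp: tails_wins_iff)

lemma tails_payment_eq:
  assumes "0 < B" "i \<in> A" "i \<in> tails_alloc v B A c"
  shows "threshold_payment (tails_alloc v B A) c i = B"
  using assms tails_wins_iff[of i B c "c i"]
  by (intro threshold_payment_eqI) (auto simp: tails_wins_iff)

lemma tails_alloc_subset: "tails_alloc v B A c \<subseteq> A"
  using valued.most_valuable_in(1)[OF valued_affordable, of B c] affordable_subset[of B A c]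
  by (auto simp: tails_alloc_def)

lemma tails_budget:
  assumes "0 < B"
  shows "(\<Sum>i\<in>A. threshold_payment (tails_alloc v B A) c i) \<le> B"
proof -
  have "(\<Sum>i\<in>A. threshold_payment (tails_alloc v B A) c i) =
      (\<Sum>i\<in>tails_alloc v B A c. threshold_payment (tails_alloc v B A) c i)"
    using tails_alloc_subset finite_A
    by (intro sum.mono_neutral_right) (auto simp: threshold_payment_def)
  also have "\<dots> \<le> B"
    using assms tails_payment_le[OF assms, of "most_valuable v (affordable B A c)" c] tails_alloc_subset[of B c]
    by (auto simp: tails_alloc_def split: if_splits)
  finally show ?thesis .
qed

end

section \<open>Truthfulness, budget and approximation of the greedy branch\<close>

locale om = valued A v for A :: "'a::linorder set" and v +
  fixes B r :: real and Orc :: "'a opt_oracle"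
  assumes B_pos: "0 < B" and r_ge: "1 \<le> r" and approx: "approx_oracle r A v B Orc"
begin

lemma Orc_le_opt: "A' \<subseteq> A \<Longrightarrow> cost_vector_on A c \<Longrightarrow> Orc A' c \<le> opt v B A' c"
  using approx by (simp add: approx_oracle_def)

lemma opt_le_Orc: "A' \<subseteq> A \<Longrightarrow> cost_vector_on A c \<Longrightarrow> opt v B A' c \<le> r * Orc A' c"
  using approx by (simp add: approx_oracle_def)

lemma cost_vector_upd: "cost_vector_on A c \<Longrightarrow> 0 \<le> x \<Longrightarrow> cost_vector_on A (c(i := x))"
  by (simp add: cost_vector_on_def)

text \<open>The supremum in the mechanism is one of reals and says something only when bounded;
  \<open>v A'\<close> bounds the estimate at every bid.\<close>

lemma bdd_above_Orc:
  assumes "A' \<subseteq> A" "cost_vector_on A c" "0 \<le> b"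
  shows "bdd_above ((\<lambda>x. Orc A' (c(i := x))) ` {b..})"
proof (rule bdd_aboveI2)
  interpret V: valued A' v using assms(1) by (rule valued_subset)
  fix x assume "x \<in> {b..}"
  then have "Orc A' (c(i := x)) \<le> opt v B A' (c(i := x))"
    using assms by (intro Orc_le_opt cost_vector_upd) auto
  also have "\<dots> \<le> v A'" using V.opt_le_total B_pos by simp
  finally show "Orc A' (c(i := x)) \<le> v A'" .
qed

text \<open>An oracle need not be monotone in the costs, but the optimum is. Each estimate is
  therefore first replaced by the optimum at its own cost vector.\<close>

lemma SUP_Orc_le_opt:
  assumes "A' \<subseteq> A" "cost_vector_on A c" "0 \<le> c i" "c i \<le> b"
  shows "(SUP x\<in>{b..}. Orc A' (c(i := x))) \<le> opt v B A' c"
proof (rule cSUP_least)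
  interpret V: valued A' v using assms(1) by (rule valued_subset)
  fix x assume "x \<in> {b..}"
  then have "Orc A' (c(i := x)) \<le> opt v B A' (c(i := x))"
    using assms by (intro Orc_le_opt cost_vector_upd) auto
  also have "\<dots> \<le> opt v B A' c" using B_pos \<open>x \<in> {b..}\<close> assms by (intro V.opt_antimono) auto
  finally show "Orc A' (c(i := x)) \<le> opt v B A' c" .
qed auto

lemma heads_alloc_subset: "heads_alloc Orc v B A c \<subseteq> affordable B A c"
proof -
  interpret V: valued "affordable B A c" v by (rule valued_affordable)
  show ?thesis using V.greedy_item_in[of _ c] by (auto simp: heads_alloc_def modified_greedy_om_def)
qed

text \<open>For bids within the budget the mechanism always acts on \<open>insert i R\<close>, so
  this set can be held fixed; all larger bids lose.\<close>

lemma heads_wins_iff: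
  fixes c :: "'a \<Rightarrow> real"
  assumes "i \<in> A" "card A \<le> N"
  defines "R \<equiv> affordable B A c - {i}"
  shows "i \<in> heads_alloc Orc v B A (c(i := b)) \<longleftrightarrow> b \<le> B \<and>
    (\<exists>k<N. beats c i b (greedy_state c R k) \<and> v (insert i (fst (greedy_state c R k))) \<le>
       1/2 * (SUP x\<in>{b..}. Orc (insert i R) (c(i := x))))"
proof (cases "b \<le> B")
  case True
  have eq: "affordable B A (c(i := b)) = insert i R" "insert i R - {i} = R" and sub: "insert i R \<subseteq> A"
    using True assms(1) affordable_subset[of B A c] by (auto simp: affordable_upd R_def)
  interpret V: valued "insert i R" v using sub by (rule valued_subset)
  have "card (insert i R) \<le> N" using card_mono[OF finite_A sub] assms(2) by simp
  then show ?thesis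
    using V.mem_modified_greedy_om_iff[of i N Orc "1/2" c b] True eq by (simp add: heads_alloc_def)
next
  case False
  then show ?thesis using heads_alloc_subset[of "c(i := b)"] by (auto simp: affordable_def)
qed

lemma state_ok_rivals: "state_ok (greedy_state c (affordable B A c - {i}) k)"
  using affordable_subset[of B A c] by (intro state_ok_greedy_state) auto

lemma heads_wins_antimono:
  assumes "cost_vector_on A c" "i \<in> A" "0 \<le> b'" "b' \<le> b" "i \<in> heads_alloc Orc v B A (c(i := b))"
  shows "i \<in> heads_alloc Orc v B A (c(i := b'))"
proof -
  let ?R = "affordable B A c - {i}"
  let ?G = "greedy_state c ?R"
  have sub: "insert i ?R \<subseteq> A" using assms(2) affordable_subset[of B A c] by auto
  obtain k where k: "k < card A" "b \<le> B" "beats c i b (?G k)"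
    "v (insert i (fst (?G k))) \<le> 1/2 * (SUP x\<in>{b..}. Orc (insert i ?R) (c(i := x)))"
    using heads_wins_iff[OF assms(2) order_refl, of c b] assms(5) by auto
  have "snd (?G k) \<subseteq> ?R" using greedy_state_snd[of ?R c k] sub by auto
  then have "beats c i b' (?G k)"
    using assms k sub by (intro beats_antimono[OF state_ok_rivals _ _ _ assms(3,4) k(3)])
      (auto simp: cost_vector_on_def)
  moreover have "(SUP x\<in>{b..}. Orc (insert i ?R) (c(i := x))) \<le> (SUP x\<in>{b'..}. Orc (insert i ?R) (c(i := x)))"
    using assms sub by (intro cSUP_subset_mono bdd_above_Orc) auto
  ultimately show ?thesis
    unfolding heads_wins_iff[OF assms(2) order_refl] using k assms(4) by (intro conjI exI[of _ k]) auto
qed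

lemma truthful_heads: "truthful A (with_threshold_payments (heads_alloc Orc v B A))"
proof (rule truthful_threshold)
  fix c i assume "i \<in> A"
  then show "\<exists>b\<ge>0. i \<notin> heads_alloc Orc v B A (c(i := b))"
    using B_pos by (intro exI[of _ "B + 1"]) (auto simp: heads_wins_iff[OF _ order_refl])
qed (rule heads_wins_antimono)

text \<open>An optimal set is covered by the prefix up to \<open>i\<close>, worth at most half the optimum, and by
  further items whose marginal value per cost is at most that of \<open>i\<close> at the bid \<open>b\<close>.\<close>

lemma winning_bid_le:
  assumes c: "cost_vector_on A c" and k: "k < card (affordable B A c)"
    and item: "greedy_item v c (affordable B A c) k = i"
    and b: "c i \<le> b" "i \<in> heads_alloc Orc v B A (c(i := b))"
  shows "b * opt v B (affordable B A c) c
    \<le> 2 * B * marginal v i (greedy_prefix v c (affordable B A c) k)"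
proof -
  let ?A = "affordable B A c"
  let ?R = "?A - {i}"
  let ?G = "greedy_state c ?R"
  let ?o = "opt v B ?A c"
  interpret V: valued ?A v by (rule valued_affordable)
  have iA: "i \<in> ?A" using V.greedy_item_in[OF k] item by auto
  then have ins: "insert i ?R = ?A" and iA': "i \<in> A" using affordable_subset[of B A c] by auto
  have ci: "0 \<le> c i" using c iA' by (simp add: cost_vector_on_def)
  have b0: "0 \<le> b" using b ci by simp
  have sub: "?R \<subseteq> A" using affordable_subset[of B A c] by auto
  note pos = V.greedy_item_bid[of i k c "c i", OF iA k]
  have pre: "greedy_prefix v c ?A k = fst (?G k)" "\<And>l. l < k \<Longrightarrow> \<not> beats c i (c i) (?G l)"
    using pos item by auto
  obtain l where l: "beats c i b (?G l)"
    "v (insert i (fst (?G l))) \<le> 1/2 * (SUP x\<in>{b..}. Orc ?A (c(i := x)))"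
    using b(2) unfolding heads_wins_iff[OF iA' order_refl] ins by auto
  define T where "T = fst (?G l)"
  have T: "?G l = (T, ?R - T)" "T \<subseteq> ?R"
    using greedy_state_snd[of ?R c l] greedy_state_subset[of ?R c l] sub
    by (auto simp: T_def prod_eq_iff)
  \<comment> \<open>State \<open>l\<close> is where the bid \<open>b\<close> wins. The true cost
    beats it too, but beats no state before \<open>k\<close>; so the prefix of the higher bid
    extends that of the true cost.\<close>
  have "beats c i (c i) (?G l)"
    using c iA' sub T b ci
    by (intro beats_antimono[OF state_ok_rivals _ _ _ _ _ l(1)]) (auto simp: cost_vector_on_def)
  then have "k \<le> l" using pre(2) not_le by blast
  then have kT: "fst (?G k) \<subseteq> T" unfolding T_def using sub by (rule_tac greedy_state_mono) auto
  have TA: "T \<subseteq> A" "i \<notin> T" using T sub by auto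
  have half: "v (insert i T) \<le> ?o / 2"
    using l(2) SUP_Orc_le_opt[OF affordable_subset c ci b(1), of B c] by (simp add: T_def)
  obtain Q where Q: "Q \<subseteq> ?A" "sum c Q \<le> B" "?o = v Q"
    using V.opt_attained B_pos less_imp_le by metis
  have QA: "Q \<subseteq> A" using Q(1) affordable_subset[of B A c] by blast
  then have Qf: "finite Q" by (rule finite_sub)
  let ?D = "Q - insert i T"
  have m0: "0 \<le> marginal v i T" using marginal_nonneg TA iA' by simp
  have cross: "marginal v x (insert i T) * b \<le> marginal v i T * c x" if x: "x \<in> ?D" for x
  proof -
    have xR: "x \<in> ?R - T" using x Q(1) by auto
    have best: "best_item v (c(i := b)) T (insert i (?R - T)) = i"
      using l(1) T(1) by (simp add: beats_def)
    have "ratio v (c(i := b)) T x \<le> ratio v (c(i := b)) T i"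
      using best_item_max[of "insert i (?R - T)" x "c(i := b)" T] xR best finite_sub[OF sub]
      by (simp del: fun_upd_apply)
    then have "marginal v x T * (c(i := b)) i \<le> marginal v i T * (c(i := b)) x"
      using xR sub c b0 TA iA'
      by (intro ratio_le_cross) (auto simp: cost_vector_on_def simp del: fun_upd_apply, auto)
    moreover have "marginal v x (insert i T) \<le> marginal v x T"
      using TA iA' xR sub by (intro marginal_antimono) auto
    ultimately show ?thesis using b0 xR mult_right_mono[of "marginal v x (insert i T)" "marginal v x T" b]
      by auto
  qed
  have "?o \<le> v (insert i T \<union> Q)" using Q(3) TA iA' QA by (auto intro!: value_mono)
  also have "\<dots> \<le> v (insert i T) + (\<Sum>x\<in>?D. marginal v x (insert i T))"
    using TA iA' QA by (intro value_union_le) auto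
  finally have "?o / 2 \<le> (\<Sum>x\<in>?D. marginal v x (insert i T))" using half by linarith
  then have "b * (?o / 2) \<le> b * (\<Sum>x\<in>?D. marginal v x (insert i T))"
    using b0 by (intro mult_left_mono)
  also have "\<dots> = (\<Sum>x\<in>?D. marginal v x (insert i T) * b)"
    by (simp add: sum_distrib_left mult.commute)
  also have "\<dots> \<le> (\<Sum>x\<in>?D. marginal v i T * c x)" by (intro sum_mono cross)
  also have "\<dots> = marginal v i T * sum c ?D" by (simp add: sum_distrib_left)
  also have "\<dots> \<le> marginal v i T * B"
  proof (intro mult_left_mono m0)
    have "sum c ?D \<le> sum c Q" using QA Qf c by (intro sum_mono2) (auto simp: cost_vector_on_def)
    then show "sum c ?D \<le> B" using Q by simp
  qed
  also have "\<dots> \<le> marginal v i (fst (?G k)) * B"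
    using kT TA iA' B_pos by (intro mult_right_mono marginal_antimono) auto
  finally show ?thesis using pre(1) by (simp add: mult.commute)
qed

lemma heads_payment_le:
  assumes "i \<in> A" shows "threshold_payment (heads_alloc Orc v B A) c i \<le> B"
  using assms B_pos by (intro threshold_payment_le) (auto simp: heads_wins_iff[OF _ order_refl])

lemma heads_budget:
  assumes c: "cost_vector_on A c" and one: "at_most_one_worthless A v"
  shows "(\<Sum>i\<in>A. threshold_payment (heads_alloc Orc v B A) c i) \<le> B"
proof -
  let ?A = "affordable B A c"
  let ?W = "heads_alloc Orc v B A c"
  let ?p = "threshold_payment (heads_alloc Orc v B A) c"
  let ?o = "opt v B ?A c"
  let ?S = "greedy_prefix v c ?A"
  let ?g = "greedy_item v c ?A"
  interpret V: valued ?A v by (rule valued_affordable)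
  have WA: "?W \<subseteq> ?A" by (rule heads_alloc_subset)
  have "(\<Sum>i\<in>A. ?p i) = (\<Sum>i\<in>?W. ?p i)"
    using WA affordable_subset[of B A c] finite_A
    by (intro sum.mono_neutral_right) (auto simp: threshold_payment_def)
  also have "\<dots> \<le> B"
  proof (cases "?o = 0")
    \<comment> \<open>Without a positive optimum there is nothing to divide by. All affordable
      sellers are then worthless, so there is at most one, and its payment is at most
      \<open>B\<close>.\<close>
    case True
    have "v {i} = 0" if "i \<in> ?A" for i
      using V.opt_ge[of "{i}" c B] V.value_nonneg[of "{i}"] that True by (auto simp: affordable_def)
    then have "\<forall>i\<in>?A. \<forall>j\<in>?A. i = j"
      using one affordable_subset[of B A c] unfolding at_most_one_worthless_def by blast
    then have "card ?A \<le> 1" by (auto simp: card_le_Suc0_iff_eq V.finite_A)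
    then have "card ?W \<le> 1" using card_mono[OF V.finite_A WA] by simp
    moreover have "(\<Sum>i\<in>?W. ?p i) \<le> of_nat (card ?W) * B"
      using WA affordable_subset[of B A c] heads_payment_le by (intro sum_bounded_above) blast
    moreover have "of_nat (card ?W) * B \<le> 1 * B"
      using \<open>card ?W \<le> 1\<close> B_pos by (intro mult_right_mono) auto
    ultimately show ?thesis by simp
  next
    case False
    then have o: "0 < ?o" using V.opt_nonneg[of B c] B_pos by simp
    define K where "K = {k. k < card ?A \<and> ?g k \<in> ?W}"
    have "finite K" by (simp add: K_def)
    have W: "?W = ?g ` K"
      using WA by (auto simp: K_def heads_alloc_def modified_greedy_om_def)
    have inj: "inj_on ?g K" using V.inj_on_greedy_item[of c] by (rule inj_on_subset) (auto simp: K_def)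
    have half: "v (?S (Suc k)) \<le> ?o / 2" if k: "k \<in> K" for k
    proof -
      obtain l where l: "l < card ?A" "?g k = ?g l"
        "v (?S (Suc l)) \<le> 1/2 * (SUP x\<in>{c (?g k)..}. Orc ?A (c(?g k := x)))"
        using k unfolding K_def heads_alloc_def modified_greedy_om_def
        by (simp del: greedy_prefix.simps split: if_splits) metis
      have "k = l" using inj_onD[OF V.inj_on_greedy_item l(2)] l(1) k by (auto simp: K_def)
      moreover have "(SUP x\<in>{c (?g k)..}. Orc ?A (c(?g k := x))) \<le> ?o"
        using V.greedy_item_in[OF l(1), of c] c affordable_subset[of B A c] l(2)
        by (intro SUP_Orc_le_opt affordable_subset) (auto simp: cost_vector_on_def)
      ultimately show ?thesis using l(3) by (simp del: greedy_prefix.simps)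
    qed
    have step: "?p (?g k) \<le> 2 * B / ?o * (v (?S (Suc k)) - v (?S k))" if k: "k \<in> K" for k
    proof -
      let ?i = "?g k" and ?w = "2 * B / ?o * (v (?S (Suc k)) - v (?S k))"
      have kc: "k < card ?A" "?i \<in> ?W" using k by (auto simp: K_def)
      have iA: "?i \<in> ?A" using V.greedy_item_in[OF kc(1), of c] by auto
      have m: "marginal v ?i (?S k) = v (?S (Suc k)) - v (?S k)"
        by (simp add: marginal_def V.greedy_prefix_Suc del: greedy_prefix.simps)
      have "v (?S k) \<le> v (?S (Suc k))"
        using kc by (intro V.value_mono V.greedy_prefix_mono V.greedy_prefix_subset) auto
      then have w0: "0 \<le> ?w" using o B_pos by simp
      have bound: "b \<le> ?w" if "c ?i \<le> b" "?i \<in> heads_alloc Orc v B A (c(?i := b))" for b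
        using winning_bid_le[OF c kc(1) refl that] o m by (simp add: field_simps)
      \<comment> \<open>A bid below the true cost is bounded by the true cost, which itself
        wins.\<close>
      have "b \<le> ?w" if "?i \<in> heads_alloc Orc v B A (c(?i := b))" for b
        using bound[OF _ that] bound[of "c ?i"] kc(2) by (cases "c ?i \<le> b") auto
      then show ?thesis using w0 by (intro threshold_payment_le) fastforce+
    qed
    have "(\<Sum>i\<in>?W. ?p i) = (\<Sum>k\<in>K. ?p (?g k))" unfolding W by (simp add: sum.reindex[OF inj])
    also have "\<dots> \<le> (\<Sum>k\<in>K. 2 * B / ?o * (v (?S (Suc k)) - v (?S k)))" by (intro sum_mono step)
    also have "\<dots> \<le> B"
    proof (cases "K = {}")
      case False
      \<comment> \<open>The estimate depends on the seller, so winners need not form a prefix.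
        Filling in all positions up to the last winner makes the sum telescope, and the prefix of
        that winner is worth at most half the optimum.\<close>
      define q where "q = Max K"
      have q: "q \<in> K" "K \<subseteq> {..<Suc q}" "q < card ?A"
        using \<open>finite K\<close> False Max_in[of K] by (auto simp: q_def less_Suc_eq_le K_def)
      have inc: "0 \<le> v (?S (Suc k)) - v (?S k)" if "k < Suc q" for k
        using that q V.value_mono[OF V.greedy_prefix_mono[of k "Suc k" c] V.greedy_prefix_subset[of "Suc k" c]]
        by simp
      have "(\<Sum>k\<in>K. 2 * B / ?o * (v (?S (Suc k)) - v (?S k)))
          \<le> (\<Sum>k<Suc q. 2 * B / ?o * (v (?S (Suc k)) - v (?S k)))"
        using q inc o B_pos by (intro sum_mono2) (auto simp del: greedy_prefix.simps)
      also have "\<dots> = 2 * B / ?o * (v (?S (Suc q)) - v (?S 0))"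
        by (simp only: sum_distrib_left[symmetric]
              sum_lessThan_telescope[of "\<lambda>k. v (?S k)" "Suc q"])
      also have "\<dots> \<le> 2 * B / ?o * (?o / 2)"
        using half[OF q(1)] V.value_nonneg[of "{}"] o B_pos
        by (intro mult_left_mono) (auto simp del: greedy_prefix.simps(2))
      finally show ?thesis using o by simp
    qed (use B_pos in simp)
    finally show ?thesis .
  qed
  finally show ?thesis .
qed

text \<open>Each branch is played with probability 1/2, so the factor \<open>2 * r\<close> here
  becomes \<open>4 * r\<close> in expectation.\<close>

lemma heads_tails_value:
  assumes c: "cost_vector_on A c"
  shows "opt v B A c \<le> 2 * r * (v (heads_alloc Orc v B A c) + v (tails_alloc v B A c))"
proof (cases "affordable B A c = {}")
  case True
  then have "opt v B A c = v {}"
    using opt_affordable[OF c, of B] B_pos by (simp add: opt_def conj_commute cong: conj_cong)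
  moreover have "v {} \<le> 2 * r * (v {} + v {})"
    using r_ge value_nonneg[of "{}"] mult_right_mono[of 1 "4 * r" "v {}"] by simp
  ultimately show ?thesis using True by (simp add: heads_alloc_def tails_alloc_def)
next
  case False
  let ?A = "affordable B A c"
  let ?W = "heads_alloc Orc v B A c"
  let ?S = "greedy_prefix v c ?A"
  let ?g = "greedy_item v c ?A"
  interpret V: valued ?A v by (rule valued_affordable)
  define o' where "o' = opt v B ?A c"
  have o0: "0 \<le> o'" using V.opt_nonneg B_pos by (simp add: o'_def)
  have WA: "?W \<subseteq> ?A" by (rule heads_alloc_subset)
  have win: "?g k \<in> ?W" if k: "k < card ?A" "v (?S (Suc k)) \<le> o' / (2 * r)" for k
  proof -
    let ?i = "?g k"
    have "?i \<in> ?A" using V.greedy_item_in[OF k(1), of c] by auto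
    then have ci: "0 \<le> c ?i" using c affordable_subset[of B A c] by (auto simp: cost_vector_on_def)
    \<comment> \<open>The declared costs are among the vectors over which the supremum is taken, so
      it inherits the guarantee of the oracle.\<close>
    have "o' / r \<le> Orc ?A c"
      using opt_le_Orc[OF affordable_subset c, of B] r_ge by (simp add: o'_def field_simps)
    also have "Orc ?A c = Orc ?A (c(?i := c ?i))" by simp
    also have "\<dots> \<le> (SUP x\<in>{c ?i..}. Orc ?A (c(?i := x)))"
      using bdd_above_Orc[OF affordable_subset c ci] by (intro cSUP_upper) auto
    finally have "v (?S (Suc k)) \<le> 1/2 * (SUP x\<in>{c ?i..}. Orc ?A (c(?i := x)))"
      using k(2) by simp
    then show ?thesis using k(1) False by (auto simp: heads_alloc_def modified_greedy_om_def)
  qed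
  have prefix: "?S k \<subseteq> ?W" if "k \<le> card ?A" "v (?S k) \<le> o' / (2 * r)" for k
    using that
  proof (induction k)
    case (Suc k)
    have "v (?S k) \<le> v (?S (Suc k))"
      using Suc.prems by (intro V.value_mono V.greedy_prefix_mono V.greedy_prefix_subset) auto
    then have "?S k \<subseteq> ?W" using Suc by simp
    then show ?case using win[of k] Suc.prems by (simp add: V.greedy_prefix_Suc del: greedy_prefix.simps)
  qed simp
  have tails: "v (tails_alloc v B A c) = v {most_valuable v ?A}" using False by (simp add: tails_alloc_def)
  have tails0: "0 \<le> v (tails_alloc v B A c)" using tails_alloc_subset by (rule value_nonneg)
  have "o' / (2 * r) \<le> v ?W + v (tails_alloc v B A c)"
  proof (cases "\<exists>k\<le>card ?A. o' / (2 * r) < v (?S k)")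
    case True
    define k where "k = (LEAST k. k \<le> card ?A \<and> o' / (2 * r) < v (?S k))"
    have k: "k \<le> card ?A" "o' / (2 * r) < v (?S k)"
      unfolding k_def using LeastI_ex[OF True] by auto
    have least: "v (?S l) \<le> o' / (2 * r)" if "l < k" for l
      using not_less_Least[of l "\<lambda>k. k \<le> card ?A \<and> o' / (2 * r) < v (?S k)"] that k(1)
      unfolding k_def by auto
    show ?thesis
    proof (cases k)
      \<comment> \<open>\<open>v {}\<close> may be positive, so already the empty prefix can exceed
        the bound.\<close>
      case 0
      then have "v (?S k) \<le> v ?W" using WA by (auto intro: V.value_mono)
      then show ?thesis using k(2) tails0 by linarith
    next
      case (Suc l)
      have l: "l < card ?A" using Suc k by simp
      have "?S l \<subseteq> ?W" using prefix[of l] least[of l] Suc k by simp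
      then have "v (?S l) \<le> v ?W" using WA by (intro V.value_mono)
      moreover have "v (?S k) \<le> v (?S l) + v {?g l}"
        unfolding Suc V.greedy_prefix_Suc
        using V.greedy_item_in[OF l, of c] V.greedy_prefix_subset[of l c] l
        by (intro V.value_insert_le) auto
      moreover have "v {?g l} \<le> v {most_valuable v ?A}"
        using V.most_valuable_in(2)[OF False] V.greedy_item_in[OF l, of c] by auto
      ultimately show ?thesis using k(2) tails by linarith
    qed
  next
    case False
    then have le: "v (?S (card ?A)) \<le> o' / (2 * r)" by (meson not_le order_refl)
    have "?S (card ?A) = ?A"
      using V.greedy_prefix_props[of "card ?A" c] by (intro card_subset_eq V.finite_A) auto
    then have "?W = ?A" using prefix[OF order_refl le] WA by simp
    moreover have "o' \<le> v ?A" unfolding o'_def using V.opt_le_total B_pos by simp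
    moreover have "o' / (2 * r) \<le> o'" using o0 r_ge mult_left_mono[of 1 "2 * r" o']
      by (simp add: divide_le_eq)
    ultimately show ?thesis using tails0 by simp
  qed
  then show ?thesis using r_ge opt_affordable[OF c, of B] by (simp add: o'_def field_simps)
qed

lemma mechanism_properties:
  shows "universally_truthful A (modified_random_om Orc (1/2) v B A)"
    and "at_most_one_worthless A v \<Longrightarrow> budget_feasible A B (modified_random_om Orc (1/2) v B A)"
    and "approximates_opt (4 * r) A v B (modified_random_om Orc (1/2) v B A)"
proof -
  show "universally_truthful A (modified_random_om Orc (1/2) v B A)"
    using truthful_heads truthful_tails[OF B_pos]
    by (auto simp: universally_truthful_def modified_random_om_def random_om_branch_eq)
  show "budget_feasible A B (modified_random_om Orc (1/2) v B A)" if "at_most_one_worthless A v"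
    using heads_budget[OF _ that] tails_budget[OF B_pos]
    by (auto simp: budget_feasible_def modified_random_om_def random_om_branch_eq
        with_threshold_payments_def)
  show "approximates_opt (4 * r) A v B (modified_random_om Orc (1/2) v B A)"
    unfolding approximates_opt_def
  proof (intro allI impI)
    fix c :: "'a \<Rightarrow> real" assume c: "cost_vector_on A c"
    have E: "measure_pmf.expectation (modified_random_om Orc (1/2) v B A) (\<lambda>M. v (fst M c)) =
        (v (heads_alloc Orc v B A c) + v (tails_alloc v B A c)) / 2"
      by (simp add: modified_random_om_def random_om_branch_eq with_threshold_payments_def field_simps)
    show "4 * r * measure_pmf.expectation (modified_random_om Orc (1/2) v B A)
        (\<lambda>M. v (fst M c)) \<ge> opt v B A c"
      unfolding E using heads_tails_value[OF c] by simp
  qed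
qed

end

section \<open>Sviridenko's greedy algorithm\<close>

lemma ex_maximizer:
  fixes f :: "'b \<Rightarrow> real"
  assumes "finite S" "S \<noteq> {}"
  obtains x where "x \<in> S" "\<And>y. y \<in> S \<Longrightarrow> f y \<le> f x"
proof -
  have "Max (f ` S) \<in> f ` S" using assms by simp
  then obtain x where "x \<in> S" "f x = Max (f ` S)" by auto
  then show ?thesis using that assms by simp
qed

definition fits :: "('a \<Rightarrow> real) \<Rightarrow> real \<Rightarrow> 'a set \<Rightarrow> 'a \<Rightarrow> bool" where
  "fits c B T j \<longleftrightarrow> sum c T + c j \<le> B"

context valued
begin

text \<open>Unlike \<open>greedy_fill\<close>, it starts from any state, which the inductions along
  a run need.\<close>

definition filled :: "('a \<Rightarrow> real) \<Rightarrow> real \<Rightarrow> 'a set \<Rightarrow> 'a set \<Rightarrow> 'a set" where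
  "filled c B T R = fst ((gstep c (fits c B) ^^ card R) (T, R))"

lemma filled_eq_run:
  assumes "state_ok (T, R)" "card R \<le> k"
  shows "filled c B T R = fst ((gstep c (fits c B) ^^ k) (T, R))"
  using run_stable[OF assms(1), of "card R" k c "fits c B"] assms(2) by (simp add: filled_def)

lemma filled_empty: "filled c B T {} = T"
  by (simp add: filled_def)

lemma filled_step:
  fixes c :: "'a \<Rightarrow> real"
  assumes "state_ok (T, R)" "R \<noteq> {}"
  defines "j \<equiv> best_item v c T R"
  shows "filled c B T R = filled c B (if fits c B T j then insert j T else T) (R - {j})"
proof -
  have "finite R" using state_okD(4)[OF assms(1)] by simp
  then have "card R = Suc (card (R - {j}))"
    using best_item_in[of R c T] assms(2) by (metis card.remove j_def)
  then show ?thesis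
    using assms(2) by (simp add: filled_def funpow_Suc_right gstep_def j_def Let_def del: funpow.simps)
qed

lemma filled_subset:
  assumes "state_ok (T, R)"
  shows "T \<subseteq> filled c B T R" "filled c B T R \<subseteq> T \<union> R" "filled c B T R \<subseteq> A"
  using run_fst_mono[OF assms, where c = c and acc = "fits c B" and k = "card R"]
    run_un[OF assms, where c = c and acc = "fits c B" and k = "card R"] state_okD(1,2)[OF assms]
  by (auto simp: filled_def)

lemma run_feasible:
  assumes "state_ok s" "sum c (fst s) \<le> B"
  shows "sum c (fst ((gstep c (fits c B) ^^ k) s)) \<le> B"
proof (induction k)
  case (Suc k)
  define t where "t = (gstep c (fits c B) ^^ k) s"
  have t: "state_ok t" unfolding t_def by (rule state_ok_run[OF assms(1)])
  have "finite (fst t)" "finite (snd t)" using state_okD[OF t] by auto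
  moreover have "best_item v c (fst t) (snd t) \<notin> fst t" if "snd t \<noteq> {}"
    using best_item_in[OF \<open>finite (snd t)\<close> that] state_okD(5)[OF t] by blast
  ultimately have "sum c (fst (gstep c (fits c B) t)) \<le> B"
    using Suc[folded t_def] by (auto simp: gstep_def fits_def Let_def case_prod_beta)
  then show ?case by (simp add: t_def)
qed (use assms in simp)

lemma filled_feasible:
  "state_ok (T, R) \<Longrightarrow> sum c T \<le> B \<Longrightarrow> sum c (filled c B T R) \<le> B"
  unfolding filled_def using run_feasible[of "(T, R)" c B] by simp

lemma greedy_fill_eq:
  assumes "U \<subseteq> A"
  shows "greedy_fill v B A c U = filled c B U (A - U)"
proof -
  have ok: "state_ok (U, A - U)" using assms by (auto simp: state_ok_def)
  have "(fill_step v B c ^^ k) (U, A - U) = (gstep c (fits c B) ^^ k) (U, A - U)" if "k \<le> card (A - U)" for k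
    using that
  proof (induction k)
    case (Suc k)
    have "card (snd ((gstep c (fits c B) ^^ k) (U, A - U))) \<noteq> 0"
      using run_card[OF ok, where c = c and acc = "fits c B" and k = k] Suc.prems by simp
    then have "snd ((gstep c (fits c B) ^^ k) (U, A - U)) \<noteq> {}" by auto
    then have "fill_step v B c ((gstep c (fits c B) ^^ k) (U, A - U)) =
        gstep c (fits c B) ((gstep c (fits c B) ^^ k) (U, A - U))"
      by (cases "(gstep c (fits c B) ^^ k) (U, A - U)") (simp add: gstep_def fill_step_def fits_def Let_def)
    then show ?case using Suc by simp
  qed simp
  then show ?thesis by (simp add: greedy_fill_def filled_def)
qed

text \<open>The maximum is used only through comparisons with some \<open>V\<close>, which ask for a
  single good candidate.\<close>

lemma sviridenko_ge_iff:
  assumes "0 \<le> B"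
  shows "V \<le> sviridenko v B A c \<longleftrightarrow>
    (\<exists>S\<subseteq>A. card S \<le> 2 \<and> sum c S \<le> B \<and> V \<le> v S) \<or>
    (\<exists>U\<subseteq>A. card U = 3 \<and> sum c U \<le> B \<and> V \<le> v (filled c B U (A - U)))"
proof -
  let ?S = "{S. S \<subseteq> A \<and> card S \<le> 2 \<and> sum c S \<le> B}"
  let ?U = "{U. U \<subseteq> A \<and> card U = 3 \<and> sum c U \<le> B}"
  have "finite ?S" "finite ?U" using finite_A by (auto intro: finite_subset[of _ "Pow A"])
  moreover have "{} \<in> ?S" using assms by simp
  ultimately have "V \<le> sviridenko v B A c \<longleftrightarrow> (\<exists>x\<in>?S \<union> greedy_fill v B A c ` ?U. V \<le> v x)"
    unfolding sviridenko_def by (subst Max_ge_iff) blast+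
  also have "\<dots> \<longleftrightarrow> (\<exists>S\<in>?S. V \<le> v S) \<or> (\<exists>U\<in>?U. V \<le> v (filled c B U (A - U)))"
    using greedy_fill_eq[of _ B c] by auto
  finally show ?thesis by blast
qed

lemma state_ok_split: "U \<subseteq> A \<Longrightarrow> R \<subseteq> A \<Longrightarrow> U \<inter> R = {} \<Longrightarrow> state_ok (U, R)"
  by (simp add: state_ok_def)

section \<open>Approximation quality of Sviridenko's algorithm\<close>

lemma sviridenko_le_opt:
  assumes "0 \<le> B"
  shows "sviridenko v B A c \<le> opt v B A c"
proof -
  have "sviridenko v B A c \<le> sviridenko v B A c" ..
  then consider S where "S \<subseteq> A" "sum c S \<le> B" "sviridenko v B A c \<le> v S"
    | U where "U \<subseteq> A" "sum c U \<le> B" "sviridenko v B A c \<le> v (filled c B U (A - U))"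
    unfolding sviridenko_ge_iff[OF assms] by blast
  then show ?thesis
  proof cases
    case (1 S)
    then show ?thesis using opt_ge[of S c B] by linarith
  next
    case (2 U)
    have ok: "state_ok (U, A - U)" using 2 by (intro state_ok_split) auto
    have "v (filled c B U (A - U)) \<le> opt v B A c"
      using filled_subset(3)[OF ok] filled_feasible[OF ok 2(2)] by (intro opt_ge)
    then show ?thesis using 2 by linarith
  qed
qed

text \<open>For the case that the three starting items use up the whole budget: the rest of an
  optimal set then costs nothing and is never rejected.\<close>

lemma filled_zero_cost:
  assumes "state_ok (T, R)" "sum c T \<le> B" "Q \<subseteq> T \<union> R" "\<And>j. j \<in> Q \<inter> R \<Longrightarrow> c j = 0"
  shows "Q \<subseteq> filled c B T R"
  using assms
proof (induction "card R" arbitrary: T R)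
  case 0
  then have "R = {}" using state_okD(4)[OF 0(2)] by simp
  then show ?case using 0 by (simp add: filled_empty)
next
  case (Suc n)
  define j where "j = best_item v c T R"
  have fin: "finite R" "finite T" using state_okD[OF Suc(3)] by auto
  have ne: "R \<noteq> {}" using Suc(2) by auto
  have j: "j \<in> R" using best_item_in fin ne by (simp add: j_def)
  have jT: "j \<notin> T" using Suc(3) j by (auto simp: state_ok_def)
  let ?T = "if fits c B T j then insert j T else T"
  have "sum c ?T \<le> B" using Suc(4) jT fin by (auto simp: fits_def)
  moreover have "j \<in> Q \<Longrightarrow> fits c B T j" using Suc(4) Suc(6)[of j] j by (simp add: fits_def)
  ultimately have "Q \<subseteq> filled c B ?T (R - {j})"
    using Suc(2-) j fin by (intro Suc(1)) (auto simp: state_ok_def)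
  then show ?case using filled_step[OF Suc(3) ne, of c B, folded j_def] by argo
qed

text \<open>In the application \<open>Q\<close> is optimal and \<open>Y\<close> consists of the
  three items to start from. The best ratio is at least the gap \<open>v Q - v T\<close> divided by
  the budget \<open>B - sum c Y\<close> that is left for \<open>Q - Y\<close>, so spending makes the
  gap decay exponentially. When an item of \<open>Q\<close> is first rejected, taking it would have
  spent this whole budget and left at most the fraction \<open>1 / e\<close> of the gap;
  \<open>w\<close> bounds the value of that one item. If none is rejected, the gap closes.\<close>

lemma filled_value:
  assumes Q: "Y \<subseteq> Q" "Q \<subseteq> A" "sum c Q \<le> B" and c: "cost_vector_on A c" and D: "sum c Y < B"
    and w: "\<And>x T. x \<in> Q - Y \<Longrightarrow> Y \<subseteq> T \<Longrightarrow> T \<subseteq> A \<Longrightarrow> marginal v x T \<le> w" "0 \<le> w"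
    and "state_ok (T, R)" "Y \<subseteq> T" "Q \<subseteq> T \<union> R" "sum c T \<le> B"
    and "v Q - v T \<le> (v Q - v Y) * exp (- (sum c T - sum c Y) / (B - sum c Y))"
  shows "v Q - v (filled c B T R) \<le> (v Q - v Y) * exp (- 1) + w"
  using assms(8-)
proof (induction "card R" arbitrary: T R)
  case 0
  then have "R = {}" using state_okD(4)[OF 0(2)] by simp
  then have "v Q \<le> v T" using 0 state_okD(1)[OF 0(2)] by (intro value_mono) auto
  moreover have "0 \<le> (v Q - v Y) * exp (- 1)" using Q by (simp add: value_mono)
  ultimately show ?case using \<open>R = {}\<close> w(2) by (simp add: filled_empty)
next
  case (Suc n)
  define j where "j = best_item v c T R"
  define T' where "T' = (if fits c B T j then insert j T else T)"
  have ok: "T \<subseteq> A" "R \<subseteq> A" "finite T" "finite R" "T \<inter> R = {}"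
    using state_okD[OF Suc(3)] Suc(3) by (auto simp: state_ok_def)
  have ne: "R \<noteq> {}" using Suc(2) by auto
  have j: "j \<in> R" using best_item_in ok ne by (simp add: j_def)
  have jT: "j \<notin> T" "j \<in> A" using ok j by auto
  have c0: "0 \<le> c x" if "x \<in> A" for x using c that by (simp add: cost_vector_on_def)
  have step: "filled c B T R = filled c B T' (R - {j})"
    using filled_step[OF Suc(3) ne] by (simp add: j_def T'_def)
  have ok': "state_ok (T', R - {j})" using ok jT j by (auto simp: T'_def state_ok_def)
  have feas: "sum c T' \<le> B" using Suc(6) jT ok by (auto simp: T'_def fits_def)
  have card: "n = card (R - {j})" using Suc(2) j ok by simp
  define D where "D = B - sum c Y"
  have D0: "0 < D" using \<open>sum c Y < B\<close> by (simp add: D_def)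
  define d where "d = v Q - v T"
  let ?m = "marginal v j T"
  have m0: "0 \<le> ?m" using marginal_nonneg ok jT by simp
  \<comment> \<open>The items of \<open>Q\<close> still missing cost at most \<open>D\<close>, and
    none has a better ratio than \<open>j\<close>.\<close>
  have "d * c j \<le> ?m * D"
  proof -
    have QT: "Q - T \<subseteq> R" using Suc(5) by auto
    have cross: "marginal v x T * c j \<le> ?m * c x" if "x \<in> Q - T" for x
      using best_item_max[OF ok(4) ne, of x c T] that QT ok jT c0
      by (intro ratio_le_cross) (auto simp: j_def)
    have "v Q \<le> v (T \<union> Q)" using ok Q by (intro value_mono) auto
    also have "\<dots> \<le> v T + (\<Sum>x\<in>Q - T. marginal v x T)" using ok Q by (intro value_union_le)
    finally have "d * c j \<le> (\<Sum>x\<in>Q - T. marginal v x T) * c j"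
      using c0[OF jT(2)] by (intro mult_right_mono) (auto simp: d_def)
    also have "\<dots> = (\<Sum>x\<in>Q - T. marginal v x T * c j)" by (simp add: sum_distrib_right)
    also have "\<dots> \<le> (\<Sum>x\<in>Q - T. ?m * c x)" by (intro sum_mono cross)
    also have "\<dots> = ?m * sum c (Q - T)" by (simp add: sum_distrib_left)
    also have "\<dots> \<le> ?m * D"
    proof (intro mult_left_mono m0)
      have "finite Q" using Q(2) by (rule finite_sub)
      have "sum c (Q - T) \<le> sum c (Q - Y)"
        using \<open>finite Q\<close> Suc(4) Q c0 by (intro sum_mono2) auto
      also have "\<dots> = sum c Q - sum c Y" using \<open>finite Q\<close> Q by (simp add: sum_diff)
      finally show "sum c (Q - T) \<le> D" using Q(3) by (simp add: D_def)
    qed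
    finally show ?thesis .
  qed
  have E0: "0 \<le> v Q - v Y" using Q by (simp add: value_mono)
  \<comment> \<open>Stated for \<open>insert j T\<close> whether or not \<open>j\<close> fits, since
    the decay is also needed for the item at which the budget is overrun.\<close>
  have key: "v Q - v (insert j T) \<le> (v Q - v Y) * exp (- (sum c T + c j - sum c Y) / D)"
  proof (cases "0 \<le> d")
    case True
    have "v Q - v (insert j T) = d - ?m" by (simp add: d_def marginal_def)
    also have "\<dots> \<le> d * (1 + - c j / D)" using \<open>d * c j \<le> ?m * D\<close> D0 by (simp add: field_simps)
    also have "\<dots> \<le> d * exp (- c j / D)" using True by (intro mult_left_mono exp_ge_add_one_self) auto
    also have "\<dots> \<le> (v Q - v Y) * exp (- (sum c T - sum c Y) / D) * exp (- c j / D)"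
      using Suc(7) by (intro mult_right_mono) (auto simp: d_def D_def)
    also have "\<dots> = (v Q - v Y) * exp (- (sum c T + c j - sum c Y) / D)"
      by (simp add: exp_add[symmetric] diff_divide_distrib add_divide_distrib algebra_simps)
    finally show ?thesis .
  next
    case False
    then have "v Q - v (insert j T) \<le> 0" using m0 by (simp add: d_def marginal_def)
    also have "0 \<le> (v Q - v Y) * exp (- (sum c T + c j - sum c Y) / D)" using E0 by simp
    finally show ?thesis .
  qed
  show ?case
  proof (cases "fits c B T j \<or> j \<notin> Q")
    case True
    have "v Q - v T' \<le> (v Q - v Y) * exp (- (sum c T' - sum c Y) / (B - sum c Y))"
      using key Suc(7) jT ok by (simp add: T'_def D_def add.commute)
    then have "v Q - v (filled c B T' (R - {j})) \<le> (v Q - v Y) * exp (- 1) + w"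
      using Suc(4,5) True j by (intro Suc(1)[OF card ok'] feas) (auto simp: T'_def)
    then show ?thesis by (simp add: step)
  next
    case False
    then have "D < sum c T + c j - sum c Y" by (simp add: fits_def D_def)
    then have "1 \<le> (sum c T + c j - sum c Y) / D" using D0 by simp
    then have "exp (- (sum c T + c j - sum c Y) / D) \<le> exp (- 1)"
      by (subst exp_le_cancel_iff) (simp only: minus_divide_left[symmetric] neg_le_iff_le)
    then have "v Q - v (insert j T) \<le> (v Q - v Y) * exp (- 1)"
      using key E0 by (meson mult_left_mono order_trans)
    moreover have "?m \<le> w" using False jT Suc(4) ok by (intro w(1)) auto
    moreover have "v T \<le> v (filled c B T R)"
      using filled_subset[OF Suc(3)] by (intro value_mono)
    ultimately show ?thesis by (simp add: marginal_def)
  qed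
qed

text \<open>One run is enough: the one from three items of an optimal set that are chosen greedily
  by marginal value, or the optimal set itself if it has at most two items.\<close>

lemma sviridenko_ge_opt:
  assumes "0 \<le> B" "cost_vector_on A c"
  shows "(1 - exp (- 1)) * opt v B A c \<le> sviridenko v B A c"
proof -
  obtain Q where Q: "Q \<subseteq> A" "sum c Q \<le> B" "opt v B A c = v Q" using opt_attained assms(1) .
  have fin: "finite Q" using Q(1) by (rule finite_sub)
  have Q0: "0 \<le> v Q" using Q(1) by (rule value_nonneg)
  have less: "(1 - exp (- 1)) * v Q \<le> v Q" using Q0 by (simp add: mult_left_le_one_le)
  show ?thesis
  proof (cases "card Q \<le> 2")
    case True
    then have "v Q \<le> sviridenko v B A c" unfolding sviridenko_ge_iff[OF assms(1)] using Q by blast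
    then show ?thesis using less Q by simp
  next
    case False
    have "Q \<noteq> {}" using False by auto
    then obtain a where a: "a \<in> Q" "\<And>y. y \<in> Q \<Longrightarrow> marginal v y {} \<le> marginal v a {}"
      using ex_maximizer[OF fin, where f = "\<lambda>y. marginal v y {}"] by metis
    have "Q - {a} \<noteq> {}" using False a fin card_mono[of "{a}" Q] by auto
    then obtain b where b: "b \<in> Q - {a}" "\<And>y. y \<in> Q - {a} \<Longrightarrow> marginal v y {a} \<le> marginal v b {a}"
      using ex_maximizer[of "Q - {a}" "\<lambda>y. marginal v y {a}"] fin by (metis finite_Diff)
    have "Q - {a, b} \<noteq> {}" using False card_mono[of "{a, b}" Q] card_insert_le_m1[of 2 "{b}" a] by auto
    then obtain d where d: "d \<in> Q - {a, b}"
        "\<And>y. y \<in> Q - {a, b} \<Longrightarrow> marginal v y {a, b} \<le> marginal v d {a, b}"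
      using ex_maximizer[of "Q - {a, b}" "\<lambda>y. marginal v y {a, b}"] fin by (metis finite_Diff)
    define Y where "Y = {a, b, d}"
    have Y: "Y \<subseteq> Q" "card Y = 3" using a b d by (auto simp: Y_def)
    have YA: "Y \<subseteq> A" using Y Q by auto
    have "marginal v a {} + marginal v b {a} + marginal v d {a, b} = v Y - v {}"
      by (simp add: marginal_def Y_def insert_commute)
    then have vY: "marginal v a {} + marginal v b {a} + marginal v d {a, b} \<le> v Y"
      using value_nonneg[of "{}"] by simp
    \<comment> \<open>By the greedy choice each of the three increments is at least the marginal
      value of \<open>x\<close>, and together they are at most \<open>v Y\<close>.\<close>
    have w: "marginal v x T \<le> v Y / 3" if x: "x \<in> Q - Y" "Y \<subseteq> T" "T \<subseteq> A" for x T
    proof -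
      have "x \<in> A" "a \<in> T" "b \<in> T" using x Q by (auto simp: Y_def)
      then have "marginal v x T \<le> marginal v x {}" "marginal v x T \<le> marginal v x {a}"
        "marginal v x T \<le> marginal v x {a, b}"
        using x(3) by (simp_all add: marginal_antimono)
      then show ?thesis using a(2)[of x] b(2)[of x] d(2)[of x] x vY by (simp add: Y_def)
    qed
    have c0: "0 \<le> c x" if "x \<in> A" for x using assms(2) that by (simp add: cost_vector_on_def)
    have cY: "sum c Y \<le> sum c Q" using Y fin Q c0 by (intro sum_mono2) auto
    have ok: "state_ok (Y, A - Y)" using YA by (intro state_ok_split) auto
    let ?F = "filled c B Y (A - Y)"
    have "(1 - exp (- 1)) * v Q \<le> v ?F"
    proof (cases "sum c Y < B")
      case True
      have "v Q - v ?F \<le> (v Q - v Y) * exp (- 1) + v Y / 3"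
        using Y Q YA True w value_nonneg[OF YA] assms(2) ok
        by (intro filled_value[where w = "v Y / 3"]) auto
      \<comment> \<open>Because \<open>e \<le> 3\<close>, the loss of one item,
        \<open>v Y / 3\<close>, is covered by the term \<open>v Y / e\<close> that \<open>Y\<close>
        contributes.\<close>
      moreover have "v Y * (1/3) \<le> v Y * exp (- 1)"
        using value_nonneg[OF YA] exp_le by (intro mult_left_mono) (auto simp: exp_minus field_simps)
      ultimately show ?thesis by (simp add: algebra_simps)
    next
      case False
      have "c x = 0" if x: "x \<in> Q \<inter> (A - Y)" for x
      proof -
        have "sum c (insert x Y) \<le> sum c Q" using Y fin Q c0 x by (intro sum_mono2) auto
        then show ?thesis using x Y(1) finite_subset[OF Y(1) fin] False Q c0[of x] by simp
      qed
      then have "Q \<subseteq> ?F" using ok Q cY YA by (intro filled_zero_cost) auto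
      then have "v Q \<le> v ?F" using filled_subset(3)[OF ok] by (rule value_mono)
      then show ?thesis using less by linarith
    qed
    moreover have "v ?F \<le> sviridenko v B A c"
      unfolding sviridenko_ge_iff[OF assms(1)] using YA Y cY Q by (intro disjI2 exI[of _ Y]) auto
    ultimately show ?thesis using Q by simp
  qed
qed

lemma approx_oracle_sviridenko:
  assumes "0 \<le> B"
  shows "approx_oracle (exp 1 / (exp 1 - 1)) A v B (sviridenko v B)"
  unfolding approx_oracle_def
proof (intro allI impI, elim conjE)
  fix A' :: "'a set" and c :: "'a \<Rightarrow> real" assume A': "A' \<subseteq> A" and "cost_vector_on A c"
  then have c: "cost_vector_on A' c" by (auto simp: cost_vector_on_def)
  interpret V: valued A' v using A' by (rule valued_subset)
  define e where "e = (exp 1 :: real)"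
  have e: "1 < e" "1 - exp (- 1) = (e - 1) / e" by (simp_all add: e_def exp_minus field_simps)
  have "opt v B A' c * (e - 1) \<le> e * sviridenko v B A' c"
    using V.sviridenko_ge_opt[OF assms c] e(1) unfolding e(2) by (simp add: field_simps)
  then have "opt v B A' c \<le> exp 1 / (exp 1 - 1) * sviridenko v B A' c"
    using e(1) by (simp add: e_def[symmetric] pos_le_divide_eq)
  then show "sviridenko v B A' c \<le> opt v B A' c \<and>
      opt v B A' c \<le> exp 1 / (exp 1 - 1) * sviridenko v B A' c"
    using V.sviridenko_le_opt[OF assms] by blast
qed

end

section \<open>The bids at which the estimate reaches a given value\<close>

context valued
begin

definition vstate :: "('a \<Rightarrow> real) \<Rightarrow> real \<Rightarrow> 'a set \<Rightarrow> 'a set \<Rightarrow> nat \<Rightarrow> 'a set \<times> 'a set" where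
  "vstate c V T R t = (gstep c (\<lambda>T j. v (insert j T) < V) ^^ t) (T, R)"

text \<open>At most one number, kept in a set so that its absence needs no special value: what
  remains of the budget, possibly negative, after buying the item that reaches
  \<open>V\<close>.\<close>

definition slack_at :: "('a \<Rightarrow> real) \<Rightarrow> real \<Rightarrow> real \<Rightarrow> 'a set \<times> 'a set \<Rightarrow> real set" where
  "slack_at c B V = (\<lambda>(T, R). {h. R \<noteq> {} \<and> V \<le> v (insert (best_item v c T R) T) \<and>
     h = B - sum c T - c (best_item v c T R)})"

definition slack :: "('a \<Rightarrow> real) \<Rightarrow> real \<Rightarrow> real \<Rightarrow> nat \<Rightarrow> 'a set \<Rightarrow> 'a set \<Rightarrow> real set" where
  "slack c B V N T R =
     {h. V \<le> v T \<and> h = B - sum c T} \<union> (\<Union>t<N. slack_at c B V (vstate c V T R t))"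

text \<open>Later purchases cost less than \<open>c j\<close> in total, at ratios no better than
  that of \<open>j\<close>; so together they gain at most what \<open>j\<close> alone would have
  gained.\<close>

lemma filled_le_insert:
  assumes ok: "state_ok (T, R)" and c: "\<And>x. x \<in> R \<Longrightarrow> 0 \<le> c x" and feas: "sum c T \<le> B" and "R \<noteq> {}"
  defines "j \<equiv> best_item v c T R"
  assumes rej: "\<not> fits c B T j"
  shows "v (filled c B T (R - {j})) \<le> v (insert j T)"
proof -
  let ?F = "filled c B T (R - {j})"
  have TR: "T \<subseteq> A" "R \<subseteq> A" "finite T" "finite R" using state_okD[OF ok] by auto
  have j: "j \<in> R" using best_item_in TR(4) assms(4) by (simp add: j_def)
  then have jA: "j \<in> A" using TR by auto
  have ok': "state_ok (T, R - {j})" using ok by (auto simp: state_ok_def)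
  have F: "T \<subseteq> ?F" "?F \<subseteq> T \<union> (R - {j})" "?F \<subseteq> A" "sum c ?F \<le> B"
    using filled_subset[OF ok'] filled_feasible[OF ok' feas] by auto
  have D: "?F - T \<subseteq> R" using F(2) by auto
  let ?m = "marginal v j T"
  have m0: "0 \<le> ?m" using marginal_nonneg TR jA by simp
  have cross: "marginal v x T * c j \<le> ?m * c x" if "x \<in> ?F - T" for x
    using best_item_max[OF TR(4) assms(4), of x c T] that D TR jA c j
    by (intro ratio_le_cross) (auto simp: j_def)
  have cF: "sum c (?F - T) = sum c ?F - sum c T" using finite_sub[OF F(3)] F(1) by (simp add: sum_diff)
  have cj: "B - sum c T < c j" using rej by (simp add: fits_def)
  then have cj0: "0 < c j" using feas by simp
  have "(\<Sum>x\<in>?F - T. marginal v x T) * c j = (\<Sum>x\<in>?F - T. marginal v x T * c j)"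
    by (simp add: sum_distrib_right)
  also have "\<dots> \<le> (\<Sum>x\<in>?F - T. ?m * c x)" by (intro sum_mono cross)
  also have "\<dots> = ?m * sum c (?F - T)" by (simp add: sum_distrib_left)
  also have "\<dots> \<le> ?m * c j" using m0 cF F(4) cj by (intro mult_left_mono) auto
  finally have "(\<Sum>x\<in>?F - T. marginal v x T) \<le> ?m" using cj0 by simp
  moreover have "v (T \<union> ?F) \<le> v T + (\<Sum>x\<in>?F - T. marginal v x T)"
    using TR F by (intro value_union_le)
  moreover have "T \<union> ?F = ?F" using F by auto
  ultimately show ?thesis by (simp add: marginal_def)
qed

text \<open>The run that accepts exactly the items keeping the value below \<open>V\<close> does not depend on the
  budget. It agrees with the filling run until the latter reaches \<open>V\<close>: if the filling run rejects \<open>j\<close>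
  although \<open>insert j T\<close> is worth less than \<open>V\<close>, it never reaches \<open>V\<close>.\<close>

lemma filled_ge_iff:
  assumes "state_ok (T, R)" "\<And>x. x \<in> T \<union> R \<Longrightarrow> 0 \<le> c x" "sum c T \<le> B" "card R \<le> N"
  shows "V \<le> v (filled c B T R) \<longleftrightarrow> (\<exists>h\<in>slack c B V N T R. 0 \<le> h)"
  using assms
proof (induction N arbitrary: T R)
  case 0
  then have "R = {}" using state_okD(4)[OF 0(1)] by simp
  then show ?case using 0 by (auto simp: slack_def filled_empty)
next
  case (Suc N)
  show ?case
  proof (cases "R = {}")
    case True
    then have "vstate c V T R t = (T, {})" for t by (simp add: vstate_def funpow_gstep_empty)
    then show ?thesis using Suc True by (auto simp: slack_def slack_at_def filled_empty)
  next
    case False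
    define j where "j = best_item v c T R"
    have TR: "T \<subseteq> A" "R \<subseteq> A" "finite T" "finite R" "T \<inter> R = {}"
      using state_okD[OF Suc(2)] Suc(2) by (auto simp: state_ok_def)
    have "j \<in> R" unfolding j_def by (rule best_item_in[OF TR(4) False])
    then have j: "j \<in> R" "j \<notin> T" "j \<in> A" using TR by auto
    have cj: "sum c (insert j T) = sum c T + c j" using TR j by simp
    have vT: "v T \<le> v (insert j T)" using TR j by (intro value_mono) auto
    define T' where "T' = (if v (insert j T) < V then insert j T else T)"
    have ok': "state_ok (T', R - {j})" and okf: "state_ok (insert j T, R - {j})" "state_ok (T, R - {j})"
      using TR j by (auto simp: T'_def state_ok_def)
    have card: "card (R - {j}) \<le> N" using Suc(5) TR j by simp
    have vs: "vstate c V T R (Suc t) = vstate c V T' (R - {j}) t" for t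
      using False by (simp add: vstate_def funpow_Suc_right gstep_def j_def T'_def Let_def del: funpow.simps)
    have split: "(\<Union>t<Suc N. slack_at c B V (vstate c V T R t)) =
        slack_at c B V (T, R) \<union> (\<Union>t<N. slack_at c B V (vstate c V T' (R - {j}) t))"
      unfolding vs[symmetric] lessThan_Suc_eq_insert_0 by (simp add: vstate_def image_image)
    have tail: "(\<exists>h\<in>slack c B V (Suc N) T R. 0 \<le> h) \<longleftrightarrow> V \<le> v T \<or> (V \<le> v (insert j T) \<and> fits c B T j) \<or>
        (\<exists>t<N. \<exists>h\<in>slack_at c B V (vstate c V T' (R - {j}) t). 0 \<le> h)"
    proof -
      have "(\<exists>h\<in>slack_at c B V (T, R). 0 \<le> h) \<longleftrightarrow> V \<le> v (insert j T) \<and> fits c B T j"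
        using False by (auto simp: slack_at_def j_def fits_def)
      moreover have "(\<exists>h\<in>{h. V \<le> v T \<and> h = B - sum c T}. 0 \<le> h) \<longleftrightarrow> V \<le> v T"
        using Suc(4) by auto
      ultimately show ?thesis unfolding slack_def split by blast
    qed
    have nonneg: "\<And>x. x \<in> T' \<union> (R - {j}) \<Longrightarrow> 0 \<le> c x" using Suc(3) j by (auto simp: T'_def split: if_splits)
    have step: "filled c B T R = filled c B (if fits c B T j then insert j T else T) (R - {j})"
      using filled_step[OF Suc(2) False, of c B] by (simp only: j_def)
    show ?thesis
    proof (cases "fits c B T j")
      case True
      show ?thesis
      proof (cases "v (insert j T) < V")
        case True': True
        have "V \<le> v (filled c B T' (R - {j})) \<longleftrightarrow> (\<exists>h\<in>slack c B V N T' (R - {j}). 0 \<le> h)"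
          using True True' cj by (intro Suc.IH[OF ok' nonneg _ card]) (auto simp: T'_def fits_def)
        then show ?thesis using True True' vT unfolding tail step by (auto simp: T'_def slack_def)
      next
        case False
        have "v (insert j T) \<le> v (filled c B (insert j T) (R - {j}))"
          using filled_subset[OF okf(1)] by (intro value_mono) auto
        then show ?thesis using True False unfolding tail step by simp
      qed
    next
      case rej: False
      show ?thesis
      proof (cases "v (insert j T) < V")
        case True
        have "v (filled c B T (R - {j})) \<le> v (insert j T)"
          unfolding j_def using Suc.prems False rej
          by (intro filled_le_insert) (auto simp: j_def)
        \<comment> \<open>The run for \<open>V\<close> goes on with \<open>j\<close>, which the
          budget does not allow, so every later set is too expensive.\<close>
        moreover have "h < 0" if h: "h \<in> slack_at c B V (vstate c V T' (R - {j}) t)" for h t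
        proof -
          define s where "s = vstate c V T' (R - {j}) t"
          have ok: "state_ok s" and sub: "insert j T \<subseteq> fst s"
            and un: "fst s \<union> snd s \<subseteq> T' \<union> (R - {j})"
            using state_ok_run[OF ok'] run_fst_mono[OF ok'] run_un[OF ok'] True
            unfolding s_def vstate_def by (fastforce simp: T'_def)+
          let ?b = "best_item v c (fst s) (snd s)"
          have h': "snd s \<noteq> {}" "h = B - sum c (fst s) - c ?b"
            using h by (auto simp: s_def slack_at_def case_prod_beta)
          have "?b \<in> snd s" using best_item_in[OF state_okD(4)[OF ok] h'(1)] .
          then have "0 \<le> c ?b" using un nonneg by blast
          moreover have "sum c (insert j T) \<le> sum c (fst s)"
            using sub un nonneg state_okD(3)[OF ok] by (intro sum_mono2) auto
          ultimately show ?thesis using h'(2) rej cj by (simp add: fits_def)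
        qed
        ultimately show ?thesis using True rej vT unfolding tail step by force
      next
        \<comment> \<open>Here both runs leave \<open>j\<close> out, and the slack of
          \<open>insert j T\<close> is negative.\<close>
        case False
        have "V \<le> v (filled c B T' (R - {j})) \<longleftrightarrow> (\<exists>h\<in>slack c B V N T' (R - {j}). 0 \<le> h)"
          using False Suc(4) by (intro Suc.IH[OF ok' nonneg _ card]) (auto simp: T'_def)
        then show ?thesis using False rej Suc(4) unfolding tail step by (auto simp: T'_def slack_def)
      qed
    qed
  qed
qed

text \<open>Neither \<open>vstate\<close> nor the condition on \<open>V\<close> mentions the budget,
  so giving away \<open>x\<close> of it lowers all slacks by \<open>x\<close>. This turns a slack
  into the largest bid that can be afforded.\<close>

lemma slack_shift:
  "(\<exists>h\<in>slack c (B - x) V N T R. 0 \<le> h) \<longleftrightarrow> (\<exists>h\<in>slack c B V N T R. x \<le> h)"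
proof -
  have at: "(\<exists>h\<in>slack_at c (B - x) V s. 0 \<le> h) \<longleftrightarrow> (\<exists>h\<in>slack_at c B V s. x \<le> h)" for s
    by (cases s) (auto simp: slack_at_def)
  have "(\<exists>h\<in>slack c B V N T R. y \<le> h) \<longleftrightarrow> V \<le> v T \<and> y \<le> B - sum c T \<or>
      (\<exists>t<N. \<exists>h\<in>slack_at c B V (vstate c V T R t). y \<le> h)" for B y
    unfolding slack_def by blast
  then show ?thesis using at by (simp add: algebra_simps)
qed

lemma slack_le:
  assumes "state_ok (T, R)" "\<And>x. x \<in> T \<union> R \<Longrightarrow> 0 \<le> c x" "h \<in> slack c B V N T R"
  shows "h \<le> B - sum c T"
proof (cases "V \<le> v T \<and> h = B - sum c T")
  case False
  then obtain t where h: "h \<in> slack_at c B V (vstate c V T R t)" using assms(3) by (auto simp: slack_def)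
  define s where "s = vstate c V T R t"
  have ok: "state_ok s" and sub: "T \<subseteq> fst s" and un: "fst s \<union> snd s \<subseteq> T \<union> R"
    using state_ok_run[OF assms(1)] run_fst_mono[OF assms(1)] run_un[OF assms(1)]
    unfolding s_def vstate_def by fastforce+
  let ?b = "best_item v c (fst s) (snd s)"
  have h': "snd s \<noteq> {}" "h = B - sum c (fst s) - c ?b"
    using h by (auto simp: s_def slack_at_def case_prod_beta)
  have "?b \<in> snd s" using best_item_in[OF state_okD(4)[OF ok] h'(1)] .
  then have "0 \<le> c ?b" using un assms(2) by blast
  moreover have "sum c T \<le> sum c (fst s)"
    using sub un assms(2) state_okD(3)[OF ok] by (intro sum_mono2) auto
  ultimately show ?thesis using h'(2) by simp
qed auto

text \<open>If \<open>i\<close> has been taken, its bid only reduces the budget for the others.\<close>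

lemma filled_bid_ge_iff:
  assumes ok: "state_ok (T, R)" and i: "i \<in> T" and c: "\<And>x. x \<in> T \<union> R \<Longrightarrow> 0 \<le> c x"
    and "c i = 0" "0 \<le> x" "card R \<le> N"
  shows "sum (c(i := x)) T \<le> B \<and> V \<le> v (filled (c(i := x)) B T R) \<longleftrightarrow>
    (\<exists>h\<in>slack c B V N T R. x \<le> h)"
proof -
  have sum: "sum (c(i := x)) T' = x + sum c T'" if "T \<subseteq> T'" "T' \<subseteq> A" for T'
  proof -
    have "finite T'" "i \<in> T'" using finite_sub that i by auto
    moreover have "sum (c(i := x)) (T' - {i}) = sum c (T' - {i})" by (intro sum.cong) auto
    ultimately show ?thesis using \<open>c i = 0\<close> by (simp add: sum.remove[of T' i] del: fun_upd_apply) simp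
  qed
  have TR: "T \<subseteq> A" "R \<subseteq> A" "i \<notin> R" using state_okD[OF ok] i by auto
  have "fits (c(i := x)) B T' j = fits c (B - x) T' j" if "j \<noteq> i" "T \<subseteq> T'" "T' \<subseteq> T \<union> R" for T' j
  proof -
    have "T' \<subseteq> A" using that TR by auto
    then show ?thesis unfolding fits_def using sum[of T'] that by (simp del: fun_upd_apply) auto
  qed
  then have eq: "filled (c(i := x)) B T R = filled c (B - x) T R"
    unfolding filled_def using TR
    by (subst run_upd[OF ok, where acc = "fits c (B - x)"]) simp_all
  have feas: "sum (c(i := x)) T \<le> B \<longleftrightarrow> sum c T \<le> B - x" using sum[of T] TR by auto
  show ?thesis
  proof (cases "sum c T \<le> B - x")
    case True
    have "V \<le> v (filled c (B - x) T R) \<longleftrightarrow> (\<exists>h\<in>slack c (B - x) V N T R. 0 \<le> h)"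
      by (rule filled_ge_iff[OF ok c True assms(6)])
    then show ?thesis unfolding eq feas slack_shift using True by blast
  next
    case False
    then have "\<not> (\<exists>h\<in>slack c (B - x) V N T R. 0 \<le> h)" using slack_le[OF ok c] by fastforce
    then show ?thesis unfolding feas slack_shift using False by blast
  qed
qed

text \<open>Sets of one or two sellers get no candidates, so they count as runs that end at once and
  need no treatment of their own.\<close>

definition rest :: "'a \<Rightarrow> 'a set \<Rightarrow> 'a set" where
  "rest i U = (if card U = 3 then A - {i} - U else {})"

definition fill_state :: "('a \<Rightarrow> real) \<Rightarrow> real \<Rightarrow> 'a \<Rightarrow> 'a set \<Rightarrow> nat \<Rightarrow> 'a set \<times> 'a set" where
  "fill_state c B i U t = (gstep c (fits c B) ^^ t) (U, rest i U)"

text \<open>The bids of \<open>i\<close> between \<open>lo\<close> and \<open>B\<close> at which the candidate from the set \<open>U\<close> is worth at least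
  \<open>V\<close> and contains \<open>i\<close>; \<open>B + 1\<close> stands for all bids above the budget. The cost of \<open>i\<close> in \<open>c\<close> is 0.\<close>

definition bids ::
    "('a \<Rightarrow> real) \<Rightarrow> real \<Rightarrow> nat \<Rightarrow> 'a \<Rightarrow> real \<Rightarrow> real \<Rightarrow> 'a set \<Rightarrow> real set" where
  "bids c B N i lo V U =
     (if B < sum c U then {}
      else if i \<in> U then {x. lo \<le> x \<and> (\<exists>h\<in>slack c B V N U (rest i U). x \<le> h)}
      else (if card U = 3 then {x. lo \<le> x \<and>
              (\<exists>t<N. (\<forall>s<t. \<not> beats c i x (fill_state c B i U s)) \<and> beats c i x (fill_state c B i U t) \<and>
                (\<exists>h\<in>slack c B V N (insert i (fst (fill_state c B i U t))) (snd (fill_state c B i U t)). x \<le> h))}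
            else {}) \<union>
           {x. x = B + 1 \<and> V \<le> v (fst (fill_state c B i U N))})"

text \<open>Up to the state \<open>t\<close> the seller \<open>i\<close> waits. If it is then
  rejected, it is neither taken nor a candidate, and the run continues as that of the rivals alone.
  Hence all rejected bids lead to the same candidate, and one bid, \<open>B + 1\<close>, can stand
  for them.\<close>

lemma filled_insert:
  fixes B :: real
  assumes ok: "state_ok (U, R)" and i: "i \<in> A" "i \<notin> U" "i \<notin> R" "c i = 0"
  defines "W \<equiv> \<lambda>t. (gstep c (fits c B) ^^ t) (U, R)"
  assumes t: "\<And>s. s < t \<Longrightarrow> \<not> beats c i x (W s)" "beats c i x (W t)"
  shows "t \<le> card R" "filled (c(i := x)) B U (insert i R) =
    (if sum c (fst (W t)) + x \<le> B then filled (c(i := x)) B (insert i (fst (W t))) (snd (W t))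
     else filled c B U R)"
proof -
  have okW: "state_ok (W s)" for s unfolding W_def by (rule state_ok_run[OF ok])
  have iW: "i \<notin> fst (W s)" "i \<notin> snd (W s)" for s
    using run_avoids[OF ok, of i] i by (simp_all add: W_def)
  have "snd (W (card R)) = {}" unfolding W_def by (rule run_finished[OF ok]) simp
  then have "beats c i x (W (card R))" by (metis beats_empty prod.collapse)
  then show tR: "t \<le> card R" using t(1) not_le by blast
  have accs: "fits (c(i := x)) B T j = fits c B T j" if "i \<notin> T" "j \<noteq> i" for T j
  proof -
    have "sum (c(i := x)) T = sum c T" using that by (intro sum.cong) auto
    then show ?thesis using that by (simp add: fits_def)
  qed
  have run: "(gstep (c(i := x)) (fits (c(i := x)) B) ^^ t) (U, insert i R) = (fst (W t), insert i (snd (W t)))"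
    using run_insert[OF ok, of i "fits (c(i := x)) B" "fits c B" t c x] i t(1) accs
    unfolding W_def by auto
  define s' where "s' = (if fits (c(i := x)) B (fst (W t)) i then insert i (fst (W t)) else fst (W t), snd (W t))"
  have step: "gstep (c(i := x)) (fits (c(i := x)) B) (fst (W t), insert i (snd (W t))) = s'"
    using t(2) iW by (simp add: gstep_def beats_def case_prod_beta s'_def Let_def)
  have fits: "fits (c(i := x)) B (fst (W t)) i \<longleftrightarrow> sum c (fst (W t)) + x \<le> B"
  proof -
    have "sum (c(i := x)) (fst (W t)) = sum c (fst (W t))" using iW(1)[of t] by (intro sum.cong) auto
    then show ?thesis by (simp add: fits_def)
  qed
  have fin: "finite R" using state_okD(4)[OF ok] by simp
  have "card (insert i R) = (card R - t) + Suc t" using fin i tR by simp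
  then have "filled (c(i := x)) B U (insert i R) =
      fst ((gstep (c(i := x)) (fits (c(i := x)) B) ^^ (card R - t)) s')"
    unfolding filled_def by (simp only: funpow_add o_apply funpow.simps run step)
  also have "card R - t = card (snd (W t))" unfolding W_def using run_card[OF ok] by simp
  finally have F: "filled (c(i := x)) B U (insert i R) =
      fst ((gstep (c(i := x)) (fits (c(i := x)) B) ^^ card (snd (W t))) s')" .
  show "filled (c(i := x)) B U (insert i R) =
    (if sum c (fst (W t)) + x \<le> B then filled (c(i := x)) B (insert i (fst (W t))) (snd (W t))
     else filled c B U R)"
  proof (cases "sum c (fst (W t)) + x \<le> B")
    case True
    then show ?thesis using F fits by (simp add: s'_def filled_def)
  next
    case False
    have "(gstep (c(i := x)) (fits (c(i := x)) B) ^^ card (snd (W t))) (W t) =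
        (gstep c (fits c B) ^^ card (snd (W t))) (W t)"
    proof (rule run_upd[OF okW iW(2)])
      fix T j assume "j \<noteq> i" "T \<subseteq> fst (W t) \<union> snd (W t)"
      then show "fits (c(i := x)) B T j = fits c B T j" using iW[of t] by (intro accs) auto
    qed
    also have "\<dots> = (gstep c (fits c B) ^^ card R) (U, R)"
      unfolding \<open>card R - t = card (snd (W t))\<close>[symmetric]
      using tR funpow_add[of "card R - t" t "gstep c (fits c B)"] by (simp add: W_def)
    finally show ?thesis using F fits False by (simp add: s'_def filled_def)
  qed
qed

lemma sum_upd_zero:
  assumes "c i = 0" "S \<subseteq> A"
  shows "sum (c(i := x)) S = sum c S + (if i \<in> S then x else 0)"
proof -
  have "finite S" using assms(2) by (rule finite_sub)
  moreover have "sum (c(i := x)) (S - {i}) = sum c (S - {i})" by (intro sum.cong) auto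
  moreover have "i \<notin> S \<Longrightarrow> sum (c(i := x)) S = sum c S" by (intro sum.cong) auto
  ultimately show ?thesis
    using assms(1) by (simp add: sum.remove[of S i] del: fun_upd_apply) (simp add: add.commute)
qed

text \<open>The mechanism only asks whether some bid of at least \<open>y\<close> reaches
  \<open>V\<close>. In this monotone form it does no harm that \<open>bids\<close> moves a candidate
  without \<open>i\<close> to the bid \<open>B + 1\<close>.\<close>

lemma sviridenko_bid_iff:
  assumes i: "i \<in> A" and c: "cost_vector_on A c" "c i = 0" and N: "card A \<le> N"
    and y: "0 \<le> lo" "lo \<le> y" "y \<le> B"
  shows "(\<exists>x\<ge>y. V \<le> sviridenko v B A (c(i := x))) \<longleftrightarrow>
    (\<exists>U\<subseteq>A. 1 \<le> card U \<and> card U \<le> 3 \<and> (\<exists>x\<in>bids c B N i lo V U. y \<le> x))"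
    (is "?L \<longleftrightarrow> ?R")
proof -
  have B0: "0 \<le> B" using y by linarith
  have c0: "0 \<le> c x" if "x \<in> A" for x using c that by (simp add: cost_vector_on_def)
  have cS0: "0 \<le> sum c S" if "S \<subseteq> A" for S using c0 that by (auto intro!: sum_nonneg)
  have rest: "rest i U \<subseteq> A" "U \<inter> rest i U = {}" "i \<notin> rest i U" for U by (auto simp: rest_def)
  have okU: "state_ok (U, rest i U)" if "U \<subseteq> A" for U using that rest by (intro state_ok_split) auto
  have okW: "state_ok (fill_state c B i U t)" if "U \<subseteq> A" for U t
    unfolding fill_state_def by (rule state_ok_run[OF okU[OF that]])
  have cardA: "0 < card A" using i finite_A card_gt_0_iff by blast
  have cardR: "card (rest i U) < N" for U
    using card_mono[OF finite_Diff[OF finite_A], of "rest i U" "{i}"] i cardA N finite_A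
    by (auto simp: rest_def)
  have iW: "i \<notin> fst (fill_state c B i U t)" "i \<notin> snd (fill_state c B i U t)" if "U \<subseteq> A" "i \<notin> U" for U t
    unfolding fill_state_def using run_avoids[OF okU[OF that(1)]] that rest by auto
  have small: "fill_state c B i U t = (U, {})" if "card U \<noteq> 3" for U t
    using that by (simp add: fill_state_def rest_def funpow_gstep_empty)
  have final: "fst (fill_state c B i U N) = filled c B U (rest i U)" if "U \<subseteq> A" for U
    unfolding fill_state_def
    by (rule filled_eq_run[OF okU[OF that] less_imp_le[OF cardR[of U]], symmetric])
  have okI: "state_ok (insert i (fst (fill_state c B i U t)), snd (fill_state c B i U t))"
    if "U \<subseteq> A" "i \<notin> U" for U t
    using okW[OF that(1), of t] iW[OF that, of t] i by (auto simp: state_ok_def)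
  have cardW: "card (snd (fill_state c B i U t)) \<le> N" if "U \<subseteq> A" for U t
    using run_card[OF okU[OF that], where c = c and acc = "fits c B" and k = t] cardR[of U]
    by (simp add: fill_state_def)
  have insW: "sum (c(i := x)) (insert i (fst (fill_state c B i U t))) \<le> B \<and>
      V \<le> v (filled (c(i := x)) B (insert i (fst (fill_state c B i U t))) (snd (fill_state c B i U t)))
      \<longleftrightarrow> (\<exists>h\<in>slack c B V N (insert i (fst (fill_state c B i U t))) (snd (fill_state c B i U t)). x \<le> h)"
    if "U \<subseteq> A" "i \<notin> U" "0 \<le> x" for U t x
    using state_okD[OF okW[OF that(1), of t]] i
    by (intro filled_bid_ge_iff okI that cardW c c0) auto
  have sumW: "sum (c(i := x)) (insert i (fst (fill_state c B i U t))) = sum c (fst (fill_state c B i U t)) + x"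
    if "U \<subseteq> A" "i \<notin> U" for U t x
    using sum_upd_zero[of c i "insert i (fst (fill_state c B i U t))" x] c i
      iW[OF that, of t] state_okD(1,3)[OF okW[OF that(1), of t]]
    by (simp del: fun_upd_apply)
  have inU: "sum (c(i := x)) U \<le> B \<and> V \<le> v (filled (c(i := x)) B U (rest i U))
      \<longleftrightarrow> (\<exists>h\<in>slack c B V N U (rest i U). x \<le> h)"
    if "U \<subseteq> A" "i \<in> U" "0 \<le> x" for U x
    using that cardR[of U] rest(1)[of U] by (intro filled_bid_ge_iff okU that c c0) auto
  have slackB: "\<exists>h\<in>slack c B V N T R. x \<le> h \<Longrightarrow> x + sum c T \<le> B" if "state_ok (T, R)" for T R x
    using slack_le[OF that, of c] c0 state_okD(1,2)[OF that] by fastforce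
  have bidsU: "x \<in> bids c B N i lo V U"
    if "U \<subseteq> A" "i \<in> U" "y \<le> x" "sum (c(i := x)) U \<le> B" "V \<le> v (filled (c(i := x)) B U (rest i U))" for U x
  proof -
    have "\<exists>h\<in>slack c B V N U (rest i U). x \<le> h" using inU[of U x] that y by auto
    then show ?thesis using slackB[OF okU[OF that(1)]] that y by (fastforce simp: bids_def)
  qed
  show ?thesis
  proof
    assume ?L
    then obtain x where x: "y \<le> x" "V \<le> sviridenko v B A (c(i := x))" by blast
    consider (empty) "V \<le> v {}"
      | (pair) S where "S \<subseteq> A" "S \<noteq> {}" "card S \<le> 2" "sum (c(i := x)) S \<le> B" "V \<le> v S"
      | (triple) U where "U \<subseteq> A" "card U = 3" "sum (c(i := x)) U \<le> B"
          "V \<le> v (filled (c(i := x)) B U (A - U))"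
      using x(2) unfolding sviridenko_ge_iff[OF B0] by blast
    then show ?R
    proof cases
      case empty
      \<comment> \<open>The empty candidate is not among the sets of one to three sellers;
        \<open>{i}\<close> at the bid \<open>B\<close> is affordable and worth at least as
        much.\<close>
      have "v {} \<le> v {i}" using i by (intro value_mono) auto
      then have "B \<in> bids c B N i lo V {i}"
        using empty y i c by (intro bidsU) (auto simp: rest_def filled_empty)
      then show ?thesis using i y by (intro exI[of _ "{i}"]) auto
    next
      case (pair S)
      have cS: "1 \<le> card S" using pair finite_sub[OF pair(1)] by (simp add: Suc_le_eq card_gt_0_iff)
      show ?thesis
      proof (cases "i \<in> S")
        case True
        then have "x \<in> bids c B N i lo V S"
          using pair x by (intro bidsU) (auto simp: rest_def filled_empty simp del: fun_upd_apply)
        then show ?thesis using pair cS x by (intro exI[of _ S]) auto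
      next
        case False
        \<comment> \<open>A candidate of one or two other sellers is the same for every bid.\<close>
        have "B + 1 \<in> bids c B N i lo V S"
          using pair sum_upd_zero[of c i S x] c False small[of S N] by (simp add: bids_def)
        then show ?thesis using pair cS y by (intro exI[of _ S] conjI bexI[of _ "B + 1"]) auto
      qed
    next
      case (triple U)
      have "\<exists>x\<in>bids c B N i lo V U. y \<le> x"
      proof (cases "i \<in> U")
        case True
        then have "A - U = rest i U" using triple by (auto simp: rest_def)
        then show ?thesis using triple True x bidsU[of U x] by auto
      next
        case False
        have ins: "A - U = insert i (rest i U)" using triple False i by (auto simp: rest_def)
        have cU: "sum c U \<le> B" using triple sum_upd_zero[of c i U x] c False by simp
        have "snd (fill_state c B i U (card (rest i U))) = {}"
          unfolding fill_state_def by (rule run_finished[OF okU[OF triple(1)]]) simp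
        then have "beats c i x (fill_state c B i U (card (rest i U)))"
          by (metis beats_empty prod.collapse)
        then obtain t where t: "beats c i x (fill_state c B i U t)"
            "\<And>s. s < t \<Longrightarrow> \<not> beats c i x (fill_state c B i U s)"
          using exists_least_iff[of "\<lambda>t. beats c i x (fill_state c B i U t)"] by blast
        note ins_eq = filled_insert[where c = c and i = i, OF okU[OF triple(1)] i False rest(3)[of U] c(2), where t = t and B = B and x = x,
            folded fill_state_def, OF t(2,1)]
        show ?thesis
        proof (cases "sum c (fst (fill_state c B i U t)) + x \<le> B")
          case True
          then have "\<exists>h\<in>slack c B V N (insert i (fst (fill_state c B i U t))) (snd (fill_state c B i U t)). x \<le> h"
            using insW[OF triple(1) False, of x t] sumW[OF triple(1) False, of x t] ins_eq(2) triple(4) x y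
            by (simp add: ins del: fun_upd_apply)
          moreover have "t < N" using ins_eq(1) cardR[of U] by simp
          ultimately have "\<exists>t<N. (\<forall>s<t. \<not> beats c i x (fill_state c B i U s)) \<and>
              beats c i x (fill_state c B i U t) \<and>
              (\<exists>h\<in>slack c B V N (insert i (fst (fill_state c B i U t))) (snd (fill_state c B i U t)). x \<le> h)"
            using t by blast
          then have "x \<in> bids c B N i lo V U"
            using triple(2) False cU x y by (simp add: bids_def)
          then show ?thesis using x by blast
        next
          case False': False
          \<comment> \<open>\<open>i\<close> is discarded, so the candidate is the one filled
            without it.\<close>
          then have "V \<le> v (fst (fill_state c B i U N))"
            using ins_eq(2) triple(4) final[OF triple(1)] by (simp add: ins del: fun_upd_apply)
          then have "B + 1 \<in> bids c B N i lo V U" using cU False by (simp add: bids_def)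
          then show ?thesis using y by (intro bexI[of _ "B + 1"]) auto
        qed
      qed
      then show ?thesis using triple by (intro exI[of _ U]) auto
    qed
  next
    assume ?R
    then obtain U x where U: "U \<subseteq> A" "card U \<le> 3" "x \<in> bids c B N i lo V U" "y \<le> x" by blast
    have cU: "sum c U \<le> B" using U(3) by (auto simp: bids_def split: if_splits)
    have x0: "0 \<le> x" using U y by simp
    show ?L
    proof (cases "i \<in> U")
      case True
      then have "sum (c(i := x)) U \<le> B \<and> V \<le> v (filled (c(i := x)) B U (rest i U))"
        using U cU inU[OF U(1) True x0] by (simp add: bids_def)
      moreover have "card U = 3 \<Longrightarrow> rest i U = A - U" using True by (auto simp: rest_def)
      moreover have "card U \<noteq> 3 \<Longrightarrow> rest i U = {}" by (simp add: rest_def)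
      ultimately have "V \<le> sviridenko v B A (c(i := x))"
        unfolding sviridenko_ge_iff[OF B0] using U(1,2)
        by (cases "card U = 3") (auto simp: filled_empty simp del: fun_upd_apply)
      then show ?thesis using U by blast
    next
      case False
      have sU: "sum (c(i := z)) U \<le> B" for z using cU sum_upd_zero[of c i U z] c U False by simp
      have ins: "card U = 3 \<Longrightarrow> A - U = insert i (rest i U)" using False i by (auto simp: rest_def)
      consider (big) "V \<le> v (fst (fill_state c B i U N))"
        | (ins) t where "card U = 3" "\<And>s. s < t \<Longrightarrow> \<not> beats c i x (fill_state c B i U s)"
          "beats c i x (fill_state c B i U t)"
          "\<exists>h\<in>slack c B V N (insert i (fst (fill_state c B i U t))) (snd (fill_state c B i U t)). x \<le> h"
        using U(3) False cU by (auto simp: bids_def split: if_splits)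
      then show ?thesis
      proof cases
        case big
        have "V \<le> sviridenko v B A (c(i := B + 1))"
        proof (cases "card U = 3")
          case True
          have "snd (fill_state c B i U (card (rest i U))) = {}"
            unfolding fill_state_def by (rule run_finished[OF okU[OF U(1)]]) simp
          then have "beats c i (B + 1) (fill_state c B i U (card (rest i U)))"
            by (metis beats_empty prod.collapse)
          then obtain t where t: "beats c i (B + 1) (fill_state c B i U t)"
              "\<And>s. s < t \<Longrightarrow> \<not> beats c i (B + 1) (fill_state c B i U s)"
            using exists_least_iff[of "\<lambda>t. beats c i (B + 1) (fill_state c B i U t)"] by blast
          note ins_eq = filled_insert[where c = c and i = i, OF okU[OF U(1)] i False rest(3)[of U] c(2), where t = t and B = B and x = "B + 1",
              folded fill_state_def, OF t(2,1)]
          \<comment> \<open>Costs are nonnegative, so the bid \<open>B + 1\<close> fits at no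
            state.\<close>
          have "filled (c(i := B + 1)) B U (A - U) = filled c B U (rest i U)"
            using ins_eq(2) cS0[OF state_okD(1)[OF okW[OF U(1), of t]]] ins[OF True] by simp
          then show ?thesis
            unfolding sviridenko_ge_iff[OF B0] using big final[OF U(1)] U(1) True sU
            by (intro disjI2 exI[of _ U]) auto
        next
          case f: False
          then show ?thesis
            unfolding sviridenko_ge_iff[OF B0] using big small[OF f] U sU
            by (intro disjI1 exI[of _ U]) auto
        qed
        then show ?thesis using y by (intro exI[of _ "B + 1"]) auto
      next
        case (ins t)
        note ins_eq = filled_insert[where c = c and i = i, OF okU[OF U(1)] i False rest(3)[of U] c(2), where t = t and B = B and x = x,
            folded fill_state_def, OF ins(2,3)]
        have "V \<le> v (filled (c(i := x)) B U (A - U))"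
          using insW[OF U(1) False x0, of t] ins(4) ins_eq(2) sumW[OF U(1) False, of x t]
          by (simp add: \<open>card U = 3 \<Longrightarrow> A - U = insert i (rest i U)\<close>[OF ins(1)] del: fun_upd_apply)
        then have "V \<le> sviridenko v B A (c(i := x))"
          unfolding sviridenko_ge_iff[OF B0] using U(1) ins(1) sU
          by (intro disjI2 exI[of _ U]) auto
        then show ?thesis using U by blast
      qed
    qed
  qed
qed

end

section \<open>Winners and payments with Sviridenko's algorithm\<close>

text \<open>The number \<open>x\<close> represents the set \<open>E\<close> of nonnegative bids: it is the supremum, or negative if
  \<open>E\<close> is empty.\<close>

definition rep :: "real \<Rightarrow> real set \<Rightarrow> bool" where
  "rep x E \<longleftrightarrow> (0 \<le> x \<longleftrightarrow> E \<noteq> {}) \<and> (\<forall>y\<ge>0. y < x \<longleftrightarrow> (\<exists>e\<in>E. y < e))"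

lemma rep_empty: "rep (- 1) {}"
  by (auto simp: rep_def)

lemma rep_Un: "rep x E \<Longrightarrow> rep y F \<Longrightarrow> rep (max x y) (E \<union> F)"
  unfolding rep_def by (auto simp: less_max_iff_disj le_max_iff_disj)

lemma rep_greatest: "x \<in> E \<Longrightarrow> 0 \<le> x \<Longrightarrow> (\<And>e. e \<in> E \<Longrightarrow> e \<le> x) \<Longrightarrow> rep x E"
  unfolding rep_def by force

lemma rep_sup:
  assumes "E \<noteq> {}" "0 \<le> x" "\<And>e. e \<in> E \<Longrightarrow> e \<le> x" "\<And>y. 0 \<le> y \<Longrightarrow> y < x \<Longrightarrow> \<exists>e\<in>E. y < e"
  shows "rep x E"
  using assms unfolding rep_def by (meson le_less_trans less_le_trans not_le)

text \<open>An upper bound that is included in the interval if \<open>u\<close> holds.\<close>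

definition below :: "real \<Rightarrow> real \<Rightarrow> bool \<Rightarrow> bool" where
  "below x z u \<longleftrightarrow> x < z \<or> x = z \<and> u"

text \<open>If the set is nonempty, its supremum is the smaller one of \<open>h\<close> and
  \<open>z\<close>; the flags of the ends decide only about emptiness. The four cases are the
  branches of the program \<open>CONTRIB\<close>.\<close>

lemma rep_interval:
  fixes h l z :: real and lu u :: bool
  assumes "0 \<le> l"
  defines "E \<equiv> {x. \<not> below x l lu \<and> below x z u \<and> x \<le> h}"
  shows "h < z \<Longrightarrow> l < h \<or> l = h \<and> \<not> lu \<Longrightarrow> rep h E"
    and "h < z \<Longrightarrow> \<not> (l < h \<or> l = h \<and> \<not> lu) \<Longrightarrow> E = {}"
    and "z \<le> h \<Longrightarrow> l < z \<or> l = z \<and> \<not> lu \<and> u \<Longrightarrow> rep z E"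
    and "z \<le> h \<Longrightarrow> \<not> (l < z \<or> l = z \<and> \<not> lu \<and> u) \<Longrightarrow> E = {}"
proof -
  show "rep h E" if "h < z" "l < h \<or> l = h \<and> \<not> lu"
    using that assms(1) by (intro rep_greatest) (auto simp: E_def below_def)
  show "E = {}" if "h < z" "\<not> (l < h \<or> l = h \<and> \<not> lu)"
    using that by (auto simp: E_def below_def)
  show "E = {}" if "z \<le> h" "\<not> (l < z \<or> l = z \<and> \<not> lu \<and> u)"
    using that by (auto simp: E_def below_def)
  show "rep z E" if z: "z \<le> h" "l < z \<or> l = z \<and> \<not> lu \<and> u"
  proof (cases "l < z")
    case True
    have between: "\<exists>e\<in>E. y < e" if "y < z" for y
    proof -
      have "max y l < z" using that True by simp
      then obtain e where "max y l < e" "e < z" using dense by blast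
      then show ?thesis using z by (intro bexI[of _ e]) (auto simp: E_def below_def)
    qed
    show ?thesis
    proof (rule rep_sup)
      show "E \<noteq> {}" using between[OF True] by blast
    qed (use between True assms(1) in \<open>auto simp: E_def below_def\<close>)
  next
    case False
    then show ?thesis using z assms(1) by (intro rep_greatest) (auto simp: E_def below_def)
  qed
qed

text \<open>Only bids up to some member of \<open>E\<close> are asked for, so the supremum
  \<open>m\<close> can replace \<open>E\<close> as one more upper bound besides \<open>B\<close> and
  \<open>z\<close>. All members of \<open>E\<close> are at least \<open>lo\<close>, which makes
  \<open>lo\<close> a witness of nonemptiness.\<close>

lemma rep_min:
  assumes "rep m E" "0 \<le> lo" "below lo z u" "0 \<le> m" "lo \<le> B" and E: "\<And>x. x \<in> E \<Longrightarrow> lo \<le> x"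
  shows "rep (min B (min z m)) {b. lo \<le> b \<and> b \<le> B \<and> below b z u \<and> (\<exists>x\<in>E. b \<le> x)}"
    (is "rep ?m ?D")
proof -
  obtain x where x: "x \<in> E" using assms(1,4) by (auto simp: rep_def)
  have lo: "lo \<in> ?D" using assms x by auto
  have up: "e \<le> m" if "e \<in> E" "0 \<le> e" for e
  proof (rule ccontr)
    assume "\<not> e \<le> m"
    then have "m < m" using assms(1,4) that unfolding rep_def by (metis not_le)
    then show False by simp
  qed
  show ?thesis
  proof (rule rep_sup)
    show "?D \<noteq> {}" using lo by blast
    show "b \<le> ?m" if b: "b \<in> ?D" for b
    proof -
      obtain x where "x \<in> E" "b \<le> x" using b by blast
      then have "b \<le> m" using up[of x] b assms(2) by simp
      then show ?thesis using b by (auto simp: below_def)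
    qed
    show "0 \<le> ?m" using assms by (auto simp: below_def)
    show "\<exists>b\<in>?D. y < b" if y: "0 \<le> y" "y < ?m" for y
    proof (cases "y < lo")
      case True
      then show ?thesis using lo by blast
    next
      case False
      obtain b where b: "y < b" "b < ?m" using y(2) dense by blast
      then have "b < m" "0 \<le> b" using y by auto
      then obtain x where "x \<in> E" "b \<le> x" using assms(1) less_imp_le unfolding rep_def by metis
      then show ?thesis using b False y by (intro bexI[of _ b]) (auto simp: below_def)
    qed
  qed
qed

text \<open>Of two lower bounds the larger one survives; at equal value the one that includes its
  endpoint counts as larger.\<close>

lemma below_lower_update:
  "(\<not> below x l lu \<and> \<not> below x z u) \<longleftrightarrow>
    \<not> below x (if l < z \<or> l = z \<and> u then z else l) (if l < z \<or> l = z \<and> u then u else lu)"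
  by (auto simp: below_def)

context valued
begin

text \<open>The triple \<open>(p, q, d)\<close> stands for \<open>p * q / d\<close>.\<close>

definition critical :: "('a \<Rightarrow> real) \<Rightarrow> real \<Rightarrow> 'a \<Rightarrow> 'a set \<times> 'a set \<Rightarrow> real \<times> real \<times> real" where
  "critical c B i = (\<lambda>(T, R). if R = {} then (B + 1, 1, 1) else
     let j = best_item v c T R; mi = marginal v i T; mj = marginal v j T in
     if mj \<le> 0 then (if 0 < mi \<or> i < j then (B + 1, 1, 1) else (- 1, 1, 1))
     else if mi \<le> 0 then (- 1, 1, 1) else (mi, c j, mj))"

text \<open>For bids between 0 and \<open>B\<close> the price \<open>B + 1\<close> means that
  \<open>i\<close> always beats the state and \<open>- 1\<close> that it never does. In all other
  cases the price is the critical bid, with the tie decided by the order of sellers.\<close>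

lemma beats_iff_below:
  assumes "T \<subseteq> A" "R \<subseteq> A" "i \<in> A" "i \<notin> R" "0 \<le> x" "x \<le> B" "\<And>k. k \<in> R \<Longrightarrow> 0 \<le> c k"
    and "critical c B i (T, R) = (p, q, d)"
  shows "beats c i x (T, R) \<longleftrightarrow> below x (p * q / d) (i < best_item v c T R)"
proof (cases "R = {}")
  case True
  then show ?thesis using assms by (simp add: beats_empty critical_def below_def)
next
  case False
  define j where "j = best_item v c T R"
  have fin: "finite R" by (rule finite_sub[OF assms(2)])
  have "j \<in> R" using best_item_in[OF fin False] by (simp add: j_def)
  then have "j \<in> A" using assms by auto
  then have m: "0 \<le> marginal v j T" "0 \<le> marginal v i T" using marginal_nonneg assms(1,3) by auto
  have b: "beats c i x (T, R) \<longleftrightarrow>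
    (if marginal v j T = 0 then 0 < marginal v i T \<or> i < j
     else 0 < marginal v i T \<and> (x < marginal v i T * c j / marginal v j T \<or>
       x = marginal v i T * c j / marginal v j T \<and> i < j))"
    unfolding j_def using assms False by (intro beats_iff_critical) auto
  have crit: "(if marginal v j T \<le> 0 then (if 0 < marginal v i T \<or> i < j then (B + 1, 1, 1) else (- 1, 1, 1))
     else if marginal v i T \<le> 0 then (- 1, 1, 1) else (marginal v i T, c j, marginal v j T)) = (p, q, d)"
    using assms(8) by (simp only: critical_def prod.case if_not_P[OF False] Let_def j_def)
  show ?thesis unfolding b j_def[symmetric]
    using crit m assms(5,6) by (auto simp: below_def split: if_splits)
qed


text \<open>Bids below the true cost are left out, since winning is monotone: \<open>i\<close> wins
  if and only if some bid from \<open>c i\<close> on wins. The cost of \<open>i\<close> is 0 in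
  \<open>e\<close>, so that sums of costs do not contain the bid. The factor 2 is the share 1/2
  brought to the other side.\<close>

definition winning_bids :: "('a \<Rightarrow> real) \<Rightarrow> real \<Rightarrow> nat \<Rightarrow> 'a \<Rightarrow> nat \<Rightarrow> real set" where
  "winning_bids c B N i k =
     (let A' = affordable B A c; e = c(i := 0); s = greedy_state e (A' - {i}) k in
      {b. c i \<le> b \<and> b \<le> B \<and> beats e i b s \<and>
        (\<exists>U\<subseteq>A'. 1 \<le> card U \<and> card U \<le> 3 \<and>
          (\<exists>x\<in>valued.bids A' v e B N i (c i) (2 * v (insert i (fst s))) U. b \<le> x))})"

lemma sviridenko_range: "0 \<le> B \<Longrightarrow> sviridenko v B A c \<in> v ` Pow A"
proof -
  assume "0 \<le> B"
  let ?C = "{S. S \<subseteq> A \<and> card S \<le> 2 \<and> sum c S \<le> B} \<union>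
    greedy_fill v B A c ` {U. U \<subseteq> A \<and> card U = 3 \<and> sum c U \<le> B}"
  have "finite ?C" using finite_A by auto
  moreover have "{} \<in> ?C" using \<open>0 \<le> B\<close> by simp
  ultimately have "Max (v ` ?C) \<in> v ` ?C" by (intro Max_in) blast+
  moreover have "greedy_fill v B A c U \<subseteq> A" if "U \<subseteq> A" for U
    unfolding greedy_fill_eq[OF that] using that by (intro filled_subset(3)) (auto simp: state_ok_def)
  ultimately show ?thesis unfolding sviridenko_def by blast
qed

text \<open>The estimate takes only values of subsets of \<open>A\<close>, hence finitely many, so
  the supremum over all higher bids is attained.\<close>

lemma le_SUP_sviridenko_iff:
  assumes "0 \<le> B"
  shows "V \<le> (SUP x\<in>{b::real..}. sviridenko v B A (f x)) \<longleftrightarrow> (\<exists>x\<ge>b. V \<le> sviridenko v B A (f x))"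
proof -
  let ?S = "(\<lambda>x. sviridenko v B A (f x)) ` {b..}"
  have "?S \<subseteq> v ` Pow A" using sviridenko_range[OF assms] by blast
  then have fin: "finite ?S" using finite_A finite_subset by blast
  then have "Sup ?S = Max ?S" by (intro cSup_eq_Max) auto
  then show ?thesis using fin by (auto simp: Max_ge_iff)
qed

lemma greedy_state_upd: "R \<subseteq> A \<Longrightarrow> i \<notin> R \<Longrightarrow> greedy_state (c(i := x)) R k = greedy_state c R k"
  unfolding greedy_state_def by (rule run_upd) (auto simp: state_ok_def)

lemma beats_upd: "beats (c(i := z)) i x s = beats c i x s"
  by (simp add: beats_def)

lemma one_le_sviridenko_ratio: "1 \<le> exp 1 / (exp 1 - 1 :: real)"
  by (simp add: pos_le_divide_eq)

lemma om_sviridenko: "0 < B \<Longrightarrow> om A v B (exp 1 / (exp 1 - 1)) (sviridenko v B)"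
  by (intro om.intro om_axioms.intro valued_axioms one_le_sviridenko_ratio approx_oracle_sviridenko) simp_all

lemma heads_sviridenko_wins_iff:
  assumes B: "0 < B" and c: "cost_vector_on A c" and i: "i \<in> affordable B A c"
    and N: "card A \<le> N" and b: "c i \<le> b"
  shows "i \<in> heads_alloc (sviridenko v B) v B A (c(i := b)) \<longleftrightarrow>
    (\<exists>k<N. b \<in> winning_bids c B N i k)"
proof -
  let ?A = "affordable B A c" and ?e = "c(i := 0)"
  interpret V: valued ?A v by (rule valued_affordable)
  interpret O: om A v B "exp 1 / (exp 1 - 1)" "sviridenko v B" using B by (rule om_sviridenko)
  have iA: "i \<in> A" "c i \<le> B" using i by (auto simp: affordable_def)
  have ins: "insert i (?A - {i}) = ?A" using i by auto
  have ci: "0 \<le> c i" using c iA by (simp add: cost_vector_on_def)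
  have e: "cost_vector_on ?A ?e" using c affordable_subset[of B A c] by (auto simp: cost_vector_on_def)
  have cardA: "card ?A \<le> N" using card_mono[OF finite_A affordable_subset[of B A c]] N by simp
  have G: "greedy_state c (?A - {i}) k = greedy_state ?e (?A - {i}) k" for k
    using affordable_subset[of B A c] by (intro greedy_state_upd[symmetric]) auto
  have eq: "w \<le> 1/2 * (SUP x\<in>{b..}. sviridenko v B ?A (c(i := x))) \<longleftrightarrow>
      (\<exists>U\<subseteq>?A. 1 \<le> card U \<and> card U \<le> 3 \<and> (\<exists>x\<in>V.bids ?e B N i (c i) (2 * w) U. b \<le> x))"
    if "b \<le> B" for w
  proof -
    have "w \<le> 1/2 * (SUP x\<in>{b..}. sviridenko v B ?A (c(i := x))) \<longleftrightarrow>
        2 * w \<le> (SUP x\<in>{b..}. sviridenko v B ?A (c(i := x)))" by linarith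
    also have "\<dots> \<longleftrightarrow> (\<exists>x\<ge>b. 2 * w \<le> sviridenko v B ?A (?e(i := x)))"
      using V.le_SUP_sviridenko_iff[of B, where V = "2 * w" and b = b and f = "\<lambda>x. c(i := x)"] B by simp
    also have "\<dots> \<longleftrightarrow>
        (\<exists>U\<subseteq>?A. 1 \<le> card U \<and> card U \<le> 3 \<and> (\<exists>x\<in>V.bids ?e B N i (c i) (2 * w) U. b \<le> x))"
      by (rule V.sviridenko_bid_iff[OF i e _ cardA ci b that]) simp
    finally show ?thesis .
  qed
  show ?thesis
    unfolding O.heads_wins_iff[OF iA(1) N] ins G winning_bids_def Let_def
    using eq b by (auto simp: beats_upd)
qed

text \<open>The winning bids form an interval starting at 0, and \<open>?D\<close> is its part from
  the true cost on: it is nonempty exactly if \<open>i\<close> wins, and its supremum is then the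
  threshold.\<close>

lemma heads_sviridenko_payment:
  assumes B: "0 < B" and c: "cost_vector_on A c" and i: "i \<in> affordable B A c"
    and N: "card A \<le> N" and P: "rep P (\<Union>k<N. winning_bids c B N i k)"
  shows "i \<in> heads_alloc (sviridenko v B) v B A c \<longleftrightarrow> 0 \<le> P"
    and "0 \<le> P \<Longrightarrow> threshold_payment (heads_alloc (sviridenko v B) v B A) c i = P"
proof -
  let ?D = "\<Union>k<N. winning_bids c B N i k"
  let ?f = "heads_alloc (sviridenko v B) v B A"
  interpret O: om A v B "exp 1 / (exp 1 - 1)" "sviridenko v B" using B by (rule om_sviridenko)
  have iA: "i \<in> A" using i by (auto simp: affordable_def)
  have ci: "0 \<le> c i" using c iA by (simp add: cost_vector_on_def)
  have wins: "i \<in> ?f (c(i := b)) \<longleftrightarrow> b \<in> ?D" if "c i \<le> b" for b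
    using heads_sviridenko_wins_iff[OF B c i N that] by auto
  have low: "c i \<le> b" if "b \<in> ?D" for b using that by (auto simp: winning_bids_def Let_def)
  have mono: "i \<in> ?f (c(i := b'))" if "0 \<le> b'" "b' \<le> b" "i \<in> ?f (c(i := b))" for b b'
    using O.heads_wins_antimono[OF c iA that] .
  have "?D \<noteq> {} \<longleftrightarrow> c i \<in> ?D"
    using wins low mono[OF ci] by (metis emptyE ex_in_conv order_refl)
  then show iff: "i \<in> ?f c \<longleftrightarrow> 0 \<le> P" using wins[of "c i"] P by (simp add: rep_def)
  assume P0: "0 \<le> P"
  have le: "b \<le> P" if "b \<in> ?D" for b
  proof (rule ccontr)
    assume "\<not> b \<le> P"
    then have "P < P" using P P0 that unfolding rep_def by (metis not_le)
    then show False by simp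
  qed
  have "c i \<in> ?D" using iff P0 wins[of "c i"] by simp
  then have ciP: "c i \<le> P" by (rule le)
  show "threshold_payment ?f c i = P"
  proof (rule threshold_payment_eqI)
    show "i \<in> ?f c" using iff P0 by simp
    show "i \<notin> ?f (c(i := b))" if "P < b" for b using wins[of b] le[of b] ciP that by auto
    show "i \<in> ?f (c(i := b))" if "0 \<le> b" "b < P" for b
    proof -
      obtain d where d: "d \<in> ?D" "b < d" using P \<open>0 \<le> b\<close> \<open>b < P\<close> unfolding rep_def by blast
      then show ?thesis using wins[of d] low[of d] mono[of b d] \<open>0 \<le> b\<close> by auto
    qed
  qed (rule P0)
qed

text \<open>With unit costs and nothing taken yet, ratios are values up to a common constant, so the
  program can find this seller with the search for the best item.\<close>

lemma most_valuable_eq_best: "A \<noteq> {} \<Longrightarrow> most_valuable v A = best_item v (\<lambda>_. 1) {} A"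
proof -
  have "ratio v (\<lambda>_. 1) {} j = ereal (v {j} - v {})" for j
    by (simp add: ratio_def marginal_def zero_ereal_def)
  then show ?thesis by (simp add: most_valuable_def best_item_def)
qed

end

section \<open>Verifying programs\<close>

notation Seq (infixr \<open>;;\<close> 60)

abbreviation At :: "vname \<Rightarrow> nexp" where "At x \<equiv> NGet x (NConst 0)"
abbreviation Real :: "vname \<Rightarrow> lexp" where "Real x \<equiv> LGet x (NConst 0)"
abbreviation For_all :: "vname \<Rightarrow> com \<Rightarrow> com" where "For_all x p \<equiv> For x (At ''n'') p"
abbreviation member :: "vname \<Rightarrow> nexp \<Rightarrow> bexp" where "member x e \<equiv> NLe (NConst 1) (NGet x e)"
abbreviation nless :: "nexp \<Rightarrow> nexp \<Rightarrow> bexp" where "nless a b \<equiv> BNot (NLe b a)"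
abbreviation rless :: "rexp \<Rightarrow> rexp \<Rightarrow> bexp" where "rless a b \<equiv> BNot (RLe b a)"
abbreviation BOr :: "bexp \<Rightarrow> bexp \<Rightarrow> bexp" where "BOr a b \<equiv> BNot (BAnd (BNot a) (BNot b))"

section \<open>Frame conditions and running time of programs\<close>

primrec nmods :: "com \<Rightarrow> vname set" where
  "nmods Skip = {}"
| "nmods (NSet x k e) = {x}"
| "nmods (LSet x k e) = {}"
| "nmods (Query x k y) = {}"
| "nmods (Pay k e) = {}"
| "nmods (Seq p q) = nmods p \<union> nmods q"
| "nmods (Cond b p q) = nmods p \<union> nmods q"
| "nmods (For x e p) = insert x (nmods p)"

primrec rmods :: "com \<Rightarrow> vname set" where
  "rmods Skip = {}"
| "rmods (NSet x k e) = {}"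
| "rmods (LSet x k e) = {x}"
| "rmods (Query x k y) = {x}"
| "rmods (Pay k e) = {}"
| "rmods (Seq p q) = rmods p \<union> rmods q"
| "rmods (Cond b p q) = rmods p \<union> rmods q"
| "rmods (For x e p) = rmods p"

primrec pay_free :: "com \<Rightarrow> bool" where
  "pay_free Skip = True"
| "pay_free (NSet x k e) = True"
| "pay_free (LSet x k e) = True"
| "pay_free (Query x k y) = True"
| "pay_free (Pay k e) = False"
| "pay_free (Seq p q) = (pay_free p \<and> pay_free q)"
| "pay_free (Cond b p q) = (pay_free p \<and> pay_free q)"
| "pay_free (For x e p) = pay_free p"

text \<open>Every loop runs exactly to \<open>n\<close>, so a bound on the time can be read off the
  syntax as a polynomial whose degree is the nesting depth.\<close>

primrec loops_ok :: "com \<Rightarrow> bool" where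
  "loops_ok Skip = True"
| "loops_ok (NSet x k e) = True"
| "loops_ok (LSet x k e) = True"
| "loops_ok (Query x k y) = True"
| "loops_ok (Pay k e) = True"
| "loops_ok (Seq p q) = (loops_ok p \<and> loops_ok q)"
| "loops_ok (Cond b p q) = (loops_ok p \<and> loops_ok q)"
| "loops_ok (For x e p) = (e = At ''n'' \<and> loops_ok p)"

primrec time_poly :: "com \<Rightarrow> nat poly" where
  "time_poly Skip = 1"
| "time_poly (NSet x k e) = 1"
| "time_poly (LSet x k e) = 1"
| "time_poly (Query x k y) = 1"
| "time_poly (Pay k e) = 1"
| "time_poly (Seq p q) = time_poly p + time_poly q"
| "time_poly (Cond b p q) = time_poly p + time_poly q + 1"
| "time_poly (For x e p) = [:0, 1:] * (time_poly p + 1) + 1"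

lemma store_eq: "store x k a m x = (m x)(k := a)"
  by (simp add: store_def)

lemma store_neq: "y \<noteq> x \<Longrightarrow> store x k a m y = m y"
  by (simp add: store_def)

lemma store_apply: "store x k a m y l = (if y = x \<and> l = k then a else m y l)"
  by (simp add: store_def)

locale machine = valued "{..<n}" v for n :: nat and v :: "nat set \<Rightarrow> real"
begin

definition run :: "com \<Rightarrow> state \<Rightarrow> state" where
  "run p s = fst (exec n v p s)"

abbreviation members :: "state \<Rightarrow> vname \<Rightarrow> nat set" where
  "members s x \<equiv> {i. i < n \<and> nats s x i \<noteq> 0}"

abbreviation enter :: "vname \<Rightarrow> nat \<Rightarrow> state \<Rightarrow> state" where
  "enter x k s \<equiv> s\<lparr>nats := store x 0 k (nats s)\<rparr>"

lemma run_simps [simp]: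
  "run Skip s = s"
  "run (NSet x k e) s = s\<lparr>nats := store x (nval k s) (nval e s) (nats s)\<rparr>"
  "run (LSet x k a) s = s\<lparr>reals := store x (nval k s) (lval a s) (reals s)\<rparr>"
  "run (Query x k y) s = s\<lparr>reals := store x (nval k s) (v (members s y)) (reals s)\<rparr>"
  "run (Pay k r) s = s\<lparr>pays := (pays s)(nval k s := rval r s)\<rparr>"
  "run (Seq p q) s = run q (run p s)"
  "run (Cond b p q) s = (if bval b s then run p s else run q s)"
  by (simp_all add: run_def case_prod_beta Let_def)

lemma exec_loop:
  "fst (fold (\<lambda>k (s, t). let (s', t') = exec n v p (enter x k s) in (s', t + t' + 1)) ks (s, t)) =
    fold (\<lambda>k s. run p (enter x k s)) ks s"
  by (induction ks arbitrary: s t) (simp_all add: run_def case_prod_beta Let_def)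

lemma run_For: "run (For x e p) s = fold (\<lambda>k s. run p (enter x k s)) [0..<nval e s] s"
  by (simp only: run_def[of "For x e p"] exec.simps exec_loop)

lemma For_rule:
  assumes "P 0 s" "\<And>k t. k < N \<Longrightarrow> P k t \<Longrightarrow> P (Suc k) (run p (enter x k t))" "nval e s = N"
  shows "P N (run (For x e p) s)"
proof -
  have "P k (fold (\<lambda>k s. run p (enter x k s)) [0..<k] s)" if "k \<le> N" for k
    using that by (induction k) (use assms in auto)
  then show ?thesis using assms(3) by (simp add: run_For)
qed

lemma frame:
  shows nats_frame: "x \<notin> nmods p \<Longrightarrow> nats (run p s) x = nats s x"
    and reals_frame: "x \<notin> rmods p \<Longrightarrow> reals (run p s) x = reals s x"
    and pays_frame: "pay_free p \<Longrightarrow> pays (run p s) = pays s"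
proof (induction p arbitrary: s)
  case (For y e p)
  { case 1
    then show ?case
      by (intro For_rule[where P = "\<lambda>_ t. nats t x = nats s x"]) (auto simp: For store_neq) }
  { case 2
    then show ?case
      by (intro For_rule[where P = "\<lambda>_ t. reals t x = reals s x"]) (auto simp: For) }
  { case 3
    then show ?case
      by (intro For_rule[where P = "\<lambda>_ t. pays t = pays s"]) (auto simp: For) }
qed (auto simp: store_neq)

lemma exec_time:
  assumes "loops_ok p" "''n'' \<notin> nmods p" "nats s ''n'' 0 = n"
  shows "snd (exec n v p s) \<le> poly (time_poly p) n"
  using assms
proof (induction p arbitrary: s)
  case (Seq p q)
  have "nats (fst (exec n v p s)) ''n'' 0 = n" using nats_frame[of "''n''" p s] Seq by (simp add: run_def)
  then show ?case
    using Seq.IH(1)[of s] Seq.IH(2)[of "fst (exec n v p s)"] Seq.prems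
    by (simp add: case_prod_beta Let_def)
next
  case (Cond b p q)
  then show ?case by (force simp: case_prod_beta Let_def)
next
  case (For x e p)
  let ?step = "\<lambda>k (s, t). let (s', t') = exec n v p (enter x k s) in (s', t + t' + 1)"
  have "nats (fst (fold ?step [0..<k] (s, 1))) ''n'' 0 = n \<and>
      snd (fold ?step [0..<k] (s, 1)) \<le> 1 + k * (poly (time_poly p) n + 1)" if "k \<le> n" for k
    using that
  proof (induction k)
    case 0
    then show ?case using For.prems by simp
  next
    case (Suc k)
    define r where "r = fold ?step [0..<k] (s, 1)"
    have IH: "nats (fst r) ''n'' 0 = n" "snd r \<le> 1 + k * (poly (time_poly p) n + 1)"
      using Suc unfolding r_def by auto
    have n: "nats (enter x k (fst r)) ''n'' 0 = n" using IH(1) For.prems by (simp add: store_neq)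
    have "nats (run p (enter x k (fst r))) ''n'' 0 = n"
      using n nats_frame[of "''n''" p "enter x k (fst r)"] For.prems by simp
    moreover have "snd (exec n v p (enter x k (fst r))) \<le> poly (time_poly p) n"
      using For.prems by (intro For.IH n) auto
    moreover have fold: "fold ?step [0..<Suc k] (s, 1) = ?step k r"
      unfolding r_def upt_Suc_append[OF le0] fold_append by simp
    moreover have "?step k r = (run p (enter x k (fst r)), snd r + snd (exec n v p (enter x k (fst r))) + 1)"
      by (simp add: run_def case_prod_beta Let_def)
    ultimately show ?case using IH(2) unfolding fold by simp
  qed
  from this[of n] show ?case using For.prems by (simp add: algebra_simps case_prod_beta Let_def)
qed simp_all

end

section \<open>Basic program fragments\<close>

definition COPY :: "vname \<Rightarrow> vname \<Rightarrow> com" where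
  "COPY x y = For_all ''k'' (NSet x (At ''k'') (NGet y (At ''k'')))"

definition CLEAR :: "vname \<Rightarrow> com" where
  "CLEAR x = For_all ''k'' (NSet x (At ''k'') (NConst 0))"

definition COST :: "vname \<Rightarrow> com" where
  "COST x = LSet ''K'' (NConst 0) (LConst 0) ;;
     For_all ''k'' (Cond (member x (At ''k''))
       (LSet ''K'' (NConst 0) (LAdd (Real ''K'') (LGet ''e'' (At ''k'')))) Skip)"

text \<open>Sets cell 1 of \<open>j\<close> if \<open>r\<close> is nonempty, cell 0 to the best item of \<open>r\<close> given \<open>x\<close>, and \<open>vT\<close> and
  \<open>vj\<close> to the values of \<open>x\<close> without and with this item. Ratios are compared by cross-multiplication.\<close>

definition BEST :: "vname \<Rightarrow> vname \<Rightarrow> com" where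
  "BEST x r = Query ''vT'' (NConst 0) x ;;
     NSet ''j'' (NConst 1) (NConst 0) ;;
     For_all ''k'' (Cond (member r (At ''k''))
       (NSet x (At ''k'') (NConst 1) ;;
        Query ''vk'' (NConst 0) x ;;
        NSet x (At ''k'') (NConst 0) ;;
        Cond (BOr (NLe (NGet ''j'' (NConst 1)) (NConst 0))
               (BAnd (rless (RLin (Real ''vT'')) (RLin (Real ''vk'')))
                 (BOr (RLe (RLin (Real ''vj'')) (RLin (Real ''vT'')))
                   (rless
                     (RMul (RLin (LSub (Real ''vj'') (Real ''vT''))) (RLin (LGet ''e'' (At ''k''))))
                     (RMul (RLin (LSub (Real ''vk'') (Real ''vT''))) (RLin (LGet ''e'' (At ''j''))))))))
          (NSet ''j'' (NConst 0) (At ''k'') ;;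
           NSet ''j'' (NConst 1) (NConst 1) ;;
           LSet ''vj'' (NConst 0) (Real ''vk''))
          Skip)
       Skip)"

text \<open>The test \<open>b\<close> may refer to the results of \<open>BEST x r\<close> and to \<open>K\<close>, the cost of \<open>x\<close>.\<close>

definition STEP :: "vname \<Rightarrow> vname \<Rightarrow> bexp \<Rightarrow> com" where
  "STEP x r b = BEST x r ;; COST x ;;
     Cond (member ''j'' (NConst 1))
       (Cond b (NSet x (At ''j'') (NConst 1)) Skip ;; NSet r (At ''j'') (NConst 0)) Skip"

lemma mods_fragments [simp]:
  "nmods (COPY x y) = {''k'', x}" "rmods (COPY x y) = {}" "pay_free (COPY x y)" "loops_ok (COPY x y)"
  "nmods (CLEAR x) = {''k'', x}" "rmods (CLEAR x) = {}" "pay_free (CLEAR x)" "loops_ok (CLEAR x)"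
  "nmods (COST x) = {''k''}" "rmods (COST x) = {''K''}" "pay_free (COST x)" "loops_ok (COST x)"
  "nmods (BEST x r) = {''k'', ''j'', x}" "rmods (BEST x r) = {''vT'', ''vj'', ''vk''}"
  "pay_free (BEST x r)" "loops_ok (BEST x r)"
  "nmods (STEP x r b) = {''k'', ''j'', x, r}" "rmods (STEP x r b) = {''K'', ''vT'', ''vj'', ''vk''}"
  "pay_free (STEP x r b)" "loops_ok (STEP x r b)"
  by (auto simp: COPY_def CLEAR_def COST_def BEST_def STEP_def)

context machine
begin

lemma COPY_correct:
  assumes "nats s ''n'' 0 = n" "x \<noteq> ''k''" "y \<noteq> ''k''" "x \<noteq> ''n''" "x \<noteq> y"
  shows "members (run (COPY x y) s) x = members s y"
proof -
  have "nats (run (COPY x y) s) y = nats s y \<and> (\<forall>i<n. nats (run (COPY x y) s) x i = nats s y i)"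
    unfolding COPY_def
    by (rule For_rule[where P = "\<lambda>k t. nats t y = nats s y \<and> (\<forall>i<k. nats t x i = nats s y i)"])
      (use assms in \<open>auto simp: store_apply store_neq less_Suc_eq\<close>)
  then show ?thesis by auto
qed

lemma CLEAR_correct:
  assumes "nats s ''n'' 0 = n" "x \<noteq> ''k''" "x \<noteq> ''n''"
  shows "members (run (CLEAR x) s) x = {}"
proof -
  have "\<forall>i<n. nats (run (CLEAR x) s) x i = 0"
    unfolding CLEAR_def
    by (rule For_rule[where P = "\<lambda>k t. \<forall>i<k. nats t x i = 0"])
      (use assms in \<open>auto simp: store_apply store_neq less_Suc_eq\<close>)
  then show ?thesis by auto
qed

lemma members_less_Suc:
  "{i. i < Suc k \<and> P i} = (if P k then insert k {i. i < k \<and> P i} else {i. i < k \<and> P i})"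
  by (auto simp: less_Suc_eq)

lemma COST_correct:
  assumes "nats s ''n'' 0 = n" "x \<noteq> ''k''"
  shows "reals (run (COST x) s) ''K'' 0 = sum (reals s ''e'') (members s x)"
proof -
  have "reals (run (COST x) s) ''e'' = reals s ''e'' \<and> nats (run (COST x) s) x = nats s x \<and>
      reals (run (COST x) s) ''K'' 0 = sum (reals s ''e'') (members s x)"
    unfolding COST_def run_simps
    by (rule For_rule[where P = "\<lambda>k t. reals t ''e'' = reals s ''e'' \<and> nats t x = nats s x \<and>
        reals t ''K'' 0 = sum (reals s ''e'') {i. i < k \<and> nats s x i \<noteq> 0}"])
      (use assms in \<open>auto simp: store_apply store_neq members_less_Suc\<close>)
  then show ?thesis by blast
qed

definition costs_ok :: "state \<Rightarrow> bool" where
  "costs_ok s \<longleftrightarrow> nats s ''n'' 0 = n \<and> (\<forall>i<n. 0 \<le> reals s ''e'' i)"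

text \<open>Each candidate is put into \<open>x\<close> only for the query; as \<open>x\<close> and
  \<open>r\<close> are disjoint, resetting its cell to 0 restores the array.\<close>

lemma BEST_correct:
  assumes ok: "costs_ok s" and disj: "members s x \<inter> members s r = {}"
    and names: "x \<noteq> r" "x \<notin> {''k'', ''j'', ''n''}" "r \<notin> {''k'', ''j'', ''n''}"
  defines "t \<equiv> run (BEST x r) s" and "b \<equiv> best_item v (reals s ''e'') (members s x) (members s r)"
  shows "nats t x = nats s x" "reals t ''vT'' 0 = v (members s x)"
    "nats t ''j'' 1 \<noteq> 0 \<longleftrightarrow> members s r \<noteq> {}"
    "members s r \<noteq> {} \<Longrightarrow> nats t ''j'' 0 = b \<and> reals t ''vj'' 0 = v (insert b (members s x))"
proof -
  let ?T = "members s x" and ?R = "\<lambda>k. {i. i < k \<and> nats s r i \<noteq> 0}" and ?e = "reals s ''e''"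
  let ?b = "\<lambda>k. best_item v ?e ?T (?R k)"
  define P where "P k t \<longleftrightarrow> nats t ''n'' = nats s ''n'' \<and> reals t ''e'' = ?e \<and>
      nats t r = nats s r \<and> nats t x = nats s x \<and> reals t ''vT'' 0 = v ?T \<and>
      (nats t ''j'' 1 \<noteq> 0 \<longleftrightarrow> ?R k \<noteq> {}) \<and>
      (?R k \<noteq> {} \<longrightarrow> nats t ''j'' 0 = ?b k \<and> reals t ''vj'' 0 = v (insert (?b k) ?T))" for k and t :: state
  have nn: "''k'' \<noteq> x" "''k'' \<noteq> r" "''j'' \<noteq> x" "''j'' \<noteq> r" "''n'' \<noteq> x" "''n'' \<noteq> r" "r \<noteq> x"
    "x \<noteq> ''k''" "r \<noteq> ''k''" "x \<noteq> ''j''" "r \<noteq> ''j''" "x \<noteq> ''n''" "r \<noteq> ''n''"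
    using names by auto
  have n: "nats s ''n'' 0 = n" and e: "\<And>i. i < n \<Longrightarrow> 0 \<le> ?e i" using ok by (auto simp: costs_ok_def)
  have "P n t"
    unfolding t_def BEST_def run_simps
  proof (rule For_rule)
    fix k t assume k: "k < n" and P: "P k t"
    show "P (Suc k) (run (Cond (member r (At ''k''))
       (NSet x (At ''k'') (NConst 1) ;;
        Query ''vk'' (NConst 0) x ;;
        NSet x (At ''k'') (NConst 0) ;;
        Cond (BOr (NLe (NGet ''j'' (NConst 1)) (NConst 0))
               (BAnd (rless (RLin (Real ''vT'')) (RLin (Real ''vk'')))
                 (BOr (RLe (RLin (Real ''vj'')) (RLin (Real ''vT'')))
                   (rless
                     (RMul (RLin (LSub (Real ''vj'') (Real ''vT''))) (RLin (LGet ''e'' (At ''k''))))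
                     (RMul (RLin (LSub (Real ''vk'') (Real ''vT''))) (RLin (LGet ''e'' (At ''j''))))))))
          (NSet ''j'' (NConst 0) (At ''k'') ;;
           NSet ''j'' (NConst 1) (NConst 1) ;;
           LSet ''vj'' (NConst 0) (Real ''vk''))
          Skip)
       Skip) (enter ''k'' k t))" (is "P _ (run ?body _)")
    proof (cases "nats s r k = 0")
      case True
      then show ?thesis
        using P names(1) nn by (simp add: P_def store_neq store_eq members_less_Suc)
    next
      case False
      then have RS: "?R (Suc k) = insert k (?R k)" by (simp add: members_less_Suc)
      have kx: "nats s x k = 0" using disj k False by auto
      then have restore: "(nats s x)(k := 0) = nats s x" by auto
      have ins: "{i. i < n \<and> ((nats s x)(k := 1)) i \<noteq> 0} = insert k ?T" using k kx by auto
      let ?better = "?R k = {} \<or> v ?T < v (insert k ?T) \<and> (v (insert (?b k) ?T) \<le> v ?T \<or>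
          (v (insert (?b k) ?T) - v ?T) * ?e k < (v (insert k ?T) - v ?T) * ?e (?b k))"
      have best: "?b (Suc k) = (if ?better then k else ?b k)"
      proof (cases "?R k = {}")
        case True
        then show ?thesis unfolding RS by (auto intro!: best_item_eqI)
      next
        case F: False
        have bR: "?b k \<in> ?R k" by (rule best_item_in) (use F in auto)
        then have bk: "?b k < k" "?b k < n" using k by auto
        have m: "0 \<le> marginal v (?b k) ?T" using bk by (intro marginal_nonneg) auto
        \<comment> \<open>Sellers are scanned in increasing order, so \<open>k\<close> comes last in
          any tie and has to be strictly better.\<close>
        have "?b (Suc k) = (if ratio v ?e ?T (?b k) < ratio v ?e ?T k then k else ?b k)"
          unfolding RS using best_item_insert[of "?R k" k ?e ?T] F bk by auto
        also have "ratio v ?e ?T (?b k) < ratio v ?e ?T k \<longleftrightarrow> ?better"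
          using F ratio_less_iff[of ?T "?b k" k ?e ?e] bk k e m
          by (auto simp: marginal_def)
        finally show ?thesis .
      qed
      let ?pre = "NSet x (At ''k'') (NConst 1) ;; Query ''vk'' (NConst 0) x ;; NSet x (At ''k'') (NConst 0)"
      let ?cond = "BOr (NLe (NGet ''j'' (NConst 1)) (NConst 0))
               (BAnd (rless (RLin (Real ''vT'')) (RLin (Real ''vk'')))
                 (BOr (RLe (RLin (Real ''vj'')) (RLin (Real ''vT'')))
                   (rless
                     (RMul (RLin (LSub (Real ''vj'') (Real ''vT''))) (RLin (LGet ''e'' (At ''k''))))
                     (RMul (RLin (LSub (Real ''vk'') (Real ''vT''))) (RLin (LGet ''e'' (At ''j'')))))))"
      let ?upd = "NSet ''j'' (NConst 0) (At ''k'') ;; NSet ''j'' (NConst 1) (NConst 1) ;;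
           LSet ''vj'' (NConst 0) (Real ''vk'')"
      note PD = P[unfolded P_def]
      define u where "u = run ?pre (enter ''k'' k t)"
      have tx: "nats t x = nats s x" using PD by simp
      have ux: "nats u x = nats s x" using nn tx restore by (simp add: u_def store_neq store_eq)
      have un: "nats u y = nats t y" if "y \<noteq> x" "y \<noteq> ''k''" for y
        using that nn by (simp add: u_def store_neq store_eq)
      have uk: "nats u ''k'' 0 = k" using nn by (simp add: u_def store_neq store_eq)
      have uv: "reals u ''vk'' 0 = v (insert k ?T)"
        using nn tx ins by (simp add: u_def store_neq store_eq)
      have ur: "reals u y = reals t y" if "y \<noteq> ''vk''" for y
        using that by (simp add: u_def store_neq)
      have uj: "nats u ''j'' = nats t ''j''" "nats u ''n'' = nats t ''n''" "nats u r = nats t r"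
        "reals u ''vT'' = reals t ''vT''" "reals u ''vj'' = reals t ''vj''" "reals u ''e'' = reals t ''e''"
        using un ur nn by auto
      have cond: "bval ?cond u \<longleftrightarrow> ?better"
      proof (cases "?R k = {}")
        case True
        then show ?thesis using PD uj by simp
      next
        case F: False
        then have "0 < nats t ''j'' 1" "nats t ''j'' 0 = ?b k" "reals t ''vj'' 0 = v (insert (?b k) ?T)"
          "reals t ''vT'' 0 = v ?T" "reals t ''e'' = ?e" using PD by auto
        then show ?thesis using F uv uk by (simp only: bval.simps nval.simps rval.simps lval.simps uj not_le) auto
      qed
      have body: "run ?body (enter ''k'' k t) = (if bval ?cond u then run ?upd u else u)"
        using nn False PD by (simp only: run_simps u_def bval.simps nval.simps) (simp add: store_neq store_eq)
      show ?thesis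
      proof (cases ?better)
        case True
        then have "bval ?cond u" using cond by blast
        then have "run ?body (enter ''k'' k t) = run ?upd u" unfolding body by (rule if_P)
        moreover have "P (Suc k) (run ?upd u)"
          using PD True best uj ux uk uv nn unfolding P_def RS by (simp add: store_neq store_eq)
        ultimately show ?thesis by simp
      next
        case F: False
        then have "\<not> bval ?cond u" using cond by blast
        then have "run ?body (enter ''k'' k t) = u" unfolding body by (rule if_not_P)
        moreover have "P (Suc k) u"
        proof -
          have b': "?b (Suc k) = ?b k" unfolding best by (rule if_not_P[OF F])
          have R: "?R k \<noteq> {}" using F by blast
          have R': "?R (Suc k) \<noteq> {}" using RS by simp
          show ?thesis unfolding P_def b' uj ux using PD R R' by blast
        qed
        ultimately show ?thesis by simp
      qed
    qed
  qed (use n names(1) nn in \<open>auto simp: P_def store_apply store_neq\<close>)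
  then show "nats t x = nats s x" "reals t ''vT'' 0 = v ?T" "nats t ''j'' 1 \<noteq> 0 \<longleftrightarrow> members s r \<noteq> {}"
    "members s r \<noteq> {} \<Longrightarrow> nats t ''j'' 0 = b \<and> reals t ''vj'' 0 = v (insert b ?T)"
    by (auto simp: P_def b_def)
qed

text \<open>The acceptance test is a parameter, described by its effect after \<open>BEST\<close>
  and \<open>COST\<close>. Thus one proof serves the greedy order, the filling run and the run for
  the threshold \<open>V\<close>.\<close>

lemma STEP_correct:
  assumes ok: "costs_ok s" and disj: "members s x \<inter> members s r = {}"
    and names: "x \<noteq> r" "x \<notin> {''k'', ''j'', ''n''}" "r \<notin> {''k'', ''j'', ''n''}"
    and test: "\<And>t j. \<lbrakk>\<And>y. y \<notin> {''k'', ''j''} \<Longrightarrow> nats t y = nats s y;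
        \<And>y. y \<notin> {''K'', ''vT'', ''vj'', ''vk''} \<Longrightarrow> reals t y = reals s y;
        nats t ''j'' 0 = j; reals t ''vT'' 0 = v (members s x);
        reals t ''vj'' 0 = v (insert j (members s x));
        reals t ''K'' 0 = sum (reals s ''e'') (members s x); j \<in> members s r\<rbrakk>
      \<Longrightarrow> bval b t \<longleftrightarrow> acc (members s x) j"
  defines "t \<equiv> run (STEP x r b) s"
  shows "(members t x, members t r) = gstep (reals s ''e'') acc (members s x, members s r)"
proof -
  have nn: "''k'' \<noteq> x" "''k'' \<noteq> r" "''j'' \<noteq> x" "''j'' \<noteq> r" "''n'' \<noteq> x" "''n'' \<noteq> r" "r \<noteq> x"
    "x \<noteq> ''k''" "r \<noteq> ''k''" "x \<noteq> ''j''" "r \<noteq> ''j''" "x \<noteq> ''n''" "r \<noteq> ''n''"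
    using names by auto
  define s1 where "s1 = run (BEST x r) s"
  define s2 where "s2 = run (COST x) s1"
  let ?j = "best_item v (reals s ''e'') (members s x) (members s r)"
  note best = BEST_correct[OF ok disj names, folded s1_def]
  have n1: "nats s1 y = nats s y" if "y \<notin> {''k'', ''j''}" for y
    using that best(1) nats_frame[of y "BEST x r" s] by (cases "y = x") (auto simp: s1_def)
  have r1: "reals s1 y = reals s y" if "y \<notin> {''vT'', ''vj'', ''vk''}" for y
    using that reals_frame[of y "BEST x r" s] by (auto simp: s1_def)
  have n2: "nats s2 y = nats s1 y" if "y \<noteq> ''k''" for y
    using that nats_frame[of y "COST x" s1] by (auto simp: s2_def)
  have r2: "reals s2 y = reals s1 y" if "y \<noteq> ''K''" for y
    using that reals_frame[of y "COST x" s1] by (auto simp: s2_def)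
  have "nats s ''n'' 0 = n" using ok by (simp add: costs_ok_def)
  then have "nats s1 ''n'' 0 = n" using n1[of "''n''"] by simp
  then have K: "reals s2 ''K'' 0 = sum (reals s ''e'') (members s x)"
    using COST_correct[of s1 x] names n1[of x] r1[of "''e''"] by (simp add: s2_def)
  have xr: "nats s2 x = nats s x" "nats s2 r = nats s r" using n1 n2 names by auto
  show ?thesis
  proof (cases "members s r = {}")
    case True
    then have "nats s2 ''j'' 1 = 0" using best(3) n2[of "''j''"] by auto
    then have "t = s2" by (simp add: t_def STEP_def s1_def[symmetric] s2_def[symmetric])
    then show ?thesis using True xr by (simp add: gstep_def)
  next
    case False
    have j: "?j \<in> members s r" by (rule best_item_in) (use False in auto)
    have "nats s2 ''j'' 1 \<noteq> 0" using best(3) False n2[of "''j''"] by auto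
    then have found: "Suc 0 \<le> nats s2 ''j'' 1" by simp
    have j0: "nats s2 ''j'' 0 = ?j" using best(4)[OF False] n2[of "''j''"] by simp
    have b: "bval b s2 \<longleftrightarrow> acc (members s x) ?j"
    proof (rule test)
      show "reals s2 ''vT'' 0 = v (members s x)" using best(2) r2[of "''vT''"] by simp
      show "reals s2 ''vj'' 0 = v (insert ?j (members s x))" using best(4)[OF False] r2[of "''vj''"] by simp
    qed (use n1 n2 r1 r2 j0 K j in auto)
    have "t = (let s3 = (if bval b s2 then s2\<lparr>nats := store x ?j 1 (nats s2)\<rparr> else s2)
        in s3\<lparr>nats := store r ?j 0 (nats s3)\<rparr>)"
      using found j0 names(1) nn
      by (simp add: t_def STEP_def s1_def[symmetric] s2_def[symmetric] Let_def store_neq)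
    then show ?thesis
      using False j xr b names by (auto simp: gstep_def Let_def store_eq store_neq)
  qed
qed

end

section \<open>Critical bids and slacks\<close>

abbreviation price_exp :: "vname \<Rightarrow> rexp" where
  "price_exp x \<equiv> RDiv (RMul (RLin (LGet x (NConst 0))) (RLin (LGet x (NConst 1)))) (RLin (LGet x (NConst 2)))"

text \<open>Products and quotients cannot be stored, so bids are stored as triples.\<close>

definition price :: "state \<Rightarrow> vname \<Rightarrow> real" where
  "price s x = reals s x 0 * reals s x 1 / reals s x 2"

definition SETP :: "vname \<Rightarrow> lexp \<Rightarrow> com" where
  "SETP x a = LSet x (NConst 0) a ;; LSet x (NConst 1) (LConst 1) ;; LSet x (NConst 2) (LConst 1)"

definition COPYP :: "vname \<Rightarrow> vname \<Rightarrow> com" where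
  "COPYP x y = LSet x (NConst 0) (LGet y (NConst 0)) ;; LSet x (NConst 1) (LGet y (NConst 1)) ;;
     LSet x (NConst 2) (LGet y (NConst 2))"

text \<open>Stores in \<open>w\<close> the bid up to which seller \<open>i\<close> beats the items in \<open>r\<close>; cell 0 of the array of
  naturals \<open>w\<close> tells whether \<open>i\<close> wins the tie at this bid.\<close>

definition CRIT :: "vname \<Rightarrow> vname \<Rightarrow> vname \<Rightarrow> com" where
  "CRIT x r w = BEST x r ;;
     NSet x (At ''i'') (NConst 1) ;; Query ''F'' (NConst 0) x ;; NSet x (At ''i'') (NConst 0) ;;
     NSet w (NConst 0) (NConst 0) ;;
     Cond (member ''j'' (NConst 1))
       (Cond (nless (At ''i'') (At ''j'')) (NSet w (NConst 0) (NConst 1)) Skip ;;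
        Cond (RLe (RLin (Real ''vj'')) (RLin (Real ''vT'')))
          (Cond (BOr (rless (RLin (Real ''vT'')) (RLin (Real ''F''))) (nless (At ''i'') (At ''j'')))
             (SETP w (LAdd (Real ''B'') (LConst 1))) (SETP w (LConst (- 1))))
          (Cond (RLe (RLin (Real ''F'')) (RLin (Real ''vT''))) (SETP w (LConst (- 1)))
             (LSet w (NConst 0) (LSub (Real ''F'') (Real ''vT'')) ;;
              LSet w (NConst 1) (LGet ''e'' (At ''j'')) ;;
              LSet w (NConst 2) (LSub (Real ''vj'') (Real ''vT'')))))
       (SETP w (LAdd (Real ''B'') (LConst 1)))"

text \<open>\<open>HX\<close> runs the greedy algorithm on \<open>X\<close> and \<open>Y\<close> with the threshold \<open>V\<close> and stores the largest slack in
  \<open>H\<close> (\<open>- 1\<close> if there is none).\<close>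

definition HUPD :: com where
  "HUPD = BEST ''X'' ''Y'' ;; COST ''X'' ;;
     Cond (BAnd (member ''j'' (NConst 1)) (BAnd (RLe (RLin (Real ''V'')) (RLin (Real ''vj'')))
         (RLe (RLin (Real ''H'')) (RLin (LSub (LSub (Real ''B'') (Real ''K'')) (LGet ''e'' (At ''j'')))))))
       (LSet ''H'' (NConst 0) (LSub (LSub (Real ''B'') (Real ''K'')) (LGet ''e'' (At ''j'')))) Skip"

definition HX :: com where
  "HX = LSet ''H'' (NConst 0) (LConst (- 1)) ;; Query ''vT'' (NConst 0) ''X'' ;; COST ''X'' ;;
     Cond (BAnd (RLe (RLin (Real ''V'')) (RLin (Real ''vT'')))
         (RLe (RLin (Real ''H'')) (RLin (LSub (Real ''B'') (Real ''K'')))))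
       (LSet ''H'' (NConst 0) (LSub (Real ''B'') (Real ''K''))) Skip ;;
     For_all ''h'' (HUPD ;; STEP ''X'' ''Y'' (rless (RLin (Real ''vj'')) (RLin (Real ''V''))))"

text \<open>The bids that are not below \<open>L\<close>, below \<open>Z\<close> and at most \<open>H\<close> contribute to the maximum \<open>M\<close>; then
  \<open>L\<close> is raised to \<open>Z\<close>.\<close>

definition CONTRIB :: com where
  "CONTRIB = Cond (rless (RLin (Real ''H'')) (price_exp ''Z''))
     (Cond (BOr (rless (price_exp ''L'') (RLin (Real ''H'')))
         (BAnd (RLe (price_exp ''L'') (RLin (Real ''H''))) (NLe (At ''L'') (NConst 0))))
       (Cond (RLe (price_exp ''M'') (RLin (Real ''H''))) (SETP ''M'' (Real ''H'')) Skip) Skip)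
     (Cond (BOr (rless (price_exp ''L'') (price_exp ''Z''))
         (BAnd (RLe (price_exp ''L'') (price_exp ''Z''))
           (BAnd (NLe (At ''L'') (NConst 0)) (member ''Z'' (NConst 0)))))
       (Cond (RLe (price_exp ''M'') (price_exp ''Z'')) (COPYP ''M'' ''Z'') Skip) Skip)"

definition LUPD :: com where
  "LUPD = Cond (BOr (rless (price_exp ''L'') (price_exp ''Z''))
         (BAnd (RLe (price_exp ''L'') (price_exp ''Z'')) (member ''Z'' (NConst 0))))
     (COPYP ''L'' ''Z'' ;; NSet ''L'' (NConst 0) (At ''Z'')) Skip"

lemma mods_SETP [simp]:
  "nmods (SETP x a) = {}" "rmods (SETP x a) = {x}" "pay_free (SETP x a)" "loops_ok (SETP x a)"
  "nmods (COPYP x y) = {}" "rmods (COPYP x y) = {x}" "pay_free (COPYP x y)" "loops_ok (COPYP x y)"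
  by (auto simp: SETP_def COPYP_def)

lemma mods_critical [simp]:
  "nmods (CRIT x r w) = {''k'', ''j'', x, w}" "rmods (CRIT x r w) = {''vT'', ''vj'', ''vk'', ''F'', w}"
  "pay_free (CRIT x r w)" "loops_ok (CRIT x r w)"
  "nmods HUPD = {''k'', ''j'', ''X''}" "rmods HUPD = {''vT'', ''vj'', ''vk'', ''K'', ''H''}"
  "pay_free HUPD" "loops_ok HUPD"
  by (auto simp: CRIT_def HUPD_def)

lemma mods_HX [simp]:
  "nmods HX = {''k'', ''j'', ''h'', ''X'', ''Y''}" "rmods HX = {''vT'', ''vj'', ''vk'', ''K'', ''H''}"
  "pay_free HX" "loops_ok HX"
  "nmods CONTRIB = {}" "rmods CONTRIB = {''M''}" "pay_free CONTRIB" "loops_ok CONTRIB"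
  "nmods LUPD = {''L''}" "rmods LUPD = {''L''}" "pay_free LUPD" "loops_ok LUPD"
  by (auto simp: HX_def CONTRIB_def LUPD_def)

context machine
begin

definition arr :: "(vname \<Rightarrow> nat \<Rightarrow> nat) \<Rightarrow> vname \<Rightarrow> nat set" where
  "arr m x = {i. i < n \<and> m x i \<noteq> 0}"

lemma arr_store: "arr (store x k a m) y = (if y = x then (if a = 0 then arr m x - {k}
    else if k < n then insert k (arr m x) else arr m x) else arr m y)"
  by (auto simp: arr_def store_apply)

lemma arr_less: "arr m x \<subseteq> {..<n}"
  by (auto simp: arr_def)

lemma arr_frame: "x \<notin> nmods p \<Longrightarrow> arr (nats (run p s)) x = arr (nats s) x"
  by (simp add: arr_def nats_frame)

lemma run_Query: "run (Query x k y) s =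
    s\<lparr>reals := store x (nval k s) (v (arr (nats s) y)) (reals s)\<rparr>"
  by (simp add: arr_def)

declare run_simps(4) [simp del]
declare run_Query [simp]

lemmas COPY_arr = COPY_correct[folded arr_def]
lemmas CLEAR_arr = CLEAR_correct[folded arr_def]
lemmas COST_arr = COST_correct[folded arr_def]
lemmas BEST_arr = BEST_correct[folded arr_def]
lemmas STEP_arr = STEP_correct[folded arr_def]

lemma price_SETP: "price (run (SETP x a) s) x = lval a s"
  by (simp add: SETP_def price_def store_eq)

lemma price_COPYP: "x \<noteq> y \<Longrightarrow> price (run (COPYP x y) s) x = price s y"
  by (simp add: COPYP_def price_def store_eq store_neq)

lemma price_frame: "x \<notin> rmods p \<Longrightarrow> price (run p s) x = price s x"
  by (simp add: price_def reals_frame)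

lemma nats_SETP: "nats (run (SETP x a) s) = nats s" "nats (run (COPYP x y) s) = nats s"
  by (simp_all add: SETP_def COPYP_def)

text \<open>Bids beyond \<open>B\<close> are excluded because the stored price \<open>B + 1\<close>
  has to stand for winning at every bid within the budget.\<close>

lemma CRIT_correct:
  assumes ok: "costs_ok s" and disj: "arr (nats s) x \<inter> arr (nats s) r = {}"
    and names: "x \<noteq> r" "x \<notin> {''k'', ''j'', ''n'', ''i''}" "r \<notin> {''k'', ''j'', ''n'', ''i''}"
      "w \<notin> {''k'', ''j'', ''n'', ''i'', ''B'', ''e'', ''F'', ''vj'', ''vT'', ''vk'', x, r}"
    and i: "nats s ''i'' 0 = i" "i < n" "i \<notin> arr (nats s) x" "i \<notin> arr (nats s) r"
  defines "t \<equiv> run (CRIT x r w) s"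
  shows "arr (nats t) x = arr (nats s) x" "reals t ''F'' 0 = v (insert i (arr (nats s) x))"
    "0 \<le> y \<Longrightarrow> y \<le> reals s ''B'' 0 \<Longrightarrow>
      beats (reals s ''e'') i y (arr (nats s) x, arr (nats s) r) \<longleftrightarrow> below y (price t w) (nats t w 0 \<noteq> 0)"
proof -
  let ?T = "arr (nats s) x" and ?R = "arr (nats s) r" and ?e = "reals s ''e''"
  let ?j = "best_item v ?e ?T ?R" and ?B = "reals s ''B'' 0"
  have nn: "''k'' \<noteq> x" "''j'' \<noteq> x" "''n'' \<noteq> x" "''i'' \<noteq> x" "x \<noteq> ''k''" "x \<noteq> ''j''" "x \<noteq> ''i''"
    "w \<noteq> x" "x \<noteq> w" "w \<noteq> ''j''" "''j'' \<noteq> w" "w \<noteq> ''i''" "''i'' \<noteq> w" "w \<noteq> ''F''" "''F'' \<noteq> w" "w \<noteq> ''vj''" "''vj'' \<noteq> w"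
    "w \<noteq> ''vT''" "''vT'' \<noteq> w" "w \<noteq> ''B''" "''B'' \<noteq> w" "w \<noteq> ''e''" "''e'' \<noteq> w"
    using names by auto
  define u where "u = run (BEST x r) s"
  have best: "nats u x = nats s x" "reals u ''vT'' 0 = v ?T" "nats u ''j'' 1 \<noteq> 0 \<longleftrightarrow> ?R \<noteq> {}"
    "?R \<noteq> {} \<Longrightarrow> nats u ''j'' 0 = ?j \<and> reals u ''vj'' 0 = v (insert ?j ?T)"
    unfolding u_def using BEST_arr[OF ok disj] names by auto
  have ui: "nats u ''i'' 0 = i" "reals u ''B'' 0 = ?B" "reals u ''e'' = ?e"
    using nn nats_frame[of "''i''" "BEST x r" s] reals_frame[of _ "BEST x r" s] i by (auto simp: u_def)
  define u2 where "u2 = run (NSet x (At ''i'') (NConst 1) ;; Query ''F'' (NConst 0) x ;;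
     NSet x (At ''i'') (NConst 0) ;; NSet w (NConst 0) (NConst 0)) u"
  have ax: "arr (nats u) x = ?T" using best(1) by (simp add: arr_def)
  have u2: "arr (nats u2) x = ?T" "reals u2 ''F'' 0 = v (insert i ?T)" "nats u2 w 0 = 0"
    "nats u2 ''i'' 0 = i" "nats u2 ''j'' = nats u ''j''"
    "reals u2 ''vT'' = reals u ''vT''" "reals u2 ''vj'' = reals u ''vj''"
    "reals u2 ''B'' = reals u ''B''" "reals u2 ''e'' = reals u ''e''"
    using nn ui i ax by (auto simp: u2_def arr_store store_eq store_neq)
  note b2 = u2(4-) best(2-4) ui
  have t: "t = run (Cond (member ''j'' (NConst 1))
       (Cond (nless (At ''i'') (At ''j'')) (NSet w (NConst 0) (NConst 1)) Skip ;;
        Cond (RLe (RLin (Real ''vj'')) (RLin (Real ''vT'')))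
          (Cond (BOr (rless (RLin (Real ''vT'')) (RLin (Real ''F''))) (nless (At ''i'') (At ''j'')))
             (SETP w (LAdd (Real ''B'') (LConst 1))) (SETP w (LConst (- 1))))
          (Cond (RLe (RLin (Real ''F'')) (RLin (Real ''vT''))) (SETP w (LConst (- 1)))
             (LSet w (NConst 0) (LSub (Real ''F'') (Real ''vT'')) ;;
              LSet w (NConst 1) (LGet ''e'' (At ''j'')) ;;
              LSet w (NConst 2) (LSub (Real ''vj'') (Real ''vT'')))))
       (SETP w (LAdd (Real ''B'') (LConst 1)))) u2" (is "t = run ?last u2")
    unfolding t_def CRIT_def u2_def u_def by (simp only: run_simps)
  have last: "x \<notin> nmods ?last" "''F'' \<notin> rmods ?last" using nn by auto
  show "arr (nats t) x = ?T" unfolding t arr_frame[OF last(1)] by (rule u2(1))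
  show "reals t ''F'' 0 = v (insert i ?T)" unfolding t reals_frame[OF last(2)] by (rule u2(2))
  assume y: "0 \<le> y" "y \<le> ?B"
  show "beats ?e i y (?T, ?R) \<longleftrightarrow> below y (price t w) (nats t w 0 \<noteq> 0)"
  proof (cases "?R = {}")
    case True
    then have "nats u2 ''j'' 1 = 0" using b2 by auto
    then have "t = run (SETP w (LAdd (Real ''B'') (LConst 1))) u2" unfolding t by simp
    then have "price t w = ?B + 1" using b2 by (simp add: price_SETP)
    then show ?thesis using True y by (simp add: beats_empty below_def)
  next
    case False
    have "nats u2 ''j'' 1 \<noteq> 0" using b2 False by simp
    then have found: "Suc 0 \<le> nats u2 ''j'' 1" by simp
    have j: "nats u2 ''j'' 0 = ?j" "reals u2 ''vj'' 0 = v (insert ?j ?T)" using b2 False by auto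
    define p where "p = reals t w 0"
    define q where "q = reals t w 1"
    define d where "d = reals t w 2"
    have crit: "critical ?e ?B i (?T, ?R) = (p, q, d) \<and> (nats t w 0 \<noteq> 0 \<longleftrightarrow> i < ?j)"
      unfolding p_def q_def d_def t critical_def prod.case if_not_P[OF False] Let_def marginal_def
      using found j b2 u2(2,3) nn
      by (auto simp: SETP_def store_eq store_neq)
    have "beats ?e i y (?T, ?R) \<longleftrightarrow> below y (p * q / d) (i < ?j)"
      using ok y i crit arr_less arr_less[of "nats s" r]
      by (intro beats_iff_below[where B = ?B]) (auto simp: costs_ok_def)
    then show ?thesis using crit by (simp add: price_def p_def q_def d_def)
  qed
qed

lemma HUPD_correct:
  assumes ok: "costs_ok s" and disj: "arr (nats s) ''X'' \<inter> arr (nats s) ''Y'' = {}"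
  defines "t \<equiv> run HUPD s"
  shows "nats t ''X'' = nats s ''X''"
    "x \<le> reals t ''H'' 0 \<longleftrightarrow> x \<le> reals s ''H'' 0 \<or>
      (\<exists>h\<in>slack_at (reals s ''e'') (reals s ''B'' 0) (reals s ''V'' 0) (arr (nats s) ''X'', arr (nats s) ''Y''). x \<le> h)"
proof -
  let ?T = "arr (nats s) ''X''" and ?R = "arr (nats s) ''Y''" and ?e = "reals s ''e''"
  let ?j = "best_item v ?e ?T ?R"
  define u where "u = run (BEST ''X'' ''Y'') s"
  define u2 where "u2 = run (COST ''X'') u"
  have best: "nats u ''X'' = nats s ''X''" "nats u ''j'' 1 \<noteq> 0 \<longleftrightarrow> ?R \<noteq> {}"
    "?R \<noteq> {} \<Longrightarrow> nats u ''j'' 0 = ?j \<and> reals u ''vj'' 0 = v (insert ?j ?T)"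
    unfolding u_def using BEST_arr[OF ok disj] by auto
  have u: "nats u ''n'' = nats s ''n''" "reals u ''e'' = ?e" "reals u ''B'' = reals s ''B''"
    "reals u ''V'' = reals s ''V''" "reals u ''H'' = reals s ''H''"
    by (simp_all add: u_def nats_frame reals_frame)
  have u2: "nats u2 ''X'' = nats u ''X''" "nats u2 ''j'' = nats u ''j''" "reals u2 ''e'' = reals u ''e''"
    "reals u2 ''B'' = reals u ''B''" "reals u2 ''V'' = reals u ''V''" "reals u2 ''H'' = reals u ''H''"
    "reals u2 ''vj'' = reals u ''vj''"
    by (simp_all add: u2_def nats_frame reals_frame)
  have K: "reals u2 ''K'' 0 = sum ?e ?T"
    using COST_arr[of u "''X''"] ok u best(1) by (simp add: u2_def costs_ok_def arr_def)
  have t: "t = run (Cond (BAnd (member ''j'' (NConst 1)) (BAnd (RLe (RLin (Real ''V'')) (RLin (Real ''vj'')))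
         (RLe (RLin (Real ''H'')) (RLin (LSub (LSub (Real ''B'') (Real ''K'')) (LGet ''e'' (At ''j'')))))))
       (LSet ''H'' (NConst 0) (LSub (LSub (Real ''B'') (Real ''K'')) (LGet ''e'' (At ''j'')))) Skip) u2"
    unfolding t_def HUPD_def u2_def u_def by (simp only: run_simps)
  show "nats t ''X'' = nats s ''X''" unfolding t using u2 best(1) by simp
  show "x \<le> reals t ''H'' 0 \<longleftrightarrow> x \<le> reals s ''H'' 0 \<or>
      (\<exists>h\<in>slack_at ?e (reals s ''B'' 0) (reals s ''V'' 0) (?T, ?R). x \<le> h)"
  proof (cases "?R = {}")
    case True
    then have "nats u2 ''j'' 1 = 0" using best u2 by auto
    then show ?thesis using True u2 u unfolding t by (simp add: slack_at_def)
  next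
    case False
    have "nats u2 ''j'' 1 \<noteq> 0" using best u2 False by simp
    then have found: "Suc 0 \<le> nats u2 ''j'' 1" by simp
    then show ?thesis using False u2 u best(3)[OF False] K unfolding t
      by (auto simp: slack_at_def store_eq)
  qed
qed

text \<open>Comparing only nonnegative \<open>x\<close> makes the initial value \<open>- 1\<close>
  and negative slacks indistinguishable from having no slack at all.\<close>

lemma HX_correct:
  assumes ok: "costs_ok s" and disj: "arr (nats s) ''X'' \<inter> arr (nats s) ''Y'' = {}" and x: "0 \<le> x"
  shows "x \<le> reals (run HX s) ''H'' 0 \<longleftrightarrow>
    (\<exists>h\<in>slack (reals s ''e'') (reals s ''B'' 0) (reals s ''V'' 0) n (arr (nats s) ''X'') (arr (nats s) ''Y''). x \<le> h)"
proof -
  let ?T = "arr (nats s) ''X''" and ?R = "arr (nats s) ''Y''" and ?e = "reals s ''e''"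
  let ?B = "reals s ''B'' 0" and ?V = "reals s ''V'' 0"
  let ?st = "vstate ?e ?V ?T ?R"
  let ?pre = "LSet ''H'' (NConst 0) (LConst (- 1)) ;; Query ''vT'' (NConst 0) ''X'' ;; COST ''X'' ;;
     Cond (BAnd (RLe (RLin (Real ''V'')) (RLin (Real ''vT'')))
         (RLe (RLin (Real ''H'')) (RLin (LSub (Real ''B'') (Real ''K'')))))
       (LSet ''H'' (NConst 0) (LSub (Real ''B'') (Real ''K''))) Skip"
  let ?body = "HUPD ;; STEP ''X'' ''Y'' (rless (RLin (Real ''vj'')) (RLin (Real ''V'')))"
  define u where "u = run ?pre s"
  have HX: "run HX s = run (For_all ''h'' ?body) u"
    unfolding HX_def u_def by (simp only: run_simps)
  define P where "P k t \<longleftrightarrow> nats t ''n'' = nats s ''n'' \<and> reals t ''e'' = ?e \<and>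
      reals t ''B'' = reals s ''B'' \<and> reals t ''V'' = reals s ''V'' \<and>
      (arr (nats t) ''X'', arr (nats t) ''Y'') = ?st k \<and>
      (\<forall>x\<ge>0. x \<le> reals t ''H'' 0 \<longleftrightarrow> (?V \<le> v ?T \<and> x \<le> ?B - sum ?e ?T) \<or>
        (\<exists>l<k. \<exists>h\<in>slack_at ?e ?B ?V (?st l). x \<le> h))" for k and t :: state
  have "P n (run (For_all ''h'' ?body) u)"
  proof (rule For_rule)
    define u1 where "u1 = run (LSet ''H'' (NConst 0) (LConst (- 1)) ;; Query ''vT'' (NConst 0) ''X'') s"
    define u2 where "u2 = run (COST ''X'') u1"
    have u1: "nats u1 = nats s" "reals u1 ''e'' = ?e" "reals u1 ''B'' = reals s ''B''"
      "reals u1 ''V'' = reals s ''V''" "reals u1 ''H'' 0 = - 1" "reals u1 ''vT'' 0 = v ?T"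
      by (simp_all add: u1_def store_eq store_neq)
    have K: "reals u2 ''K'' 0 = sum ?e ?T"
      using COST_arr[of u1 "''X''"] ok u1 by (simp add: u2_def costs_ok_def)
    have u2: "nats u2 ''n'' = nats s ''n''" "nats u2 ''X'' = nats s ''X''" "nats u2 ''Y'' = nats s ''Y''"
      "reals u2 ''e'' = ?e" "reals u2 ''B'' = reals s ''B''"
      "reals u2 ''V'' = reals s ''V''" "reals u2 ''H'' 0 = - 1" "reals u2 ''vT'' 0 = v ?T"
      using u1 by (simp_all add: u2_def nats_frame reals_frame)
    have u: "u = run (Cond (BAnd (RLe (RLin (Real ''V'')) (RLin (Real ''vT'')))
         (RLe (RLin (Real ''H'')) (RLin (LSub (Real ''B'') (Real ''K'')))))
       (LSet ''H'' (NConst 0) (LSub (Real ''B'') (Real ''K''))) Skip) u2"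
      unfolding u_def u2_def u1_def by (simp only: run_simps)
    have "(arr (nats u) ''X'', arr (nats u) ''Y'') = (?T, ?R)" unfolding u using u2 by (simp add: arr_def)
    then show "P 0 u" using u2 K unfolding P_def u by (auto simp: vstate_def store_eq store_neq)
    show "nval (At ''n'') u = n" using u2 ok unfolding u by (simp add: costs_ok_def)
  next
    fix k t assume P: "P k t"
    define t0 where "t0 = enter ''h'' k t"
    define t1 where "t1 = run HUPD t0"
    define t2 where "t2 = run (STEP ''X'' ''Y'' (rless (RLin (Real ''vj'')) (RLin (Real ''V'')))) t1"
    obtain T R where TR: "?st k = (T, R)" by force
    have t0: "costs_ok t0" "arr (nats t0) ''X'' = T" "arr (nats t0) ''Y'' = R" "reals t0 = reals t"
      "nats t0 ''n'' = nats s ''n''"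
      using P ok TR by (auto simp: P_def t0_def costs_ok_def arr_store store_neq)
    have "state_ok (?T, ?R)" using disj arr_less by (auto simp: state_ok_def)
    then have "state_ok (T, R)" unfolding TR[symmetric] vstate_def by (rule state_ok_run)
    then have disj': "T \<inter> R = {}" by (simp add: state_ok_def)
    note hu = HUPD_correct[OF t0(1), folded t1_def, unfolded t0(2-4), OF disj']
    have t1: "nats t1 ''n'' = nats s ''n''" "nats t1 ''Y'' = nats t0 ''Y''" "reals t1 ''e'' = ?e"
      "reals t1 ''B'' = reals s ''B''" "reals t1 ''V'' = reals s ''V''"
      using P t0 by (simp_all add: t1_def nats_frame reals_frame P_def)
    have arr1: "arr (nats t1) ''X'' = T" "arr (nats t1) ''Y'' = R"
      using hu(1) t1(2) t0 by (simp_all add: arr_def)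
    have ok1: "costs_ok t1" using ok t1 by (simp add: costs_ok_def)
    have st: "(arr (nats t2) ''X'', arr (nats t2) ''Y'') = gstep ?e (\<lambda>T j. v (insert j T) < ?V) (T, R)"
      using STEP_arr[OF ok1, of "''X''" "''Y''" "rless (RLin (Real ''vj'')) (RLin (Real ''V''))"
          "\<lambda>T j. v (insert j T) < ?V", folded t2_def] disj' arr1 t1
      by (simp add: not_le)
    have "run ?body t0 = t2" by (simp add: t2_def t1_def)
    moreover have "P (Suc k) t2"
      unfolding P_def
    proof (intro conjI allI impI)
      show "(arr (nats t2) ''X'', arr (nats t2) ''Y'') = ?st (Suc k)"
        using st TR by (simp add: vstate_def)
      fix x :: real assume "0 \<le> x"
      have "x \<le> reals t2 ''H'' 0 \<longleftrightarrow> x \<le> reals t1 ''H'' 0" by (simp add: t2_def reals_frame)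
      also have "\<dots> \<longleftrightarrow> x \<le> reals t ''H'' 0 \<or> (\<exists>h\<in>slack_at ?e ?B ?V (?st k). x \<le> h)"
        using hu(2)[of x] P TR by (simp add: P_def)
      finally show "x \<le> reals t2 ''H'' 0 \<longleftrightarrow> (?V \<le> v ?T \<and> x \<le> ?B - sum ?e ?T) \<or>
          (\<exists>l<Suc k. \<exists>h\<in>slack_at ?e ?B ?V (?st l). x \<le> h)"
        using P \<open>0 \<le> x\<close> unfolding P_def less_Suc_eq by blast
    qed (use t1 in \<open>simp_all add: t2_def nats_frame reals_frame\<close>)
    ultimately show "P (Suc k) (run ?body (enter ''h'' k t))" by (simp add: t0_def)
  qed
  then have "x \<le> reals (run HX s) ''H'' 0 \<longleftrightarrow> (?V \<le> v ?T \<and> x \<le> ?B - sum ?e ?T) \<or>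
      (\<exists>l<n. \<exists>h\<in>slack_at ?e ?B ?V (?st l). x \<le> h)"
    unfolding HX P_def using x by blast
  also have "\<dots> \<longleftrightarrow> (\<exists>h\<in>slack ?e ?B ?V n ?T ?R. x \<le> h)" unfolding slack_def by blast
  finally show ?thesis .
qed

lemma rep_if: "rep a E \<Longrightarrow> rep b F \<Longrightarrow> rep (if a \<le> b then b else a) (E \<union> F)"
  using rep_Un[of a E b F] by (simp add: max_def)

text \<open>\<open>rep\<close> lets a single price carry both the supremum of the bids found so far
  and whether there are any; a negative price means none.\<close>

lemma CONTRIB_correct:
  assumes "rep (price s ''M'') E" "0 \<le> price s ''L''"
  shows "rep (price (run CONTRIB s) ''M'') (E \<union> {x. \<not> below x (price s ''L'') (nats s ''L'' 0 \<noteq> 0) \<and>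
    below x (price s ''Z'') (nats s ''Z'' 0 \<noteq> 0) \<and> x \<le> reals s ''H'' 0})"
proof -
  let ?l = "price s ''L''" and ?lu = "nats s ''L'' 0 \<noteq> 0" and ?z = "price s ''Z''"
  let ?u = "nats s ''Z'' 0 \<noteq> 0" and ?h = "reals s ''H'' 0" and ?m = "price s ''M''"
  note I = rep_interval[OF assms(2), where h = ?h and z = ?z and lu = ?lu and u = ?u]
  have c: "bval (rless (RLin (Real ''H'')) (price_exp ''Z'')) s \<longleftrightarrow> ?h < ?z"
    "bval (BOr (rless (price_exp ''L'') (RLin (Real ''H'')))
         (BAnd (RLe (price_exp ''L'') (RLin (Real ''H''))) (NLe (At ''L'') (NConst 0)))) s
      \<longleftrightarrow> ?l < ?h \<or> ?l = ?h \<and> \<not> ?lu"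
    "bval (BOr (rless (price_exp ''L'') (price_exp ''Z''))
         (BAnd (RLe (price_exp ''L'') (price_exp ''Z''))
           (BAnd (NLe (At ''L'') (NConst 0)) (member ''Z'' (NConst 0))))) s
      \<longleftrightarrow> ?l < ?z \<or> ?l = ?z \<and> \<not> ?lu \<and> ?u"
    "bval (RLe (price_exp ''M'') (RLin (Real ''H''))) s \<longleftrightarrow> ?m \<le> ?h"
    "bval (RLe (price_exp ''M'') (price_exp ''Z'')) s \<longleftrightarrow> ?m \<le> ?z"
    by (auto simp: price_def)
  have R: "run CONTRIB s =
    (if ?h < ?z then (if ?l < ?h \<or> ?l = ?h \<and> \<not> ?lu then (if ?m \<le> ?h then run (SETP ''M'' (Real ''H'')) s else s) else s)
     else (if ?l < ?z \<or> ?l = ?z \<and> \<not> ?lu \<and> ?u then (if ?m \<le> ?z then run (COPYP ''M'' ''Z'') s else s) else s))"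
    unfolding CONTRIB_def by (simp only: run_simps c)
  have M: "price (run CONTRIB s) ''M'' =
    (if ?h < ?z then (if ?l < ?h \<or> ?l = ?h \<and> \<not> ?lu then (if ?m \<le> ?h then ?h else ?m) else ?m)
     else (if ?l < ?z \<or> ?l = ?z \<and> \<not> ?lu \<and> ?u then (if ?m \<le> ?z then ?z else ?m) else ?m))"
    unfolding R by (auto simp: price_SETP price_COPYP)
  show ?thesis
  proof (cases "?h < ?z")
    case True
    show ?thesis
    proof (cases "?l < ?h \<or> ?l = ?h \<and> \<not> ?lu")
      case t: True
      show ?thesis unfolding M if_P[OF True] if_P[OF t] by (rule rep_if[OF assms(1) I(1)[OF True t]])
    next
      case f: False
      show ?thesis unfolding M if_P[OF True] if_not_P[OF f] I(2)[OF True f] using assms(1) by simp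
    qed
  next
    case False
    then have z: "?z \<le> ?h" by simp
    show ?thesis
    proof (cases "?l < ?z \<or> ?l = ?z \<and> \<not> ?lu \<and> ?u")
      case t: True
      show ?thesis unfolding M if_not_P[OF False] if_P[OF t] by (rule rep_if[OF assms(1) I(3)[OF z t]])
    next
      case f: False
      show ?thesis unfolding M if_not_P[OF False] if_not_P[OF f] I(4)[OF z f] using assms(1) by simp
    qed
  qed
qed

lemma LUPD_correct:
  fixes s
  defines "t \<equiv> run LUPD s"
  shows "\<not> below x (price t ''L'') (nats t ''L'' 0 \<noteq> 0) \<longleftrightarrow>
      \<not> below x (price s ''L'') (nats s ''L'' 0 \<noteq> 0) \<and> \<not> below x (price s ''Z'') (nats s ''Z'' 0 \<noteq> 0)"
    and "price s ''L'' \<le> price t ''L''"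
proof -
  let ?c = "price s ''L'' < price s ''Z'' \<or> price s ''L'' = price s ''Z'' \<and> nats s ''Z'' 0 \<noteq> 0"
  have "bval (BOr (rless (price_exp ''L'') (price_exp ''Z''))
         (BAnd (RLe (price_exp ''L'') (price_exp ''Z'')) (member ''Z'' (NConst 0)))) s \<longleftrightarrow> ?c"
    by (auto simp: price_def)
  then have t: "t = (if ?c then run (COPYP ''L'' ''Z'' ;; NSet ''L'' (NConst 0) (At ''Z'')) s else s)"
    unfolding t_def LUPD_def by (simp only: run_simps)
  have "price t ''L'' = (if ?c then price s ''Z'' else price s ''L'')"
    "nats t ''L'' 0 = (if ?c then nats s ''Z'' 0 else nats s ''L'' 0)"
    unfolding t by (auto simp: COPYP_def price_def store_eq store_neq)
  moreover from this have "(nats t ''L'' 0 \<noteq> 0) = (if ?c then nats s ''Z'' 0 \<noteq> 0 else nats s ''L'' 0 \<noteq> 0)"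
    by simp
  ultimately show "\<not> below x (price t ''L'') (nats t ''L'' 0 \<noteq> 0) \<longleftrightarrow>
      \<not> below x (price s ''L'') (nats s ''L'' 0 \<noteq> 0) \<and> \<not> below x (price s ''Z'') (nats s ''Z'' 0 \<noteq> 0)"
    "price s ''L'' \<le> price t ''L''"
    unfolding below_lower_update by auto
qed

end

section \<open>The largest bid at which the estimate reaches a value\<close>

abbreviation nneq :: "nexp \<Rightarrow> nexp \<Rightarrow> bexp" where "nneq a b \<equiv> BNot (BAnd (NLe a b) (NLe b a))"

text \<open>The cost of \<open>i\<close> in \<open>e\<close> is 0. \<open>XP\<close> goes through all sets \<open>{a, b, d}\<close> of one to three sellers, from which
  Sviridenko's algorithm fills up only those with three.\<close>

definition SETUP :: com where
  "SETUP = CLEAR ''T'' ;; NSet ''T'' (At ''a'') (NConst 1) ;; NSet ''T'' (At ''b'') (NConst 1) ;;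
     NSet ''T'' (At ''d'') (NConst 1) ;;
     Cond (BAnd (nneq (At ''a'') (At ''b'')) (BAnd (nneq (At ''a'') (At ''d'')) (nneq (At ''b'') (At ''d''))))
       (COPY ''R'' ''A'' ;; NSet ''R'' (At ''i'') (NConst 0) ;; NSet ''R'' (At ''a'') (NConst 0) ;;
        NSet ''R'' (At ''b'') (NConst 0) ;; NSet ''R'' (At ''d'') (NConst 0) ;; NSet ''g'' (NConst 0) (NConst 1))
       (CLEAR ''R'' ;; NSet ''g'' (NConst 0) (NConst 0))"

definition INSERT_I :: com where
  "INSERT_I = CRIT ''T'' ''R'' ''Z'' ;; COPY ''X'' ''T'' ;; COPY ''Y'' ''R'' ;;
     NSet ''X'' (At ''i'') (NConst 1) ;; HX ;; CONTRIB ;; LUPD ;;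
     STEP ''T'' ''R'' (RLe (RLin (LAdd (Real ''K'') (LGet ''e'' (At ''j'')))) (RLin (Real ''B'')))"

definition OUTSIDE :: com where
  "OUTSIDE = SETP ''L'' (LGet ''c'' (At ''i'')) ;; NSet ''L'' (NConst 0) (NConst 0) ;;
     For_all ''t'' (Cond (member ''g'' (NConst 0)) INSERT_I Skip) ;;
     Query ''vT'' (NConst 0) ''T'' ;;
     Cond (BAnd (RLe (RLin (Real ''V'')) (RLin (Real ''vT'')))
         (RLe (price_exp ''M'') (RLin (LAdd (Real ''B'') (LConst 1)))))
       (SETP ''M'' (LAdd (Real ''B'') (LConst 1))) Skip"

definition INSIDE :: com where
  "INSIDE = COPY ''X'' ''T'' ;; COPY ''Y'' ''R'' ;; HX ;;
     Cond (BAnd (RLe (RLin (LGet ''c'' (At ''i''))) (RLin (Real ''H''))) (RLe (price_exp ''M'') (RLin (Real ''H''))))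
       (SETP ''M'' (Real ''H'')) Skip"

definition TRIPLE :: com where
  "TRIPLE = Cond (BAnd (member ''A'' (At ''a'')) (BAnd (member ''A'' (At ''b'')) (member ''A'' (At ''d''))))
     (SETUP ;; COST ''T'' ;;
      Cond (RLe (RLin (Real ''K'')) (RLin (Real ''B'')))
        (Cond (member ''T'' (At ''i'')) INSIDE OUTSIDE) Skip) Skip"

definition XP :: com where
  "XP = SETP ''M'' (LConst (- 1)) ;; For_all ''a'' (For_all ''b'' (For_all ''d'' TRIPLE))"

lemma mods_SETUP [simp]:
  "nmods SETUP = {''k'', ''T'', ''R'', ''g''}" "rmods SETUP = {}" "pay_free SETUP" "loops_ok SETUP"
  by (auto simp: SETUP_def)

lemma mods_INSERT_I [simp]:
  "nmods INSERT_I = {''k'', ''j'', ''h'', ''T'', ''R'', ''X'', ''Y'', ''Z'', ''L''}"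
  "rmods INSERT_I = {''vT'', ''vj'', ''vk'', ''F'', ''K'', ''H'', ''Z'', ''L'', ''M''}"
  "pay_free INSERT_I" "loops_ok INSERT_I"
  by (auto simp: INSERT_I_def)

lemma mods_OUTSIDE [simp]:
  "nmods OUTSIDE = {''t'', ''k'', ''j'', ''h'', ''T'', ''R'', ''X'', ''Y'', ''Z'', ''L''}"
  "rmods OUTSIDE = {''vT'', ''vj'', ''vk'', ''F'', ''K'', ''H'', ''Z'', ''L'', ''M''}"
  "pay_free OUTSIDE" "loops_ok OUTSIDE"
  "nmods INSIDE = {''k'', ''j'', ''h'', ''X'', ''Y''}"
  "rmods INSIDE = {''vT'', ''vj'', ''vk'', ''K'', ''H'', ''M''}"
  "pay_free INSIDE" "loops_ok INSIDE"
  by (auto simp: OUTSIDE_def INSIDE_def)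

lemma mods_TRIPLE [simp]:
  "nmods TRIPLE = {''t'', ''k'', ''j'', ''h'', ''g'', ''T'', ''R'', ''X'', ''Y'', ''Z'', ''L''}"
  "rmods TRIPLE = {''vT'', ''vj'', ''vk'', ''F'', ''K'', ''H'', ''Z'', ''L'', ''M''}"
  "pay_free TRIPLE" "loops_ok TRIPLE"
  by (auto simp: TRIPLE_def)

lemma mods_XP [simp]:
  "nmods XP = {''a'', ''b'', ''d'', ''t'', ''k'', ''j'', ''h'', ''g'', ''T'', ''R'', ''X'', ''Y'', ''Z'', ''L''}"
  "rmods XP = {''vT'', ''vj'', ''vk'', ''F'', ''K'', ''H'', ''Z'', ''L'', ''M''}"
  "pay_free XP" "loops_ok XP"
  by (auto simp: XP_def)

lemma card_1_3_iff: "finite U \<Longrightarrow> 1 \<le> card U \<and> card U \<le> 3 \<longleftrightarrow> (\<exists>a b d. U = {a, b, d})"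
proof
  assume U: "finite U" "1 \<le> card U \<and> card U \<le> 3"
  then consider "card U = 1" | "card U = 2" | "card U = 3" by linarith
  then show "\<exists>a b d. U = {a, b, d}"
  proof cases
    case 1
    then show ?thesis by (metis card_1_singletonE insert_absorb2)
  next
    case 2
    then show ?thesis by (metis card_2_iff insert_absorb2)
  next
    case 3
    then show ?thesis by (metis card_3_iff)
  qed
qed (auto simp: card_insert_if)

context machine
begin

text \<open>The part of the state that stays fixed while the bids of one seller are examined.\<close>

definition same :: "state \<Rightarrow> state \<Rightarrow> bool" where
  "same s u \<longleftrightarrow> nats u ''n'' = nats s ''n'' \<and> nats u ''i'' = nats s ''i'' \<and> nats u ''A'' = nats s ''A'' \<and>
     reals u ''e'' = reals s ''e'' \<and> reals u ''B'' = reals s ''B'' \<and> reals u ''V'' = reals s ''V'' \<and>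
     reals u ''c'' = reals s ''c''"

lemma same_refl: "same s s"
  by (simp add: same_def)

lemma same_run:
  assumes "same s u" "''n'' \<notin> nmods p" "''i'' \<notin> nmods p" "''A'' \<notin> nmods p"
    "''e'' \<notin> rmods p" "''B'' \<notin> rmods p" "''V'' \<notin> rmods p" "''c'' \<notin> rmods p"
  shows "same s (run p u)"
  using assms by (simp add: same_def nats_frame reals_frame)

lemma same_enter: "same s u \<Longrightarrow> x \<notin> {''n'', ''i'', ''A''} \<Longrightarrow> same s (enter x k u)"
  by (auto simp: same_def store_neq)

lemma same_costs_ok: "same s u \<Longrightarrow> costs_ok s \<Longrightarrow> costs_ok u"
  by (simp add: same_def costs_ok_def)

lemma price_enter: "price (enter x k s) y = price s y"
  by (simp add: price_def)

text \<open>One rule for the three nested loops over the starting sets: \<open>M\<close> represents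
  the union of the contributions, and \<open>Y\<close> names the counters of the outer loops, which
  the body must preserve.\<close>

lemma bids_loop:
  assumes "nats s ''n'' 0 = n" "same s0 s" "x \<notin> {''n'', ''i'', ''A''}" "x \<notin> nmods p"
    and p: "''n'' \<notin> nmods p" "''i'' \<notin> nmods p" "''A'' \<notin> nmods p"
      "''e'' \<notin> rmods p" "''B'' \<notin> rmods p" "''V'' \<notin> rmods p" "''c'' \<notin> rmods p"
    and Q: "\<And>y. y \<in> Y \<Longrightarrow> y \<noteq> x \<and> y \<notin> nmods p"
    and body: "\<And>k t E. \<lbrakk>k < n; same s0 t; nats t x 0 = k; \<And>y. y \<in> Y \<Longrightarrow> nats t y = nats s y;
        rep (price t ''M'') E\<rbrakk> \<Longrightarrow> rep (price (run p t) ''M'') (E \<union> C k)"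
    and M: "rep (price s ''M'') E"
  shows "rep (price (run (For_all x p) s) ''M'') (E \<union> (\<Union>k<n. C k))"
proof -
  have "same s0 (run (For_all x p) s) \<and> (\<forall>y\<in>Y. nats (run (For_all x p) s) y = nats s y) \<and>
      rep (price (run (For_all x p) s) ''M'') (E \<union> (\<Union>k<n. C k))"
  proof (rule For_rule[where P = "\<lambda>k t. same s0 t \<and> (\<forall>y\<in>Y. nats t y = nats s y) \<and>
      rep (price t ''M'') (E \<union> (\<Union>k<k. C k))"])
    show "same s0 s \<and> (\<forall>y\<in>Y. nats s y = nats s y) \<and> rep (price s ''M'') (E \<union> (\<Union>k<0. C k))"
      using assms(2) M by simp
    fix k t
    assume k: "k < n" and t: "same s0 t \<and> (\<forall>y\<in>Y. nats t y = nats s y) \<and> rep (price t ''M'') (E \<union> (\<Union>k<k. C k))"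
    let ?t = "enter x k t"
    have st: "same s0 ?t" using t assms(3) by (intro same_enter) auto
    have Y: "nats ?t y = nats s y" if "y \<in> Y" for y using t Q[OF that] that by (simp add: store_neq)
    have "rep (price (run p ?t) ''M'') ((E \<union> (\<Union>k<k. C k)) \<union> C k)"
      by (rule body[OF k st]) (use t Y in \<open>auto simp: store_eq price_enter\<close>)
    moreover have "(E \<union> (\<Union>k<k. C k)) \<union> C k = E \<union> (\<Union>k<Suc k. C k)" by (auto simp: less_Suc_eq)
    moreover have "nats (run p ?t) y = nats s y" if "y \<in> Y" for y
      using Y[OF that] Q[OF that] by (simp add: nats_frame)
    ultimately show "same s0 (run p ?t) \<and> (\<forall>y\<in>Y. nats (run p ?t) y = nats s y) \<and>
        rep (price (run p ?t) ''M'') (E \<union> (\<Union>k<Suc k. C k))"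
      using same_run[OF st p] by simp
  qed (use assms(1) in simp)
  then show ?thesis by blast
qed

lemma slack_le_budget:
  assumes "costs_ok s" "T \<subseteq> {..<n}" "R \<subseteq> {..<n}" "T \<inter> R = {}" "h \<in> slack (reals s ''e'') B V N T R"
  shows "h \<le> B"
proof -
  have e: "\<And>x. x \<in> T \<union> R \<Longrightarrow> 0 \<le> reals s ''e'' x" using assms(1-3) by (auto simp: costs_ok_def)
  then have "0 \<le> sum (reals s ''e'') T" by (intro sum_nonneg) auto
  moreover have "state_ok (T, R)" using assms(2-4) by (simp add: state_ok_def)
  ultimately show ?thesis using slack_le[OF _ e assms(5)] by fastforce
qed

text \<open>\<open>L\<close> bounds the bids that would have entered at an earlier state,
  \<open>Z\<close> those that enter now or earlier. So the bids that enter at this very state lie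
  between the two, and the slack after taking \<open>i\<close> cuts them off from above.\<close>

lemma INSERT_I_correct:
  assumes ok: "costs_ok s" and disj: "arr (nats s) ''T'' \<inter> arr (nats s) ''R'' = {}"
    and i: "nats s ''i'' 0 = i" "i < n" "i \<notin> arr (nats s) ''T''" "i \<notin> arr (nats s) ''R''"
    and L: "0 \<le> price s ''L''" and M: "rep (price s ''M'') E"
  defines "W \<equiv> (arr (nats s) ''T'', arr (nats s) ''R'')" and "e \<equiv> reals s ''e''" and "B \<equiv> reals s ''B'' 0"
    and "V \<equiv> reals s ''V'' 0" and "t \<equiv> run INSERT_I s"
  shows "(arr (nats t) ''T'', arr (nats t) ''R'') = gstep e (fits e B) W"
    and "0 \<le> x \<Longrightarrow> x \<le> B \<Longrightarrow> \<not> below x (price t ''L'') (nats t ''L'' 0 \<noteq> 0) \<longleftrightarrow>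
      \<not> below x (price s ''L'') (nats s ''L'' 0 \<noteq> 0) \<and> \<not> beats e i x W"
    and "0 \<le> price t ''L''"
    and "rep (price t ''M'') (E \<union> {x. 0 \<le> x \<and> \<not> below x (price s ''L'') (nats s ''L'' 0 \<noteq> 0) \<and> beats e i x W \<and>
      (\<exists>h\<in>slack e B V n (insert i (fst W)) (snd W). x \<le> h)})"
proof -
  let ?T = "arr (nats s) ''T''" and ?R = "arr (nats s) ''R''"
  define s1 where "s1 = run (CRIT ''T'' ''R'' ''Z'') s"
  define s2 where "s2 = run (COPY ''X'' ''T'') s1"
  define s3 where "s3 = run (COPY ''Y'' ''R'') s2"
  define s4 where "s4 = run (NSet ''X'' (At ''i'') (NConst 1)) s3"
  define s5 where "s5 = run HX s4"
  define s6 where "s6 = run CONTRIB s5"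
  define s7 where "s7 = run LUPD s6"
  have t: "t = run (STEP ''T'' ''R'' (RLe (RLin (LAdd (Real ''K'') (LGet ''e'' (At ''j'')))) (RLin (Real ''B'')))) s7"
    by (simp only: t_def INSERT_I_def run_simps s1_def s2_def s3_def s4_def s5_def s6_def s7_def)
  have sm1: "same s s1" unfolding s1_def by (rule same_run[OF same_refl]) simp_all
  have sm2: "same s s2" unfolding s2_def by (rule same_run[OF sm1]) simp_all
  have sm3: "same s s3" unfolding s3_def by (rule same_run[OF sm2]) simp_all
  have sm4: "same s s4" unfolding s4_def by (rule same_run[OF sm3]) simp_all
  have sm5: "same s s5" unfolding s5_def by (rule same_run[OF sm4]) simp_all
  have sm6: "same s s6" unfolding s6_def by (rule same_run[OF sm5]) simp_all
  have sm7: "same s s7" unfolding s7_def by (rule same_run[OF sm6]) simp_all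
  note crit = CRIT_correct[of s "''T''" "''R''" "''Z''" i, OF ok disj _ _ _ _ i, folded s1_def]
  have a1: "arr (nats s1) ''T'' = ?T" "arr (nats s1) ''R'' = ?R"
    using crit(1) by (simp_all add: s1_def arr_frame)
  have bt: "beats e i x W \<longleftrightarrow> below x (price s1 ''Z'') (nats s1 ''Z'' 0 \<noteq> 0)" if "0 \<le> x" "x \<le> B" for x
    using crit(3)[of x] that by (simp add: W_def e_def B_def)
  have n: "nats s ''n'' 0 = n" using ok by (simp add: costs_ok_def)
  have a2: "arr (nats s2) ''X'' = ?T" "arr (nats s2) ''T'' = ?T" "arr (nats s2) ''R'' = ?R"
    using COPY_arr[of s1 "''X''" "''T''"] n sm1 a1 by (simp_all add: s2_def arr_frame same_def)
  have a3: "arr (nats s3) ''X'' = ?T" "arr (nats s3) ''Y'' = ?R" "arr (nats s3) ''T'' = ?T" "arr (nats s3) ''R'' = ?R"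
    using COPY_arr[of s2 "''Y''" "''R''"] n sm2 a2 by (simp_all add: s3_def arr_frame same_def)
  have a4: "arr (nats s4) ''X'' = insert i ?T" "arr (nats s4) ''Y'' = ?R" "arr (nats s4) ''T'' = ?T" "arr (nats s4) ''R'' = ?R"
    using a3 sm3 i by (simp_all add: s4_def arr_store same_def)
  have disj4: "arr (nats s4) ''X'' \<inter> arr (nats s4) ''Y'' = {}" using a4 disj i by auto
  have H: "x \<le> reals s5 ''H'' 0 \<longleftrightarrow> (\<exists>h\<in>slack e B V n (insert i ?T) ?R. x \<le> h)" if "0 \<le> x" for x
    using HX_correct[OF same_costs_ok[OF sm4 ok] disj4 that] a4 sm4
    by (simp add: s5_def same_def e_def B_def V_def)
  have fr: "price s5 ''L'' = price s ''L''" "price s5 ''M'' = price s ''M''" "price s5 ''Z'' = price s1 ''Z''"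
    "nats s5 ''L'' = nats s ''L''" "nats s5 ''Z'' = nats s1 ''Z''"
    by (simp_all add: s1_def s2_def s3_def s4_def s5_def price_frame nats_frame price_def reals_frame store_neq)
  have a7: "arr (nats s7) ''T'' = ?T" "arr (nats s7) ''R'' = ?R"
    using a4 by (simp_all add: s5_def s6_def s7_def arr_frame)
  have "(arr (nats t) ''T'', arr (nats t) ''R'') =
      gstep (reals s7 ''e'') (fits e B) (arr (nats s7) ''T'', arr (nats s7) ''R'')"
    unfolding t using sm7 same_costs_ok[OF sm7 ok] a7 disj
    by (intro STEP_arr) (auto simp: fits_def e_def B_def same_def)
  then show "(arr (nats t) ''T'', arr (nats t) ''R'') = gstep e (fits e B) W"
    using a7 sm7 by (simp add: W_def e_def same_def)
  have fr7: "price t ''L'' = price s7 ''L''" "nats t ''L'' = nats s7 ''L''" "price t ''M'' = price s6 ''M''"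
    by (simp_all add: t s7_def price_frame nats_frame)
  have fr6: "price s6 ''L'' = price s ''L''" "nats s6 ''L'' = nats s ''L''"
    "price s6 ''Z'' = price s1 ''Z''" "nats s6 ''Z'' = nats s1 ''Z''"
    using fr by (simp_all add: s6_def price_frame nats_frame)
  show "\<not> below x (price t ''L'') (nats t ''L'' 0 \<noteq> 0) \<longleftrightarrow>
      \<not> below x (price s ''L'') (nats s ''L'' 0 \<noteq> 0) \<and> \<not> beats e i x W" if "0 \<le> x" "x \<le> B"
    unfolding fr7 bt[OF that] s7_def LUPD_correct(1)[of x s6] fr6 ..
  show "0 \<le> price t ''L''" using LUPD_correct(2)[of s6] L unfolding fr7 s7_def fr6 by linarith
  have hB: "h \<le> B" if "h \<in> slack e B V n (insert i ?T) ?R" for h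
    using slack_le_budget[of s "insert i ?T" ?R h B V n] ok that disj i arr_less by (auto simp: e_def)
  \<comment> \<open>\<open>L\<close> and the slacks keep \<open>x\<close> between 0 and
    \<open>B\<close>, the range in which the price in \<open>Z\<close> decides whether
    \<open>i\<close> beats the state.\<close>
  have set: "{x. \<not> below x (price s5 ''L'') (nats s5 ''L'' 0 \<noteq> 0) \<and>
      below x (price s5 ''Z'') (nats s5 ''Z'' 0 \<noteq> 0) \<and> x \<le> reals s5 ''H'' 0} =
    {x. 0 \<le> x \<and> \<not> below x (price s ''L'') (nats s ''L'' 0 \<noteq> 0) \<and> beats e i x W \<and>
      (\<exists>h\<in>slack e B V n (insert i (fst W)) (snd W). x \<le> h)}" (is "?l = ?r")
  proof (intro set_eqI iffI)
    fix x assume "x \<in> ?l"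
    then have x: "\<not> below x (price s ''L'') (nats s ''L'' 0 \<noteq> 0)"
      "below x (price s1 ''Z'') (nats s1 ''Z'' 0 \<noteq> 0)" "x \<le> reals s5 ''H'' 0" by (simp_all add: fr)
    then have x0: "0 \<le> x" using L by (auto simp: below_def)
    then obtain h where h: "h \<in> slack e B V n (insert i ?T) ?R" "x \<le> h" using H x(3) by blast
    then have "x \<le> B" using hB[OF h(1)] by linarith
    then show "x \<in> ?r" using x x0 h bt[OF x0] by (auto simp: W_def)
  next
    fix x assume x: "x \<in> ?r"
    then obtain h where h: "h \<in> slack e B V n (insert i ?T) ?R" "x \<le> h" by (auto simp: W_def)
    then have "x \<le> B" using hB[OF h(1)] by linarith
    then show "x \<in> ?l" using x h H[of x] bt[of x] by (auto simp: fr)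
  qed
  have "rep (price s6 ''M'') (E \<union> ?r)"
    using CONTRIB_correct[of s5 E, unfolded set, unfolded fr, folded s6_def, OF M L] .
  then show "rep (price t ''M'') (E \<union> ?r)" by (simp only: fr7)
qed


text \<open>\<open>L\<close> starts at the declared cost, so lower bids are never counted. The loop
  always makes \<open>n\<close> rounds: once the rivals are used up, every bid within the budget is
  below \<open>L\<close>, and the remaining rounds add nothing.\<close>

lemma OUTSIDE_correct:
  fixes s :: state
  defines "e \<equiv> reals s ''e''" and "B \<equiv> reals s ''B'' 0" and "V \<equiv> reals s ''V'' 0"
    and "i \<equiv> nats s ''i'' 0" and "A' \<equiv> arr (nats s) ''A''" and "U \<equiv> arr (nats s) ''T''"
  assumes ok: "costs_ok s" and U: "U \<subseteq> A'" "i \<in> A'" "i \<notin> U" and R: "arr (nats s) ''R'' = valued.rest A' i U"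
    and g: "nats s ''g'' 0 \<noteq> 0 \<longleftrightarrow> card U = 3" and lo: "0 \<le> reals s ''c'' i" and feas: "sum e U \<le> B"
    and M: "rep (price s ''M'') E"
  shows "rep (price (run OUTSIDE s) ''M'') (E \<union> valued.bids A' v e B n i (reals s ''c'' i) V U)"
proof -
  have A': "A' \<subseteq> {..<n}" unfolding A'_def by (rule arr_less)
  interpret VA: valued A' v using A' by (rule valued_subset)
  have i: "i < n" using U(2) A' by auto
  let ?lo = "reals s ''c'' i"
  let ?W = "VA.fill_state e B i U"
  let ?N = "\<lambda>k. if card U = 3 then {x. ?lo \<le> x \<and> (\<exists>t<k. (\<forall>s<t. \<not> beats e i x (?W s)) \<and> beats e i x (?W t) \<and>
      (\<exists>h\<in>slack e B V n (insert i (fst (?W t))) (snd (?W t)). x \<le> h))} else {}"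
  let ?body = "Cond (member ''g'' (NConst 0)) INSERT_I Skip"
  define u where "u = run (SETP ''L'' (LGet ''c'' (At ''i'')) ;; NSet ''L'' (NConst 0) (NConst 0)) s"
  define w where "w = run (For_all ''t'' ?body) u"
  define P where "P k t \<longleftrightarrow> same s t \<and> (arr (nats t) ''T'', arr (nats t) ''R'') = ?W k \<and>
      nats t ''g'' = nats s ''g'' \<and> 0 \<le> price t ''L'' \<and>
      (card U = 3 \<longrightarrow> (\<forall>x. 0 \<le> x \<and> x \<le> B \<longrightarrow> (\<not> below x (price t ''L'') (nats t ''L'' 0 \<noteq> 0) \<longleftrightarrow>
        ?lo \<le> x \<and> (\<forall>s<k. \<not> beats e i x (?W s))))) \<and>
      rep (price t ''M'') (E \<union> ?N k)" for k and t :: state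
  have okU: "VA.state_ok (U, VA.rest i U)" using U by (auto simp: VA.state_ok_def VA.rest_def)
  have okW: "VA.state_ok (?W k)" for k
    unfolding VA.fill_state_def by (rule VA.state_ok_run[OF okU])
  have iW: "i \<notin> fst (?W k)" "i \<notin> snd (?W k)" for k
    unfolding VA.fill_state_def using VA.run_avoids[OF okU, of i] U(3) by (auto simp: VA.rest_def)
  have "P n w"
    unfolding w_def
  proof (rule For_rule)
    have smu: "same s u" by (simp add: u_def same_def nats_SETP store_neq reals_frame)
    show "nval (At ''n'') u = n" using smu ok by (simp add: same_def costs_ok_def)
    have "price u ''L'' = ?lo" "nats u ''L'' 0 = 0" "price u ''M'' = price s ''M''"
      by (simp_all add: u_def SETP_def price_def store_eq store_neq i_def)
    moreover have "arr (nats u) ''T'' = U" "arr (nats u) ''R'' = VA.rest i U" "nats u ''g'' = nats s ''g''"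
      using R by (simp_all add: u_def nats_SETP arr_store store_neq U_def)
    moreover have "?N 0 = {}" by simp
    ultimately show "P 0 u"
      using smu lo M unfolding P_def by (auto simp: VA.fill_state_def below_def)
  next
    fix k t assume P: "P k t"
    define t0 where "t0 = enter ''t'' k t"
    have sm0: "same s t0" using P unfolding P_def t0_def by (intro same_enter) auto
    have t0: "arr (nats t0) ''T'' = fst (?W k)" "arr (nats t0) ''R'' = snd (?W k)" "nats t0 ''g'' = nats s ''g''"
      "price t0 ''L'' = price t ''L''" "nats t0 ''L'' = nats t ''L''" "price t0 ''M'' = price t ''M''"
      using P by (auto simp: P_def t0_def arr_store store_neq price_enter prod_eq_iff)
    have "P (Suc k) (run ?body t0)"
    proof (cases "card U = 3")
      case False
      then have "run ?body t0 = t0" using g t0(3) by simp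
      moreover have "?W l = (U, {})" for l
        using False by (simp add: VA.fill_state_def VA.rest_def VA.funpow_gstep_empty)
      ultimately show ?thesis using P False sm0 t0 by (simp add: P_def)
    next
      case True
      have "nats t0 ''g'' 0 \<noteq> 0" using True g t0(3) by simp
      then have "Suc 0 \<le> nats t0 ''g'' 0" by simp
      then have run: "run ?body t0 = run INSERT_I t0" by simp
      have it: "nats t0 ''i'' 0 = i" "reals t0 ''e'' = e" "reals t0 ''B'' 0 = B" "reals t0 ''V'' 0 = V"
        using sm0 by (simp_all add: same_def i_def e_def B_def V_def)
      have disj: "fst (?W k) \<inter> snd (?W k) = {}" using okW[of k] by (simp add: VA.state_ok_def)
      have sub: "fst (?W k) \<subseteq> {..<n}" "snd (?W k) \<subseteq> {..<n}"
        using okW[of k] A' by (auto simp: VA.state_ok_def)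
      note I = INSERT_I_correct[OF same_costs_ok[OF sm0 ok], of i, unfolded t0(1,2) it prod.collapse,
          OF disj refl i iW, unfolded t0(4-6)]
      have L0: "0 \<le> price t ''L''" and M0: "rep (price t ''M'') (E \<union> ?N k)" using P by (simp_all add: P_def)
      have Lk: "\<not> below x (price t ''L'') (nats t ''L'' 0 \<noteq> 0) \<longleftrightarrow>
        ?lo \<le> x \<and> (\<forall>s<k. \<not> beats e i x (?W s))" if "0 \<le> x" "x \<le> B" for x
        using P True that by (simp add: P_def)
      have hB: "h \<le> B" if "h \<in> slack e B V n (insert i (fst (?W k))) (snd (?W k))" for h
        using slack_le_budget[OF ok, of "insert i (fst (?W k))" "snd (?W k)" h B V n] that sub disj i iW
        by (auto simp: e_def)
      have set: "{x. 0 \<le> x \<and> \<not> below x (price t ''L'') (nats t ''L'' 0 \<noteq> 0) \<and> beats e i x (?W k) \<and>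
          (\<exists>h\<in>slack e B V n (insert i (fst (?W k))) (snd (?W k)). x \<le> h)} =
        {x. ?lo \<le> x \<and> (\<forall>s<k. \<not> beats e i x (?W s)) \<and> beats e i x (?W k) \<and>
          (\<exists>h\<in>slack e B V n (insert i (fst (?W k))) (snd (?W k)). x \<le> h)}"
        using Lk hB lo by (intro Collect_cong) (meson order_trans)
      have N: "?N (Suc k) = ?N k \<union> {x. ?lo \<le> x \<and> (\<forall>s<k. \<not> beats e i x (?W s)) \<and> beats e i x (?W k) \<and>
          (\<exists>h\<in>slack e B V n (insert i (fst (?W k))) (snd (?W k)). x \<le> h)}"
        using True by (auto simp: less_Suc_eq)
      have "rep (price (run INSERT_I t0) ''M'') (E \<union> ?N (Suc k))"
        using I(4)[OF L0 M0] unfolding set N by (simp only: Un_assoc)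
      moreover have "(arr (nats (run INSERT_I t0)) ''T'', arr (nats (run INSERT_I t0)) ''R'') = ?W (Suc k)"
        using I(1)[OF L0 M0] by (simp add: VA.fill_state_def)
      moreover have "same s (run INSERT_I t0)" by (rule same_run[OF sm0]) simp_all
      moreover have "nats (run INSERT_I t0) ''g'' = nats s ''g''" using t0(3) by (simp add: nats_frame)
      moreover have "\<not> below x (price (run INSERT_I t0) ''L'') (nats (run INSERT_I t0) ''L'' 0 \<noteq> 0) \<longleftrightarrow>
        ?lo \<le> x \<and> (\<forall>s<Suc k. \<not> beats e i x (?W s))" if "0 \<le> x" "x \<le> B" for x
        using I(2)[OF L0 M0 that] Lk[OF that] by (auto simp: less_Suc_eq)
      ultimately show ?thesis using I(3)[OF L0 M0] unfolding P_def run by blast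
    qed
    then show "P (Suc k) (run ?body (enter ''t'' k t))" by (simp only: t0_def)
  qed
  define z where "z = run (Query ''vT'' (NConst 0) ''T'') w"
  have z: "reals z ''vT'' 0 = v (fst (?W n))" "price z ''M'' = price w ''M''" "reals z ''B'' 0 = B" "reals z ''V'' 0 = V"
    using \<open>P n w\<close> by (auto simp: z_def P_def price_def store_eq store_neq same_def B_def V_def prod_eq_iff)
  have run: "run OUTSIDE s = run (Cond (BAnd (RLe (RLin (Real ''V'')) (RLin (Real ''vT'')))
         (RLe (price_exp ''M'') (RLin (LAdd (Real ''B'') (LConst 1)))))
       (SETP ''M'' (LAdd (Real ''B'') (LConst 1))) Skip) z"
    unfolding OUTSIDE_def z_def w_def u_def by (simp only: run_simps)
  have bv: "bval (BAnd (RLe (RLin (Real ''V'')) (RLin (Real ''vT'')))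
         (RLe (price_exp ''M'') (RLin (LAdd (Real ''B'') (LConst 1))))) z \<longleftrightarrow>
      V \<le> v (fst (?W n)) \<and> price z ''M'' \<le> B + 1"
    using z by (simp add: price_def)
  have M': "price (run OUTSIDE s) ''M'' = (if V \<le> v (fst (?W n)) then (if price w ''M'' \<le> B + 1 then B + 1 else price w ''M'')
      else price w ''M'')"
    unfolding run run_simps bv using z by (auto simp: price_SETP)
  have Mw: "rep (price w ''M'') (E \<union> ?N n)" using \<open>P n w\<close> by (simp add: P_def)
  have "0 \<le> e x" if "x \<in> U" for x
  proof -
    have "x < n" using that U(1) A' by auto
    then show ?thesis using ok by (simp add: costs_ok_def e_def)
  qed
  then have B0: "0 \<le> B" using feas sum_nonneg[of U e] by fastforce
  have bids: "VA.bids e B n i ?lo V U = ?N n \<union> {x. x = B + 1 \<and> V \<le> v (fst (?W n))}"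
    using feas U(3) by (auto simp: VA.bids_def)
  show ?thesis
  proof (cases "V \<le> v (fst (?W n))")
    case True
    have "rep (B + 1) {x. x = B + 1 \<and> V \<le> v (fst (?W n))}"
      using True B0 by (intro rep_greatest) auto
    from rep_if[OF Mw this] show ?thesis
      unfolding M' bids if_P[OF True] by (simp only: Un_assoc)
  next
    case False
    then show ?thesis using Mw unfolding M' bids if_not_P[OF False] by simp
  qed
qed

text \<open>With \<open>i\<close> among the starting sellers, its bid takes part in no comparison of
  ratios and only uses up budget; the bids that count form a closed interval, if there are
  any.\<close>

lemma INSIDE_correct:
  fixes s :: state
  defines "e \<equiv> reals s ''e''" and "B \<equiv> reals s ''B'' 0" and "V \<equiv> reals s ''V'' 0"
    and "i \<equiv> nats s ''i'' 0" and "A' \<equiv> arr (nats s) ''A''" and "U \<equiv> arr (nats s) ''T''"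
  assumes ok: "costs_ok s" and U: "i \<in> U" and R: "arr (nats s) ''R'' = valued.rest A' i U"
    and lo: "0 \<le> reals s ''c'' i" and feas: "sum e U \<le> B" and M: "rep (price s ''M'') E"
  shows "rep (price (run INSIDE s) ''M'') (E \<union> valued.bids A' v e B n i (reals s ''c'' i) V U)"
proof -
  have A': "A' \<subseteq> {..<n}" unfolding A'_def by (rule arr_less)
  interpret VA: valued A' v using A' by (rule valued_subset)
  let ?lo = "reals s ''c'' i" and ?R = "VA.rest i U"
  define s1 where "s1 = run (COPY ''X'' ''T'') s"
  define s2 where "s2 = run (COPY ''Y'' ''R'') s1"
  define s3 where "s3 = run HX s2"
  have n: "nats s ''n'' 0 = n" using ok by (simp add: costs_ok_def)
  have sm1: "same s s1" unfolding s1_def by (rule same_run[OF same_refl]) simp_all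
  have sm2: "same s s2" unfolding s2_def by (rule same_run[OF sm1]) simp_all
  have sm3: "same s s3" unfolding s3_def by (rule same_run[OF sm2]) simp_all
  have a1: "arr (nats s1) ''X'' = U" "arr (nats s1) ''R'' = ?R"
    using COPY_arr[of s "''X''" "''T''"] n R by (simp_all add: s1_def arr_frame U_def)
  have a2: "arr (nats s2) ''X'' = U" "arr (nats s2) ''Y'' = ?R"
    using COPY_arr[of s1 "''Y''" "''R''"] n sm1 a1 by (simp_all add: s2_def arr_frame same_def)
  have disj: "arr (nats s2) ''X'' \<inter> arr (nats s2) ''Y'' = {}" unfolding a2 by (auto simp: VA.rest_def)
  have H: "x \<le> reals s3 ''H'' 0 \<longleftrightarrow> (\<exists>h\<in>slack e B V n U ?R. x \<le> h)" if "0 \<le> x" for x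
    using HX_correct[OF same_costs_ok[OF sm2 ok] disj that] a2 sm2
    by (simp add: s3_def same_def e_def B_def V_def)
  have Ms: "price s3 ''M'' = price s ''M''" by (simp add: s1_def s2_def s3_def price_frame)
  let ?h = "reals s3 ''H'' 0"
  have run: "run INSIDE s = run (Cond (BAnd (RLe (RLin (LGet ''c'' (At ''i''))) (RLin (Real ''H''))) (RLe (price_exp ''M'') (RLin (Real ''H''))))
       (SETP ''M'' (Real ''H'')) Skip) s3"
    unfolding INSIDE_def s3_def s2_def s1_def by (simp only: run_simps)
  have bv: "bval (BAnd (RLe (RLin (LGet ''c'' (At ''i''))) (RLin (Real ''H''))) (RLe (price_exp ''M'') (RLin (Real ''H'')))) s3
      \<longleftrightarrow> ?lo \<le> ?h \<and> price s3 ''M'' \<le> ?h"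
    using sm3 by (simp add: same_def i_def price_def)
  have M': "price (run INSIDE s) ''M'' = (if ?lo \<le> ?h then (if price s ''M'' \<le> ?h then ?h else price s ''M'') else price s ''M'')"
    unfolding run run_simps bv using Ms by (auto simp: price_SETP)
  have bids: "VA.bids e B n i ?lo V U = {x. ?lo \<le> x \<and> x \<le> ?h}"
    using feas U H lo by (auto simp: VA.bids_def)
  show ?thesis
  proof (cases "?lo \<le> ?h")
    case True
    have "rep ?h {x. ?lo \<le> x \<and> x \<le> ?h}" using True lo by (intro rep_greatest) auto
    from rep_if[OF M this] show ?thesis unfolding M' bids if_P[OF True] .
  next
    case False
    then have "{x. ?lo \<le> x \<and> x \<le> ?h} = {}" by auto
    then show ?thesis using M unfolding M' bids if_not_P[OF False] by (simp only: Un_empty_right)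
  qed
qed

lemma SETUP_correct:
  fixes s :: state
  defines "A' \<equiv> arr (nats s) ''A''" and "i \<equiv> nats s ''i'' 0"
    and "U \<equiv> {nats s ''a'' 0, nats s ''b'' 0, nats s ''d'' 0}" and "t \<equiv> run SETUP s"
  assumes n: "nats s ''n'' 0 = n" and U: "U \<subseteq> {..<n}"
  shows "arr (nats t) ''T'' = U" "arr (nats t) ''R'' = valued.rest A' i U"
    "nats t ''g'' 0 \<noteq> 0 \<longleftrightarrow> card U = 3"
proof -
  have A': "A' \<subseteq> {..<n}" unfolding A'_def by (rule arr_less)
  interpret VA: valued A' v using A' by (rule valued_subset)
  let ?a = "nats s ''a'' 0" and ?b = "nats s ''b'' 0" and ?d = "nats s ''d'' 0"
  let ?c = "?a \<noteq> ?b \<and> ?a \<noteq> ?d \<and> ?b \<noteq> ?d"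
  define s1 where "s1 = run (CLEAR ''T'' ;; NSet ''T'' (At ''a'') (NConst 1) ;; NSet ''T'' (At ''b'') (NConst 1) ;;
     NSet ''T'' (At ''d'') (NConst 1)) s"
  have clear: "arr (nats (run (CLEAR ''T'') s)) ''T'' = {}" using CLEAR_arr[of s "''T''"] n by simp
  have fr: "nats (run (CLEAR ''T'') s) x = nats s x" if "x \<noteq> ''k''" "x \<noteq> ''T''" for x
    using that by (simp add: nats_frame)
  have T1: "arr (nats s1) ''T'' = U"
    using clear U fr by (auto simp: s1_def arr_store store_neq U_def)
  have fr1: "nats s1 x = nats s x" if "x \<noteq> ''k''" "x \<noteq> ''T''" for x
    using that by (simp add: s1_def fr store_neq)
  have n1: "nats s1 ''n'' 0 = n" and abd: "nats s1 ''a'' = nats s ''a''" "nats s1 ''b'' = nats s ''b''"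
    "nats s1 ''d'' = nats s ''d''"
    using n fr1 by simp_all
  have c: "bval (BAnd (nneq (At ''a'') (At ''b'')) (BAnd (nneq (At ''a'') (At ''d'')) (nneq (At ''b'') (At ''d'')))) s1 \<longleftrightarrow> ?c"
    unfolding bval.simps nval.simps abd by arith
  have run: "t = (if ?c then run (COPY ''R'' ''A'' ;; NSet ''R'' (At ''i'') (NConst 0) ;; NSet ''R'' (At ''a'') (NConst 0) ;;
        NSet ''R'' (At ''b'') (NConst 0) ;; NSet ''R'' (At ''d'') (NConst 0) ;; NSet ''g'' (NConst 0) (NConst 1)) s1
      else run (CLEAR ''R'' ;; NSet ''g'' (NConst 0) (NConst 0)) s1)"
    unfolding t_def SETUP_def c[symmetric] s1_def by (simp only: run_simps)
  have card: "card U = 3 \<longleftrightarrow> ?c" by (auto simp: U_def card_insert_if)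
  have frC: "nats (run (COPY ''R'' ''A'') s1) x = nats s x" if "x \<notin> {''k'', ''R'', ''T''}" for x
    using that fr1 by (simp add: nats_frame)
  have "arr (nats (run (COPY ''R'' ''A'') s1)) ''R'' = A'"
    using COPY_arr[of s1 "''R''" "''A''"] n1 fr1 by (simp add: A'_def arr_def)
  moreover have "arr (nats (run (CLEAR ''R'') s1)) ''R'' = {}" using CLEAR_arr[of s1 "''R''"] n1 by simp
  ultimately have "arr (nats t) ''R'' = (if ?c then A' - {i} - U else {})"
    unfolding run using frC by (auto simp: arr_store store_neq U_def i_def)
  then show "arr (nats t) ''R'' = VA.rest i U" unfolding VA.rest_def card .
  show "arr (nats t) ''T'' = U" unfolding run using T1 by (simp add: arr_store arr_frame)
  show "nats t ''g'' 0 \<noteq> 0 \<longleftrightarrow> card U = 3" unfolding run card by (simp add: store_eq)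
qed

lemma TRIPLE_correct:
  fixes s :: state
  defines "e \<equiv> reals s ''e''" and "B \<equiv> reals s ''B'' 0" and "V \<equiv> reals s ''V'' 0"
    and "i \<equiv> nats s ''i'' 0" and "A' \<equiv> arr (nats s) ''A''"
    and "U \<equiv> {nats s ''a'' 0, nats s ''b'' 0, nats s ''d'' 0}"
  assumes ok: "costs_ok s" and i: "i \<in> A'" and U: "U \<subseteq> {..<n}"
    and lo: "0 \<le> reals s ''c'' i" and M: "rep (price s ''M'') E"
  shows "rep (price (run TRIPLE s) ''M'')
    (E \<union> (if U \<subseteq> A' then valued.bids A' v e B n i (reals s ''c'' i) V U else {}))"
proof (cases "U \<subseteq> A'")
  case False
  then have "run TRIPLE s = s" using U by (auto simp: TRIPLE_def A'_def U_def arr_def)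
  then show ?thesis using M False by simp
next
  case True
  have A': "A' \<subseteq> {..<n}" unfolding A'_def by (rule arr_less)
  interpret VA: valued A' v using A' by (rule valued_subset)
  define s1 where "s1 = run SETUP s"
  define s2 where "s2 = run (COST ''T'') s1"
  have n: "nats s ''n'' 0 = n" using ok by (simp add: costs_ok_def)
  note su = SETUP_correct[of s, folded s1_def, folded U_def A'_def i_def, OF n U]
  have sm1: "same s s1" unfolding s1_def by (rule same_run[OF same_refl]) simp_all
  have sm2: "same s s2" unfolding s2_def by (rule same_run[OF sm1]) simp_all
  have K: "reals s2 ''K'' 0 = sum e U"
    using COST_arr[of s1 "''T''"] n sm1 su(1) by (simp add: s2_def same_def e_def)
  have s2: "arr (nats s2) ''T'' = U" "arr (nats s2) ''R'' = VA.rest i U" "nats s2 ''g'' 0 \<noteq> 0 \<longleftrightarrow> card U = 3"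
    "price s2 ''M'' = price s ''M''"
    using su by (simp_all add: s2_def s1_def arr_frame nats_frame price_frame)
  have eqs: "reals s2 ''e'' = e" "reals s2 ''B'' 0 = B" "reals s2 ''V'' 0 = V" "nats s2 ''i'' 0 = i"
    "arr (nats s2) ''A'' = A'" "reals s2 ''c'' = reals s ''c''"
    using sm2 by (simp_all add: same_def e_def B_def V_def i_def A'_def arr_def)
  have ok2: "costs_ok s2" by (rule same_costs_ok[OF sm2 ok])
  have run: "run TRIPLE s = run (Cond (RLe (RLin (Real ''K'')) (RLin (Real ''B'')))
        (Cond (member ''T'' (At ''i'')) INSIDE OUTSIDE) Skip) s2"
    using True by (auto simp: TRIPLE_def s2_def s1_def U_def A'_def arr_def)
  have mem: "bval (member ''T'' (At ''i'')) s2 \<longleftrightarrow> i \<in> U"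
    using s2(1) i A' eqs(4) by (auto simp: arr_def)
  show ?thesis
  proof (cases "sum e U \<le> B")
    case False
    then have "run TRIPLE s = s2" unfolding run using K eqs by simp
    then show ?thesis using False M s2(4) True by (simp add: VA.bids_def)
  next
    case feas: True
    show ?thesis
    proof (cases "i \<in> U")
      case iU: True
      have "run TRIPLE s = run INSIDE s2" unfolding run run_simps(7) using mem iU K eqs feas by simp
      then show ?thesis
        using INSIDE_correct[of s2 E, unfolded eqs s2, OF ok2 iU refl lo feas M] True by simp
    next
      case iU: False
      have "run TRIPLE s = run OUTSIDE s2" unfolding run run_simps(7) using mem iU K eqs feas by simp
      then show ?thesis
        using OUTSIDE_correct[of s2 E, unfolded eqs s2(1,2,4), OF ok2 True i iU refl s2(3) lo feas M] True by simp
    qed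
  qed
qed

text \<open>A set is met once for each way of writing it as \<open>{a, b, d}\<close>; repetitions do
  not change a maximum.\<close>

lemma XP_correct:
  fixes s :: state
  defines "e \<equiv> reals s ''e''" and "B \<equiv> reals s ''B'' 0" and "V \<equiv> reals s ''V'' 0"
    and "i \<equiv> nats s ''i'' 0" and "A' \<equiv> arr (nats s) ''A''"
  assumes ok: "costs_ok s" and i: "i \<in> A'" and lo: "0 \<le> reals s ''c'' i"
  shows "rep (price (run XP s) ''M'')
    {x. \<exists>U\<subseteq>A'. 1 \<le> card U \<and> card U \<le> 3 \<and> x \<in> valued.bids A' v e B n i (reals s ''c'' i) V U}"
proof -
  have A': "A' \<subseteq> {..<n}" unfolding A'_def by (rule arr_less)
  let ?C = "\<lambda>U. if U \<subseteq> A' then valued.bids A' v e B n i (reals s ''c'' i) V U else {}"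
  define s1 where "s1 = run (SETP ''M'' (LConst (- 1))) s"
  have sm: "same s s1" unfolding s1_def by (rule same_run[OF same_refl]) simp_all
  have M1: "rep (price s1 ''M'') {}" by (simp add: s1_def price_SETP rep_empty)
  have n: "nats t ''n'' 0 = n" if "same s t" for t
    using same_costs_ok[OF that ok] by (simp add: costs_ok_def)
  have triple: "rep (price (run TRIPLE t) ''M'') (E \<union> ?C {a, b, d})"
    if "a < n" "b < n" "d < n" "same s t" "nats t ''a'' 0 = a" "nats t ''b'' 0 = b" "nats t ''d'' 0 = d"
      "rep (price t ''M'') E" for a b d t E
  proof -
    have eqs: "reals t ''e'' = e" "reals t ''B'' 0 = B" "reals t ''V'' 0 = V" "nats t ''i'' 0 = i"
      "arr (nats t) ''A'' = A'" "reals t ''c'' = reals s ''c''"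
      using that(4) by (simp_all add: same_def e_def B_def V_def i_def A'_def arr_def)
    show ?thesis
      using TRIPLE_correct[of t E, unfolded eqs that(5-7), OF same_costs_ok[OF that(4) ok] i _ lo that(8)] that(1-3)
      by blast
  qed
  have d_loop: "rep (price (run (For_all ''d'' TRIPLE) t) ''M'') (E \<union> (\<Union>d<n. ?C {a, b, d}))"
    if "a < n" "b < n" "same s t" "nats t ''a'' 0 = a" "nats t ''b'' 0 = b" "rep (price t ''M'') E" for a b t E
  proof (rule bids_loop[where Y = "{''a'', ''b''}" and ?s0.0 = s, OF n[OF that(3)] that(3)])
    fix d u F
    assume u: "d < n" "same s u" "nats u ''d'' 0 = d" "\<And>y. y \<in> {''a'', ''b''} \<Longrightarrow> nats u y = nats t y"
      "rep (price u ''M'') F"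
    have "nats u ''a'' 0 = a" "nats u ''b'' 0 = b" using that u(4) by simp_all
    then show "rep (price (run TRIPLE u) ''M'') (F \<union> ?C {a, b, d})"
      by (rule triple[OF that(1,2) u(1,2) _ _ u(3,5)])
  qed (use that in auto)
  have b_loop: "rep (price (run (For_all ''b'' (For_all ''d'' TRIPLE)) t) ''M'')
      (E \<union> (\<Union>b<n. \<Union>d<n. ?C {a, b, d}))"
    if "a < n" "same s t" "nats t ''a'' 0 = a" "rep (price t ''M'') E" for a t E
  proof (rule bids_loop[where Y = "{''a''}" and ?s0.0 = s, OF n[OF that(2)] that(2)])
    fix b u F
    assume u: "b < n" "same s u" "nats u ''b'' 0 = b" "\<And>y. y \<in> {''a''} \<Longrightarrow> nats u y = nats t y"
      "rep (price u ''M'') F"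
    have "nats u ''a'' 0 = a" using that u(4) by simp
    then show "rep (price (run (For_all ''d'' TRIPLE) u) ''M'') (F \<union> (\<Union>d<n. ?C {a, b, d}))"
      by (rule d_loop[OF that(1) u(1,2) _ u(3,5)])
  qed (use that in auto)
  have a_loop: "rep (price (run (For_all ''a'' (For_all ''b'' (For_all ''d'' TRIPLE))) s1) ''M'')
      ({} \<union> (\<Union>a<n. \<Union>b<n. \<Union>d<n. ?C {a, b, d}))"
  proof (rule bids_loop[where Y = "{}" and ?s0.0 = s, OF n[OF sm] sm])
    fix a u F
    assume "a < n" "same s u" "nats u ''a'' 0 = a" "rep (price u ''M'') F"
    then show "rep (price (run (For_all ''b'' (For_all ''d'' TRIPLE)) u) ''M'')
        (F \<union> (\<Union>b<n. \<Union>d<n. ?C {a, b, d}))"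
      by (rule b_loop)
  qed (use M1 in auto)
  moreover have "{} \<union> (\<Union>a<n. \<Union>b<n. \<Union>d<n. ?C {a, b, d}) =
      {x. \<exists>U\<subseteq>A'. 1 \<le> card U \<and> card U \<le> 3 \<and> x \<in> valued.bids A' v e B n i (reals s ''c'' i) V U}"
    (is "?l = ?r")
  proof (intro set_eqI iffI)
    fix x assume "x \<in> ?l"
    then obtain a b d where "x \<in> ?C {a, b, d}" by blast
    then have "{a, b, d} \<subseteq> A' \<and> x \<in> valued.bids A' v e B n i (reals s ''c'' i) V {a, b, d}"
      by (auto split: if_splits)
    moreover have "1 \<le> card {a, b, d} \<and> card {a, b, d} \<le> 3"
      using card_1_3_iff[of "{a, b, d}"] by blast
    ultimately show "x \<in> ?r" by blast
  next
    fix x assume "x \<in> ?r"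
    then obtain U where U: "U \<subseteq> A'" "1 \<le> card U" "card U \<le> 3"
      "x \<in> valued.bids A' v e B n i (reals s ''c'' i) V U" by blast
    have "finite U" using U(2) card.infinite by fastforce
    then obtain a b d where abd: "U = {a, b, d}" using card_1_3_iff[of U] U by blast
    then have "a < n" "b < n" "d < n" using U(1) A' by auto
    moreover have "x \<in> ?C {a, b, d}" using U abd by simp
    ultimately show "x \<in> ?l" by blast
  qed
  moreover have "run XP s = run (For_all ''a'' (For_all ''b'' (For_all ''d'' TRIPLE))) s1"
    unfolding XP_def s1_def by (simp only: run_simps)
  ultimately show ?thesis by simp
qed

end

section \<open>Irrelevance of the costs of other agents\<close>

context valued
begin

text \<open>Costs are functions on all of the type, but the machine holds 0 for indices that are not
  sellers. The congruences from here on show that the mechanism cannot tell the difference.\<close>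

lemma run_cong:
  assumes "state_ok s" "\<And>x. x \<in> A \<Longrightarrow> c x = d x" "\<And>T j. T \<subseteq> A \<Longrightarrow> j \<in> A \<Longrightarrow> acc T j = acc' T j"
  shows "(gstep c acc ^^ k) s = (gstep d acc' ^^ k) s"
proof (induction k)
  case (Suc k)
  obtain T R where TR: "(gstep d acc' ^^ k) s = (T, R)" by force
  have ok: "state_ok (T, R)" using state_ok_run[OF assms(1), where c = d and acc = acc' and k = k] by (simp add: TR)
  have sub: "T \<subseteq> A" "R \<subseteq> A" "finite R" using state_okD[OF ok] by auto
  have best: "best_item v c T R = best_item v d T R"
    using sub assms(2) by (intro best_item_cong) auto
  have "R \<noteq> {} \<Longrightarrow> best_item v d T R \<in> A" using best_item_in[OF sub(3)] sub by blast
  then have "gstep c acc (T, R) = gstep d acc' (T, R)"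
    using best assms(3)[OF sub(1)] by (simp add: gstep_def Let_def)
  then show ?case using Suc TR by simp
qed simp

lemma sviridenko_cong:
  assumes "0 \<le> B" "\<And>x. x \<in> A \<Longrightarrow> c x = d x"
  shows "sviridenko v B A c = sviridenko v B A d"
proof -
  have sum: "sum c S = sum d S" if "S \<subseteq> A" for S using that assms(2) by (intro sum.cong) auto
  have "filled c B U (A - U) = filled d B U (A - U)" if "U \<subseteq> A" for U
    unfolding filled_def using that sum assms(2)
    by (subst run_cong[of _ c d "fits c B" "fits d B"]) (auto simp: state_ok_def fits_def)
  then have "V \<le> sviridenko v B A c \<longleftrightarrow> V \<le> sviridenko v B A d" for V
    unfolding sviridenko_ge_iff[OF assms(1)] using sum by auto
  then show ?thesis by (meson antisym order_refl)
qed

lemma affordable_cong: "(\<And>x. x \<in> A \<Longrightarrow> c x = d x) \<Longrightarrow> affordable B A c = affordable B A d"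
  by (auto simp: affordable_def)

lemma heads_sviridenko_cong:
  assumes "0 \<le> B" "\<And>x. x \<in> A \<Longrightarrow> c x = d x"
  shows "heads_alloc (sviridenko v B) v B A c = heads_alloc (sviridenko v B) v B A d"
proof -
  have A': "affordable B A c = affordable B A d" using assms(2) by (rule affordable_cong)
  let ?A = "affordable B A d"
  interpret V: valued ?A v by (rule valued_affordable)
  have eq: "c x = d x" if "x \<in> ?A" for x using that assms(2) affordable_subset[of B A d] by auto
  have st: "V.greedy_state c ?A k = V.greedy_state d ?A k" for k
    unfolding V.greedy_state_def using eq by (intro V.run_cong) (auto simp: V.state_ok_def)
  have pre: "greedy_prefix v c ?A k = greedy_prefix v d ?A k" if "k \<le> card ?A" for k
    using V.greedy_state_eq_prefix[OF that, of c] V.greedy_state_eq_prefix[OF that, of d] st[of k] by simp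
  have item: "greedy_item v c ?A k = greedy_item v d ?A k" if "k < card ?A" for k
    unfolding greedy_item_def pre[OF less_imp_le[OF that]] using eq by (intro best_item_cong) auto
  have orc: "sviridenko v B ?A (c(i := x)) = sviridenko v B ?A (d(i := x))" for i x
    using eq assms(1) by (intro V.sviridenko_cong) auto
  have "i \<in> modified_greedy_om (sviridenko v B) (1/2) v ?A c \<longleftrightarrow>
      i \<in> modified_greedy_om (sviridenko v B) (1/2) v ?A d" for i
  proof -
    have "(i = greedy_item v c ?A k \<and> v (greedy_prefix v c ?A (Suc k)) \<le> 1/2 * (SUP x\<in>{c i..}. sviridenko v B ?A (c(i := x))))
      \<longleftrightarrow> (i = greedy_item v d ?A k \<and> v (greedy_prefix v d ?A (Suc k)) \<le> 1/2 * (SUP x\<in>{d i..}. sviridenko v B ?A (d(i := x))))"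
      if k: "k < card ?A" for k
      unfolding orc item[OF k] pre[OF Suc_leI[OF k]]
      using eq V.greedy_item_in[OF k, of d] by auto
    then show ?thesis unfolding modified_greedy_om_def mem_Collect_eq by metis
  qed
  then show ?thesis unfolding heads_alloc_def A' by auto
qed

lemma tails_cong:
  assumes "\<And>x. x \<in> A \<Longrightarrow> c x = d x"
  shows "tails_alloc v B A c = tails_alloc v B A d"
  using affordable_cong[OF assms] by (simp add: tails_alloc_def)

end

lemma threshold_payment_cong:
  assumes "\<And>c d. (\<And>x. x \<in> A \<Longrightarrow> c x = d x) \<Longrightarrow> f c = f d" "\<And>x. x \<in> A \<Longrightarrow> c x = d x"
  shows "threshold_payment f c i = threshold_payment f d i"
proof -
  have "f c = f d" using assms by blast
  moreover have "f (c(i := b)) = f (d(i := b))" for b using assms(2) by (intro assms(1)) simp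
  ultimately show ?thesis by (simp add: threshold_payment_def)
qed

section \<open>The program\<close>

text \<open>The minimum of \<open>rep_min\<close>, computed by copying triples, since their values
  may be compared but not stored.\<close>

definition PAYUPD :: com where
  "PAYUPD = SETP ''N'' (Real ''B'') ;;
     Cond (RLe (price_exp ''W'') (price_exp ''N'')) (COPYP ''N'' ''W'') Skip ;;
     Cond (RLe (price_exp ''M'') (price_exp ''N'')) (COPYP ''N'' ''M'') Skip ;;
     Cond (RLe (price_exp ''P'') (price_exp ''N'')) (COPYP ''P'' ''N'') Skip"

text \<open>A half cannot be stored, so the value test asks for an estimate of
  \<open>V = F + F\<close>. The state contributes exactly if \<open>i\<close> beats it at the true
  cost and some bid makes the estimate reach \<open>V\<close>.\<close>

definition ROUND :: com where
  "ROUND = CRIT ''S'' ''Q'' ''W'' ;; LSet ''V'' (NConst 0) (LAdd (Real ''F'') (Real ''F'')) ;; XP ;;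
     Cond (BAnd (BOr (rless (RLin (LGet ''c'' (At ''i''))) (price_exp ''W''))
           (BAnd (RLe (RLin (LGet ''c'' (At ''i''))) (price_exp ''W'')) (member ''W'' (NConst 0))))
         (RLe (RLin (LConst 0)) (price_exp ''M'')))
       PAYUPD Skip ;;
     STEP ''S'' ''Q'' (NLe (NConst 0) (NConst 0))"

definition BEGIN :: com where
  "BEGIN = For_all ''k'' (LSet ''e'' (At ''k'') (LGet ''c'' (At ''k''))) ;; LSet ''e'' (At ''i'') (LConst 0) ;;
     COPY ''Q'' ''A'' ;; NSet ''Q'' (At ''i'') (NConst 0) ;; CLEAR ''S'' ;; SETP ''P'' (LConst (- 1))"

definition SELLER :: com where
  "SELLER = BEGIN ;; For_all ''s'' ROUND ;;
     Cond (RLe (RLin (LConst 0)) (price_exp ''P''))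
       (NSet ''win'' (At ''i'') (NConst 1) ;; Pay (At ''i'') (price_exp ''P'')) Skip"

definition HEADS :: com where
  "HEADS = For_all ''i'' (Cond (member ''A'' (At ''i'')) SELLER Skip)"

definition TAILS :: com where
  "TAILS = For_all ''k'' (LSet ''e'' (At ''k'') (LConst 1)) ;; CLEAR ''T'' ;; COPY ''R'' ''A'' ;; BEST ''T'' ''R'' ;;
     Cond (member ''j'' (NConst 1)) (NSet ''win'' (At ''j'') (NConst 1) ;; Pay (At ''j'') (RLin (Real ''B''))) Skip"

definition AFFORD :: com where
  "AFFORD = For_all ''k'' (Cond (RLe (RLin (LGet ''c'' (At ''k''))) (RLin (Real ''B'')))
     (NSet ''A'' (At ''k'') (NConst 1)) Skip)"

definition MECHANISM :: com where
  "MECHANISM = AFFORD ;; Cond (member ''coin'' (NConst 0)) HEADS TAILS"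

lemma mods_PAYUPD [simp]:
  "nmods PAYUPD = {}" "rmods PAYUPD = {''N'', ''P''}" "pay_free PAYUPD" "loops_ok PAYUPD"
  "nmods BEGIN = {''k'', ''Q'', ''S''}" "rmods BEGIN = {''e'', ''P''}" "pay_free BEGIN" "loops_ok BEGIN"
  by (auto simp: PAYUPD_def BEGIN_def)

lemma mods_ROUND [simp]:
  "nmods ROUND = {''a'', ''b'', ''d'', ''t'', ''k'', ''j'', ''h'', ''g'', ''T'', ''R'', ''X'', ''Y'', ''Z'', ''L'', ''W'', ''S'', ''Q''}"
  "rmods ROUND = {''vT'', ''vj'', ''vk'', ''F'', ''K'', ''H'', ''Z'', ''L'', ''M'', ''W'', ''V'', ''N'', ''P''}"
  "pay_free ROUND" "loops_ok ROUND"
  by (auto simp: ROUND_def)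

lemma loops_ok_MECHANISM: "loops_ok MECHANISM"
  by (simp add: MECHANISM_def HEADS_def TAILS_def SELLER_def AFFORD_def)

lemma n_MECHANISM: "''n'' \<notin> nmods MECHANISM"
  by (simp add: MECHANISM_def HEADS_def TAILS_def SELLER_def AFFORD_def)

context machine
begin

lemma PAYUPD_correct:
  fixes s :: state
  defines "m \<equiv> min (reals s ''B'' 0) (min (price s ''W'') (price s ''M''))"
  shows "price (run PAYUPD s) ''P'' = (if price s ''P'' \<le> m then m else price s ''P'')"
proof -
  define s1 where "s1 = run (SETP ''N'' (Real ''B'')) s"
  define s2 where "s2 = run (Cond (RLe (price_exp ''W'') (price_exp ''N'')) (COPYP ''N'' ''W'') Skip) s1"
  define s3 where "s3 = run (Cond (RLe (price_exp ''M'') (price_exp ''N'')) (COPYP ''N'' ''M'') Skip) s2"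
  have run: "run PAYUPD s = run (Cond (RLe (price_exp ''P'') (price_exp ''N'')) (COPYP ''P'' ''N'') Skip) s3"
    unfolding PAYUPD_def s1_def s2_def s3_def by (simp only: run_simps)
  have bv: "bval (RLe (price_exp x) (price_exp y)) t \<longleftrightarrow> price t x \<le> price t y" for x y t
    by (simp add: price_def)
  have 1: "price s1 ''N'' = reals s ''B'' 0" by (simp add: s1_def price_SETP)
  have 2: "price s2 ''N'' = (if price s1 ''W'' \<le> price s1 ''N'' then price s1 ''W'' else price s1 ''N'')"
    unfolding s2_def run_simps bv by (simp add: price_COPYP)
  have 3: "price s3 ''N'' = (if price s2 ''M'' \<le> price s2 ''N'' then price s2 ''M'' else price s2 ''N'')"
    unfolding s3_def run_simps bv by (simp add: price_COPYP)
  have 4: "price (run PAYUPD s) ''P'' = (if price s3 ''P'' \<le> price s3 ''N'' then price s3 ''N'' else price s3 ''P'')"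
    unfolding run run_simps bv by (simp add: price_COPYP)
  have "price s1 ''W'' = price s ''W''" "price s2 ''M'' = price s ''M''" "price s3 ''P'' = price s ''P''"
    by (simp_all add: s1_def s2_def s3_def price_frame del: run_simps)
  then show ?thesis using 1 2 3 4 by (auto simp: m_def min_def)
qed

lemma ROUND_correct:
  fixes s :: state
  defines "e \<equiv> reals s ''e''" and "B \<equiv> reals s ''B'' 0" and "i \<equiv> nats s ''i'' 0"
    and "A' \<equiv> arr (nats s) ''A''" and "T \<equiv> arr (nats s) ''S''" and "R \<equiv> arr (nats s) ''Q''"
    and "lo \<equiv> reals s ''c'' (nats s ''i'' 0)"
  assumes ok: "costs_ok s" and disj: "T \<inter> R = {}" and i: "i \<in> A'" "i \<notin> T" "i \<notin> R"
    and lo: "0 \<le> lo" "lo \<le> B" and P: "rep (price s ''P'') E"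
  defines "t \<equiv> run ROUND s"
  shows "(arr (nats t) ''S'', arr (nats t) ''Q'') = gstep e (\<lambda>_ _. True) (T, R)"
    and "rep (price t ''P'') (E \<union> {b. lo \<le> b \<and> b \<le> B \<and> beats e i b (T, R) \<and>
      (\<exists>U\<subseteq>A'. 1 \<le> card U \<and> card U \<le> 3 \<and>
        (\<exists>x\<in>valued.bids A' v e B n i lo (2 * v (insert i T)) U. b \<le> x))})"
proof -
  have A': "A' \<subseteq> {..<n}" unfolding A'_def by (rule arr_less)
  interpret VA: valued A' v using A' by (rule valued_subset)
  let ?V = "2 * v (insert i T)"
  let ?c = "BAnd (BOr (rless (RLin (LGet ''c'' (At ''i''))) (price_exp ''W''))
           (BAnd (RLe (RLin (LGet ''c'' (At ''i''))) (price_exp ''W'')) (member ''W'' (NConst 0))))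
         (RLe (RLin (LConst 0)) (price_exp ''M''))"
  let ?E = "{x. \<exists>U\<subseteq>A'. 1 \<le> card U \<and> card U \<le> 3 \<and> x \<in> VA.bids e B n i lo ?V U}"
  let ?D = "{b. lo \<le> b \<and> b \<le> B \<and> beats e i b (T, R) \<and>
      (\<exists>U\<subseteq>A'. 1 \<le> card U \<and> card U \<le> 3 \<and> (\<exists>x\<in>VA.bids e B n i lo ?V U. b \<le> x))}"
  define s1 where "s1 = run (CRIT ''S'' ''Q'' ''W'') s"
  define s2 where "s2 = run (LSet ''V'' (NConst 0) (LAdd (Real ''F'') (Real ''F''))) s1"
  define s3 where "s3 = run XP s2"
  define s4 where "s4 = run (Cond ?c PAYUPD Skip) s3"
  have t: "t = run (STEP ''S'' ''Q'' (NLe (NConst 0) (NConst 0))) s4"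
    by (simp only: t_def ROUND_def run_simps s1_def s2_def s3_def s4_def)
  have iN: "i < n" using i A' by auto
  have crit: "arr (nats s1) ''S'' = T" "reals s1 ''F'' 0 = v (insert i T)"
    "\<And>y. 0 \<le> y \<Longrightarrow> y \<le> B \<Longrightarrow> beats e i y (T, R) \<longleftrightarrow> below y (price s1 ''W'') (nats s1 ''W'' 0 \<noteq> 0)"
    using CRIT_correct[of s "''S''" "''Q''" "''W''" i, OF ok] disj i iN
    by (simp_all add: s1_def T_def R_def i_def e_def B_def)
  have f1: "nats s1 x = nats s x" if "x \<in> {''n'', ''i'', ''A'', ''Q''}" for x
    using that by (auto simp: s1_def nats_frame)
  have r1: "reals s1 x = reals s x" if "x \<in> {''e'', ''B'', ''c'', ''P''}" for x
    using that by (auto simp: s1_def reals_frame)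
  have s2: "nats s2 = nats s1" "reals s2 ''V'' 0 = ?V" using crit(2) by (simp_all add: s2_def store_eq)
  have r2: "reals s2 x = reals s1 x" if "x \<noteq> ''V''" for x using that by (simp add: s2_def store_neq)
  have ok2: "costs_ok s2" using ok f1[of "''n''"] r1[of "''e''"] r2[of "''e''"] s2 by (simp add: costs_ok_def)
  have M: "rep (price s3 ''M'') ?E"
    using XP_correct[OF ok2, folded s3_def] i lo s2 f1 r1 r2
    by (simp add: e_def B_def i_def A'_def lo_def arr_def)
  have f3: "nats s3 x = nats s2 x" if "x \<in> {''n'', ''i'', ''A'', ''Q'', ''S'', ''W''}" for x
    using that by (auto simp: s3_def nats_frame)
  have r3: "reals s3 x = reals s2 x" if "x \<in> {''e'', ''B'', ''c'', ''P'', ''W''}" for x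
    using that by (auto simp: s3_def reals_frame)
  have p3: "price s3 ''W'' = price s1 ''W''" "price s3 ''P'' = price s ''P''"
    using r1 r2 r3 by (simp_all add: price_def)
  have v3: "reals s3 ''c'' (nats s3 ''i'' 0) = lo" "nats s3 ''W'' 0 = nats s1 ''W'' 0" "reals s3 ''B'' 0 = B"
    using f1 f3 r1 r2 r3 s2 by (simp_all add: lo_def B_def)
  have bv: "bval ?c s3 \<longleftrightarrow> below lo (price s1 ''W'') (nats s1 ''W'' 0 \<noteq> 0) \<and> 0 \<le> price s3 ''M''"
    using v3 p3(1) by (auto simp: below_def price_def)
  have p4: "price s4 ''P'' = (if bval ?c s3 then (if price s ''P'' \<le> min B (min (price s1 ''W'') (price s3 ''M''))
      then min B (min (price s1 ''W'') (price s3 ''M'')) else price s ''P'') else price s ''P'')"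
    unfolding s4_def run_simps using PAYUPD_correct[of s3] v3 p3 by simp
  have D: "?D = {b. lo \<le> b \<and> b \<le> B \<and> below b (price s1 ''W'') (nats s1 ''W'' 0 \<noteq> 0) \<and> (\<exists>x\<in>?E. b \<le> x)}"
  proof (rule Collect_cong)
    fix b
    have bids: "(\<exists>U\<subseteq>A'. 1 \<le> card U \<and> card U \<le> 3 \<and> (\<exists>x\<in>VA.bids e B n i lo ?V U. b \<le> x)) \<longleftrightarrow> (\<exists>x\<in>?E. b \<le> x)"
      by blast
    have "lo \<le> b \<Longrightarrow> b \<le> B \<Longrightarrow> beats e i b (T, R) \<longleftrightarrow> below b (price s1 ''W'') (nats s1 ''W'' 0 \<noteq> 0)"
      by (rule crit(3)) (use lo(1) in auto)
    then show "(lo \<le> b \<and> b \<le> B \<and> beats e i b (T, R) \<and>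
        (\<exists>U\<subseteq>A'. 1 \<le> card U \<and> card U \<le> 3 \<and> (\<exists>x\<in>VA.bids e B n i lo ?V U. b \<le> x))) \<longleftrightarrow>
      (lo \<le> b \<and> b \<le> B \<and> below b (price s1 ''W'') (nats s1 ''W'' 0 \<noteq> 0) \<and> (\<exists>x\<in>?E. b \<le> x))"
      unfolding bids by argo
  qed
  have E_lo: "lo \<le> x" if "x \<in> ?E" for x
    using that lo(2) by (auto simp: VA.bids_def split: if_splits)
  have "rep (price s4 ''P'') (E \<union> ?D)"
  proof (cases "bval ?c s3")
    case True
    then have "rep (min B (min (price s1 ''W'') (price s3 ''M''))) ?D"
      unfolding D using bv lo E_lo by (intro rep_min[OF M]) blast+
    from rep_if[OF P this] show ?thesis unfolding p4 if_P[OF True] .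
  next
    case False
    \<comment> \<open>Either \<open>i\<close> does not beat the state at its true cost, and at
      higher bids even less, or no bid reaches \<open>V\<close>.\<close>
    have "?D = {}"
    proof (cases "0 \<le> price s3 ''M''")
      case True
      then have "\<not> below lo (price s1 ''W'') (nats s1 ''W'' 0 \<noteq> 0)" using False bv by blast
      then show ?thesis unfolding D by (auto simp: below_def)
    next
      case F: False
      then have "?E = {}" using M unfolding rep_def by blast
      then show ?thesis unfolding D by blast
    qed
    then show ?thesis unfolding p4 if_not_P[OF False] using P by (simp only: Un_empty_right)
  qed
  moreover have "price t ''P'' = price s4 ''P''" by (simp add: t price_frame)
  ultimately show "rep (price t ''P'') (E \<union> ?D)" by simp
  have f4: "nats s4 x = nats s3 x" "reals s4 ''e'' = reals s3 ''e''" for x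
    using nats_frame[of x "Cond ?c PAYUPD Skip" s3] reals_frame[of "''e''" "Cond ?c PAYUPD Skip" s3]
    unfolding s4_def by (simp_all del: run_simps)
  have a4: "arr (nats s4) ''S'' = T" "arr (nats s4) ''Q'' = R" "reals s4 ''e'' = e"
    using f4 f3 s2 f1 crit(1) r1 r2 r3 by (simp_all add: R_def e_def arr_def)
  have ok4: "costs_ok s4" using ok2 f4 f3 r3 by (simp add: costs_ok_def)
  show "(arr (nats t) ''S'', arr (nats t) ''Q'') = gstep e (\<lambda>_ _. True) (T, R)"
    using STEP_arr[OF ok4, of "''S''" "''Q''" "NLe (NConst 0) (NConst 0)" "\<lambda>_ _. True", folded t] disj a4
    by simp
qed

text \<open>The loop copies only the first \<open>n\<close> cells; the premise on the other cells
  makes the arrays equal as functions, as the set-level definitions require.\<close>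

lemma BEGIN_correct:
  fixes s :: state
  defines "i \<equiv> nats s ''i'' 0" and "t \<equiv> run BEGIN s"
  assumes n: "nats s ''n'' 0 = n" and tail: "\<And>k. n \<le> k \<Longrightarrow> reals s ''c'' k = 0 \<and> reals s ''e'' k = 0"
    and i: "i < n"
  shows "reals t ''e'' = (reals s ''c'')(i := 0)" "arr (nats t) ''Q'' = arr (nats s) ''A'' - {i}"
    "arr (nats t) ''S'' = {}" "price t ''P'' = - 1"
proof -
  define s1 where "s1 = run (For_all ''k'' (LSet ''e'' (At ''k'') (LGet ''c'' (At ''k'')))) s"
  define s2 where "s2 = run (LSet ''e'' (At ''i'') (LConst 0)) s1"
  define s3 where "s3 = run (COPY ''Q'' ''A'') s2"
  define s4 where "s4 = run (NSet ''Q'' (At ''i'') (NConst 0)) s3"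
  define s5 where "s5 = run (CLEAR ''S'') s4"
  have t: "t = run (SETP ''P'' (LConst (- 1))) s5"
    by (simp only: t_def BEGIN_def run_simps s1_def s2_def s3_def s4_def s5_def)
  have "reals s1 ''c'' = reals s ''c'' \<and> (\<forall>k. reals s1 ''e'' k = (if k < n then reals s ''c'' k else reals s ''e'' k))"
    unfolding s1_def
    by (rule For_rule[where P = "\<lambda>k t. reals t ''c'' = reals s ''c'' \<and>
        (\<forall>j. reals t ''e'' j = (if j < k then reals s ''c'' j else reals s ''e'' j))"])
      (use n in \<open>auto simp: store_apply store_neq\<close>)
  then have e1: "reals s1 ''e'' = reals s ''c''" using tail by (auto simp: fun_eq_iff)
  have n1: "nats s1 x = nats s x" if "x \<noteq> ''k''" for x using that by (simp add: s1_def nats_frame)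
  have e2: "reals s2 ''e'' = (reals s ''c'')(i := 0)" using e1 n1 by (simp add: s2_def store_eq i_def)
  have n2: "nats s2 = nats s1" by (simp add: s2_def)
  then show "reals t ''e'' = (reals s ''c'')(i := 0)"
    using e2 by (simp add: t s5_def s4_def s3_def reals_frame)
  have "arr (nats s3) ''Q'' = arr (nats s) ''A''"
    using COPY_arr[of s2 "''Q''" "''A''"] n n1 n2 by (simp add: s3_def arr_def)
  moreover have "nats s3 ''i'' 0 = i" using n1 n2 by (simp add: s3_def nats_frame i_def)
  ultimately have "arr (nats s4) ''Q'' = arr (nats s) ''A'' - {i}" by (simp add: s4_def arr_store)
  then show "arr (nats t) ''Q'' = arr (nats s) ''A'' - {i}" by (simp add: t s5_def arr_frame)
  have "nats s4 ''n'' 0 = n" using n n1 n2 by (simp add: s4_def s3_def nats_frame store_neq)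
  then show "arr (nats t) ''S'' = {}" using CLEAR_arr[of s4 "''S''"] by (simp add: t s5_def arr_frame)
  show "price t ''P'' = - 1" by (simp add: t price_SETP)
qed

text \<open>The last conclusion hands the premise on \<open>e\<close> on to the next seller.\<close>

lemma SELLER_correct:
  fixes s :: state
  defines "i \<equiv> nats s ''i'' 0" and "c \<equiv> reals s ''c''" and "B \<equiv> reals s ''B'' 0" and "t \<equiv> run SELLER s"
  defines "f \<equiv> heads_alloc (sviridenko v B) v B {..<n}"
  assumes n: "nats s ''n'' 0 = n" and tail: "\<And>k. n \<le> k \<Longrightarrow> c k = 0 \<and> reals s ''e'' k = 0"
    and c: "cost_vector_on {..<n} c" and B: "0 < B"
    and A: "arr (nats s) ''A'' = affordable B {..<n} c" and i: "i \<in> affordable B {..<n} c"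
  shows "nats t ''win'' = (if i \<in> f c then (nats s ''win'')(i := 1) else nats s ''win'')"
    "pays t = (if i \<in> f c then (pays s)(i := threshold_payment f c i) else pays s)"
    "reals t ''c'' = c" "reals t ''B'' 0 = B" "nats t ''n'' 0 = n" "nats t ''A'' = nats s ''A''"
    "n \<le> k \<Longrightarrow> reals t ''e'' k = 0"
proof -
  let ?A = "affordable B {..<n} c" and ?e = "c(i := 0)"
  let ?G = "greedy_state ?e (?A - {i})"
  have iN: "i < n" and iB: "c i \<le> B" using i by (auto simp: affordable_def)
  have ci: "0 \<le> c i" using c iN by (simp add: cost_vector_on_def)
  define s1 where "s1 = run BEGIN s"
  define s2 where "s2 = run (For_all ''s'' ROUND) s1"
  have t: "t = run (Cond (RLe (RLin (LConst 0)) (price_exp ''P''))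
       (NSet ''win'' (At ''i'') (NConst 1) ;; Pay (At ''i'') (price_exp ''P'')) Skip) s2"
    by (simp only: t_def SELLER_def run_simps s1_def s2_def)
  have b: "reals s1 ''e'' = ?e" "arr (nats s1) ''Q'' = ?A - {i}" "arr (nats s1) ''S'' = {}" "price s1 ''P'' = - 1"
    using BEGIN_correct[of s, folded s1_def i_def] n tail iN A by (simp_all add: c_def)
  define fr where "fr u \<longleftrightarrow> nats u ''n'' 0 = n \<and> nats u ''i'' 0 = i \<and> nats u ''A'' = nats s ''A'' \<and>
      reals u ''e'' = ?e \<and> reals u ''B'' 0 = B \<and> reals u ''c'' = c" for u :: state
  have fr1: "fr s1" using b n by (simp add: fr_def s1_def nats_frame reals_frame i_def B_def c_def)
  have rivals: "?A - {i} \<subseteq> {..<n}" using affordable_subset[of B "{..<n}" c] by auto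
  have "fr s2 \<and> (arr (nats s2) ''S'', arr (nats s2) ''Q'') = ?G n \<and>
      rep (price s2 ''P'') (\<Union>k<n. winning_bids c B n i k)"
    unfolding s2_def
  proof (rule For_rule[where P = "\<lambda>k u. fr u \<and> (arr (nats u) ''S'', arr (nats u) ''Q'') = ?G k \<and>
      rep (price u ''P'') (\<Union>k<k. winning_bids c B n i k)"])
    show "fr s1 \<and> (arr (nats s1) ''S'', arr (nats s1) ''Q'') = ?G 0 \<and>
        rep (price s1 ''P'') (\<Union>k<0. winning_bids c B n i k)"
      using fr1 b by (simp add: greedy_state_def rep_empty)
    show "nval (At ''n'') s1 = n" using fr1 by (simp add: fr_def)
    fix k u
    assume u: "fr u \<and> (arr (nats u) ''S'', arr (nats u) ''Q'') = ?G k \<and>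
        rep (price u ''P'') (\<Union>k<k. winning_bids c B n i k)"
    define u0 where "u0 = enter ''s'' k u"
    have fr0: "fr u0" using u by (simp add: u0_def fr_def store_neq)
    have SQ: "arr (nats u0) ''S'' = fst (?G k)" "arr (nats u0) ''Q'' = snd (?G k)"
      using u by (auto simp: u0_def arr_store prod_eq_iff)
    have eqs: "reals u0 ''e'' = ?e" "reals u0 ''B'' 0 = B" "nats u0 ''i'' 0 = i" "reals u0 ''c'' = c"
      "arr (nats u0) ''A'' = ?A"
      using fr0 A by (simp_all add: fr_def arr_def)
    have ok0: "costs_ok u0" using fr0 c by (simp add: fr_def costs_ok_def cost_vector_on_def)
    have st: "snd (?G k) = ?A - {i} - fst (?G k)" "fst (?G k) \<subseteq> ?A - {i}"
      using greedy_state_snd[OF rivals] greedy_state_subset[OF rivals] by blast+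
    have disj: "fst (?G k) \<inter> snd (?G k) = {}" and iG: "i \<notin> fst (?G k)" "i \<notin> snd (?G k)" using st by auto
    have P0: "rep (price u0 ''P'') (\<Union>k<k. winning_bids c B n i k)" using u by (simp add: u0_def price_enter)
    note R = ROUND_correct[OF ok0, unfolded eqs SQ prod.collapse, OF _ i _ _ ci iB P0]
    have "fr (run ROUND u0)" using fr0 by (simp add: fr_def nats_frame reals_frame)
    moreover have "(arr (nats (run ROUND u0)) ''S'', arr (nats (run ROUND u0)) ''Q'') = ?G (Suc k)"
      using R(1)[OF disj iG] by (simp add: greedy_state_def)
    moreover have "rep (price (run ROUND u0) ''P'') (\<Union>k<Suc k. winning_bids c B n i k)"
    proof -
      have "winning_bids c B n i k = {b. c i \<le> b \<and> b \<le> B \<and> beats ?e i b (?G k) \<and>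
        (\<exists>U\<subseteq>?A. 1 \<le> card U \<and> card U \<le> 3 \<and>
          (\<exists>x\<in>valued.bids ?A v ?e B n i (c i) (2 * v (insert i (fst (?G k)))) U. b \<le> x))}"
        by (simp add: winning_bids_def Let_def)
      then have "rep (price (run ROUND u0) ''P'') ((\<Union>k<k. winning_bids c B n i k) \<union> winning_bids c B n i k)"
        using R(2)[OF disj iG] by (simp only:)
      moreover have "(\<Union>k<k. winning_bids c B n i k) \<union> winning_bids c B n i k = (\<Union>k<Suc k. winning_bids c B n i k)"
        by (auto simp: less_Suc_eq)
      ultimately show ?thesis by simp
    qed
    ultimately show "fr (run ROUND (enter ''s'' k u)) \<and>
        (arr (nats (run ROUND (enter ''s'' k u))) ''S'', arr (nats (run ROUND (enter ''s'' k u))) ''Q'') = ?G (Suc k) \<and>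
        rep (price (run ROUND (enter ''s'' k u)) ''P'') (\<Union>k<Suc k. winning_bids c B n i k)"
      unfolding u0_def by blast
  qed
  then have fr2: "fr s2" and P2: "rep (price s2 ''P'') (\<Union>k<n. winning_bids c B n i k)" by auto
  have pay: "i \<in> f c \<longleftrightarrow> 0 \<le> price s2 ''P''" "0 \<le> price s2 ''P'' \<Longrightarrow> threshold_payment f c i = price s2 ''P''"
    using heads_sviridenko_payment[OF B c i _ P2] by (simp_all add: f_def)
  have "bval (RLe (RLin (LConst 0)) (price_exp ''P'')) s2 \<longleftrightarrow> i \<in> f c" using pay(1) by (simp add: price_def)
  then have t': "t = (if i \<in> f c then run (NSet ''win'' (At ''i'') (NConst 1) ;; Pay (At ''i'') (price_exp ''P'')) s2 else s2)"
    unfolding t by (simp only: run_simps)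
  have old: "nats s2 ''win'' = nats s ''win''" "pays s2 = pays s"
    by (simp_all add: s2_def s1_def nats_frame pays_frame)
  have i2: "nats s2 ''i'' 0 = i" using fr2 by (simp add: fr_def)
  show "nats t ''win'' = (if i \<in> f c then (nats s ''win'')(i := 1) else nats s ''win'')"
    unfolding t' using old i2 by (simp add: store_eq)
  show "pays t = (if i \<in> f c then (pays s)(i := threshold_payment f c i) else pays s)"
    unfolding t' using old i2 pay by (simp add: price_def store_neq)
  have "fr t" unfolding t' using fr2 by (simp add: fr_def store_neq)
  then show "reals t ''c'' = c" "reals t ''B'' 0 = B" "nats t ''n'' 0 = n" "nats t ''A'' = nats s ''A''"
    "n \<le> k \<Longrightarrow> reals t ''e'' k = 0"
    using tail iN by (simp_all add: fr_def)
qed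


section \<open>The two branches of the coin and the whole program\<close>

lemma AFFORD_correct:
  assumes n: "nats s ''n'' 0 = n" and "\<And>k. nats s ''A'' k = 0"
  shows "arr (nats (run AFFORD s)) ''A'' = affordable (reals s ''B'' 0) {..<n} (reals s ''c'')"
proof -
  have "\<forall>k. nats (run AFFORD s) ''A'' k = (if k < n \<and> reals s ''c'' k \<le> reals s ''B'' 0 then 1 else 0) \<and>
      reals (run AFFORD s) = reals s"
    unfolding AFFORD_def
    by (rule For_rule[where P = "\<lambda>j t. \<forall>k. nats t ''A'' k = (if k < j \<and> reals s ''c'' k \<le> reals s ''B'' 0 then 1 else 0) \<and>
        reals t = reals s"])
      (use assms in \<open>auto simp: store_apply store_neq less_Suc_eq\<close>)
  then show ?thesis by (auto simp: arr_def affordable_def)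
qed

lemma HEADS_correct:
  fixes s :: state
  defines "c \<equiv> reals s ''c''" and "B \<equiv> reals s ''B'' 0" and "t \<equiv> run HEADS s"
  defines "f \<equiv> heads_alloc (sviridenko v B) v B {..<n}"
  assumes n: "nats s ''n'' 0 = n" and tail: "\<And>k. n \<le> k \<Longrightarrow> c k = 0 \<and> reals s ''e'' k = 0"
    and c: "cost_vector_on {..<n} c" and B: "0 < B"
    and A: "arr (nats s) ''A'' = affordable B {..<n} c"
    and init: "\<And>i. nats s ''win'' i = 0" "\<And>i. pays s i = 0"
  shows "members t ''win'' = f c" "\<And>i. i < n \<Longrightarrow> pays t i = threshold_payment f c i"
proof -
  interpret O: om "{..<n}" v B "exp 1 / (exp 1 - 1)" "sviridenko v B" using B by (rule om_sviridenko)
  have sub: "f c \<subseteq> affordable B {..<n} c" unfolding f_def by (rule O.heads_alloc_subset)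
  define P where "P k u \<longleftrightarrow> reals u ''c'' = c \<and> reals u ''B'' 0 = B \<and> nats u ''n'' 0 = n \<and>
      nats u ''A'' = nats s ''A'' \<and> (\<forall>k\<ge>n. reals u ''e'' k = 0) \<and>
      (\<forall>i. nats u ''win'' i \<noteq> 0 \<longleftrightarrow> i < k \<and> i \<in> f c) \<and>
      (\<forall>i. pays u i = (if i < k then threshold_payment f c i else 0))" for k and u :: state
  have "P n t"
    unfolding t_def HEADS_def
  proof (rule For_rule)
    show "P 0 s" using n tail init by (simp add: P_def c_def B_def)
    show "nval (At ''n'') s = n" using n by simp
    fix k u assume k: "k < n" and u: "P k u"
    define u0 where "u0 = enter ''i'' k u"
    have u0: "reals u0 ''c'' = c" "reals u0 ''B'' 0 = B" "nats u0 ''n'' 0 = n" "nats u0 ''A'' = nats s ''A''"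
      "\<And>k. n \<le> k \<Longrightarrow> reals u0 ''e'' k = 0" "nats u0 ''i'' 0 = k" "nats u0 ''win'' = nats u ''win''"
      "pays u0 = pays u"
      using u by (simp_all add: P_def u0_def store_neq store_eq)
    have win: "nats u ''win'' i \<noteq> 0 \<longleftrightarrow> i < k \<and> i \<in> f c"
      and pay: "pays u i = (if i < k then threshold_payment f c i else 0)" for i
      using u by (simp_all add: P_def)
    have memA: "nats s ''A'' k \<noteq> 0 \<longleftrightarrow> k \<in> affordable B {..<n} c" using A k by (auto simp: arr_def)
    have "P (Suc k) (run (Cond (member ''A'' (At ''i'')) SELLER Skip) u0)"
    proof (cases "k \<in> affordable B {..<n} c")
      case True
      then have "run (Cond (member ''A'' (At ''i'')) SELLER Skip) u0 = run SELLER u0"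
        using memA u0 by simp
      moreover have A0: "arr (nats u0) ''A'' = affordable B {..<n} c" using A u0(4) by (simp add: arr_def)
      note S = SELLER_correct[of u0, unfolded u0(1,2,6), folded f_def, OF u0(3) _ c B A0 True]
      have tl: "c j = 0 \<and> reals u0 ''e'' j = 0" if "n \<le> j" for j using tail[OF that] u0(5)[OF that] by blast
      have "P (Suc k) (run SELLER u0)"
        unfolding P_def
      proof (intro conjI allI impI)
        show "nats (run SELLER u0) ''win'' i \<noteq> 0 \<longleftrightarrow> i < Suc k \<and> i \<in> f c" for i
          using S(1)[OF tl] u0(7) win[of i] by (auto simp: less_Suc_eq)
        show "pays (run SELLER u0) i = (if i < Suc k then threshold_payment f c i else 0)" for i
          using S(2)[OF tl] u0(8) pay[of i] by (auto simp: less_Suc_eq threshold_payment_def)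
      qed (use S(3-)[OF tl] u0(4) in simp_all)
      ultimately show ?thesis by simp
    next
      case False
      then have "run (Cond (member ''A'' (At ''i'')) SELLER Skip) u0 = u0"
        using memA u0 by simp
      moreover have "k \<notin> f c" using False sub by blast
      moreover from this have "threshold_payment f c k = 0" by (simp add: threshold_payment_def)
      ultimately show ?thesis
        using u0 win pay by (auto simp: P_def less_Suc_eq)
    qed
    then show "P (Suc k) (run (Cond (member ''A'' (At ''i'')) SELLER Skip) (enter ''i'' k u))"
      by (simp only: u0_def)
  qed
  then show "members t ''win'' = f c" "\<And>i. i < n \<Longrightarrow> pays t i = threshold_payment f c i"
    using sub affordable_subset[of B "{..<n}" c] by (auto simp: P_def)
qed

lemma TAILS_correct:
  fixes s :: state
  defines "c \<equiv> reals s ''c''" and "B \<equiv> reals s ''B'' 0" and "t \<equiv> run TAILS s"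
  defines "f \<equiv> tails_alloc v B {..<n}"
  assumes n: "nats s ''n'' 0 = n" and B: "0 < B"
    and A: "arr (nats s) ''A'' = affordable B {..<n} c"
    and init: "\<And>i. nats s ''win'' i = 0" "\<And>i. pays s i = 0"
  shows "members t ''win'' = f c" "\<And>i. i < n \<Longrightarrow> pays t i = threshold_payment f c i"
proof -
  let ?A = "affordable B {..<n} c"
  interpret VA: valued ?A v by (rule valued_affordable)
  define s1 where "s1 = run (For_all ''k'' (LSet ''e'' (At ''k'') (LConst 1))) s"
  define s2 where "s2 = run (CLEAR ''T'') s1"
  define s3 where "s3 = run (COPY ''R'' ''A'') s2"
  define s4 where "s4 = run (BEST ''T'' ''R'') s3"
  have t: "t = run (Cond (member ''j'' (NConst 1))
      (NSet ''win'' (At ''j'') (NConst 1) ;; Pay (At ''j'') (RLin (Real ''B''))) Skip) s4"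
    by (simp only: t_def TAILS_def run_simps s1_def s2_def s3_def s4_def)
  have "\<forall>k<n. reals s1 ''e'' k = 1"
    unfolding s1_def
    by (rule For_rule[where P = "\<lambda>j t. \<forall>k<j. reals t ''e'' k = 1"])
      (use n in \<open>auto simp: store_apply less_Suc_eq\<close>)
  then have e3: "reals s3 ''e'' k = 1" if "k < n" for k using that by (simp add: s3_def s2_def reals_frame)
  have n1: "nats s1 ''n'' 0 = n" "nats s1 ''A'' = nats s ''A''" using n by (simp_all add: s1_def nats_frame)
  have n2: "nats s2 ''n'' 0 = n" "nats s2 ''A'' = nats s ''A''" using n1 by (simp_all add: s2_def nats_frame)
  have n3: "nats s3 ''n'' 0 = n" using n2 by (simp add: s3_def nats_frame)
  have ok: "costs_ok s3" using n3 e3 by (simp add: costs_ok_def)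
  have T: "arr (nats s3) ''T'' = {}" using CLEAR_arr[of s1 "''T''"] n1 by (simp add: s3_def s2_def arr_frame)
  have R: "arr (nats s3) ''R'' = ?A" using COPY_arr[of s2 "''R''" "''A''"] n2 A by (simp add: s3_def arr_def)
  note best = BEST_arr[OF ok, of "''T''" "''R''", folded s4_def, unfolded T R]
  have old: "nats s4 ''win'' = nats s ''win''" "pays s4 = pays s" "reals s4 ''B'' 0 = B"
    by (simp_all add: s4_def s3_def s2_def s1_def nats_frame pays_frame reals_frame B_def)
  have sub: "f c \<subseteq> {..<n}" unfolding f_def by (rule tails_alloc_subset)
  have "members t ''win'' = f c \<and> (\<forall>i<n. pays t i = threshold_payment f c i)"
  proof (cases "?A = {}")
    case True
    then have "nats s4 ''j'' 1 = 0" using best(3) by simp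
    then have "t = s4" unfolding t by simp
    moreover have "f c = {}" using True by (simp add: f_def tails_alloc_def)
    ultimately show ?thesis using old init by (simp add: threshold_payment_def)
  next
    case False
    let ?m = "most_valuable v ?A"
    have "nats s4 ''j'' 1 \<noteq> 0" using best(3) False by simp
    then have found: "Suc 0 \<le> nats s4 ''j'' 1" by simp
    have "best_item v (reals s3 ''e'') {} ?A = ?m"
      unfolding VA.most_valuable_eq_best[OF False] using e3 affordable_subset[of B "{..<n}" c]
      by (intro best_item_cong) auto
    then have j: "nats s4 ''j'' 0 = ?m" using best(4) False by simp
    have fc: "f c = {?m}" using False by (simp add: f_def tails_alloc_def)
    then have m: "?m < n" using sub by auto
    have pay: "threshold_payment f c ?m = B"
      unfolding f_def using m fc by (intro tails_payment_eq B) (auto simp: f_def)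
    show ?thesis
      unfolding t using found j old init m fc pay
      by (auto simp: store_eq store_neq threshold_payment_def)
  qed
  then show "members t ''win'' = f c" "\<And>i. i < n \<Longrightarrow> pays t i = threshold_payment f c i" by auto
qed

lemma MECHANISM_correct:
  fixes c :: "nat \<Rightarrow> real" and heads :: bool
  assumes B: "0 < B" and c: "cost_vector_on {..<n} c"
  defines "t \<equiv> run MECHANISM (initial_state n B c heads)"
    and "f \<equiv> (if heads then heads_alloc (sviridenko v B) v B {..<n} else tails_alloc v B {..<n})"
  shows "members t ''win'' = f c" "\<And>i. i < n \<Longrightarrow> pays t i = threshold_payment f c i"
proof -
  \<comment> \<open>The cost vector as the machine sees it; the result is carried over to
    \<open>c\<close> by congruence.\<close>
  let ?d = "\<lambda>i. if i < n then c i else 0"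
  let ?s = "initial_state n B c heads"
  define s where "s = run AFFORD ?s"
  have cong: "f c = f c'" if "\<And>x. x < n \<Longrightarrow> c x = c' x" for c c'
    unfolding f_def using that B heads_sviridenko_cong[of B c c'] tails_cong[of c c' B] by simp
  have fd: "f ?d = f c" by (rule cong) simp
  have pd: "threshold_payment f ?d i = threshold_payment f c i" for i
  proof (rule threshold_payment_cong)
    show "f c1 = f c2" if "\<And>x. x \<in> {..<n} \<Longrightarrow> c1 x = c2 x" for c1 c2
      using that by (intro cong) simp
  qed simp
  have d: "cost_vector_on {..<n} ?d" using c by (simp add: cost_vector_on_def)
  have init: "nats ?s ''n'' 0 = n" "nats ?s ''A'' k = 0" "nats ?s ''win'' k = 0" "pays ?s k = 0"
    "reals ?s ''B'' 0 = B" "reals ?s ''c'' = ?d" "reals ?s ''e'' k = 0"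
    "nats ?s ''coin'' 0 = (if heads then 1 else 0)" for k
    by (simp_all add: initial_state_def store_apply store_neq)
  have s: "nats s ''n'' 0 = n" "nats s ''win'' k = 0" "pays s k = 0" "reals s ''B'' 0 = B"
    "reals s ''c'' = ?d" "reals s ''e'' k = 0" "nats s ''coin'' 0 = (if heads then 1 else 0)" for k
  proof -
    have "''n'' \<notin> nmods AFFORD" "''win'' \<notin> nmods AFFORD" "''coin'' \<notin> nmods AFFORD" "pay_free AFFORD" "rmods AFFORD = {}"
      by (simp_all add: AFFORD_def)
    then show "nats s ''n'' 0 = n" "nats s ''win'' k = 0" "pays s k = 0" "reals s ''B'' 0 = B"
      "reals s ''c'' = ?d" "reals s ''e'' k = 0" "nats s ''coin'' 0 = (if heads then 1 else 0)"
      using init by (simp_all add: s_def nats_frame reals_frame pays_frame)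
  qed
  have A: "arr (nats s) ''A'' = affordable B {..<n} ?d"
    using AFFORD_correct[of ?s, OF init(1,2)] init by (simp add: s_def)
  have t: "t = run (if heads then HEADS else TAILS) s"
    using s by (simp add: t_def MECHANISM_def s_def)
  have "members t ''win'' = f ?d \<and> (\<forall>i<n. pays t i = threshold_payment f ?d i)"
  proof (cases heads)
    case True
    have "members t ''win'' = f ?d" "\<And>i. i < n \<Longrightarrow> pays t i = threshold_payment f ?d i"
      using HEADS_correct[of s, unfolded s(4,5), OF s(1) _ d B A s(2,3)] s(6) True
      by (simp_all add: t f_def)
    then show ?thesis by simp
  next
    case False
    have "members t ''win'' = f ?d" "\<And>i. i < n \<Longrightarrow> pays t i = threshold_payment f ?d i"
      using TAILS_correct[of s, unfolded s(4,5), OF s(1) B A s(2,3)] False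
      by (simp_all add: t f_def)
    then show ?thesis by simp
  qed
  then show "members t ''win'' = f c" "\<And>i. i < n \<Longrightarrow> pays t i = threshold_payment f c i"
    unfolding fd pd by auto
qed

end

section \<open>Polynomial running time and the theorem\<close>

lemma polynomial_time_modified_random_om:
  "polynomial_time (\<lambda>v B A. random_om_branch (sviridenko v B) (1/2) v B A)"
  unfolding polynomial_time_def
proof (intro exI allI impI)
  fix n :: nat and v :: "nat set \<Rightarrow> real" and B :: real and c :: "nat \<Rightarrow> real" and heads
  assume asm: "0 < B \<and> valuation_on {..<n} v \<and> cost_vector_on {..<n} c"
  then interpret machine n v by unfold_locales auto
  let ?s = "initial_state n B c heads"
  have n: "nats ?s ''n'' 0 = n" by (simp add: initial_state_def store_apply)
  note time = exec_time[OF loops_ok_MECHANISM n_MECHANISM n]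
  show "let (s, t) = exec n v MECHANISM ?s; (f, pay) = random_om_branch (sviridenko v B) (1/2) v B {..<n} heads in
      t \<le> poly (time_poly MECHANISM) n \<and> {i. i < n \<and> nats s ''win'' i \<noteq> 0} = f c \<and>
      (\<forall>i<n. pays s i = pay c i)"
    using time MECHANISM_correct[where B = B and c = c and heads = heads] asm
    by (simp add: case_prod_beta Let_def run_def random_om_branch_eq with_threshold_payments_def)
qed

theorem theorem3p16:
  fixes A :: "'a::linorder set" and v :: "'a set \<Rightarrow> real" and B :: real
  assumes "finite A" and "0 < B" and "valuation_on A v"
  shows "(\<forall>Orc r. 1 \<le> r \<and> approx_oracle r A v B Orc \<longrightarrow>
            universally_truthful A (modified_random_om Orc (1/2) v B A) \<and>
            (at_most_one_worthless A v \<longrightarrow>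
               budget_feasible A B (modified_random_om Orc (1/2) v B A)) \<and>
            approximates_opt (4 * r) A v B (modified_random_om Orc (1/2) v B A)) \<and>
         universally_truthful A (modified_random_om (sviridenko v B) (1/2) v B A) \<and>
         (at_most_one_worthless A v \<longrightarrow>
            budget_feasible A B (modified_random_om (sviridenko v B) (1/2) v B A)) \<and>
         approximates_opt (4 * exp 1 / (exp 1 - 1)) A v B
           (modified_random_om (sviridenko v B) (1/2) v B A) \<and>
         polynomial_time (\<lambda>v B A. random_om_branch (sviridenko v B) (1/2) v B A)"
proof -
  interpret valued A v using assms by unfold_locales
  have general: "universally_truthful A (modified_random_om Orc (1/2) v B A) \<and>
      (at_most_one_worthless A v \<longrightarrow> budget_feasible A B (modified_random_om Orc (1/2) v B A)) \<and>
      approximates_opt (4 * r) A v B (modified_random_om Orc (1/2) v B A)"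
    if "1 \<le> r" "approx_oracle r A v B Orc" for Orc r
  proof -
    interpret om A v B r Orc using assms(2) that by unfold_locales
    show ?thesis using mechanism_properties by blast
  qed
  have "approx_oracle (exp 1 / (exp 1 - 1)) A v B (sviridenko v B)"
    using assms(2) by (intro approx_oracle_sviridenko) simp
  note general[OF one_le_sviridenko_ratio this, unfolded times_divide_eq_right]
  then show ?thesis using general polynomial_time_modified_random_om by blast
qed

end
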